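(* Let $B=\operatorname{diag}(-1,1)$, $Q=\begin{pmatrix}0&Q_{12}\\ Q_{21}&0\end{pmatrix}$ with $Q_{12},Q_{21}\in C[0,1]$, and let $C=(c_{jk}),D=(d_{jk})\in\mathbb{C}^{2\times2}$. Put $$J_{13}:=\det\begin{pmatrix}c_{11}&d_{11}\\ c_{21}&d_{21}\end{pmatrix},\qquad J_{42}:=\det\begin{pmatrix}d_{12}&c_{12}\\ d_{22}&c_{22}\end{pmatrix}.$$ Assume that $$J_{13}Q_{12}(0)-J_{42}Q_{21}(1)\neq0,\qquad J_{13}Q_{12}(1)-J_{42}Q_{21}(0)\neq0.$$ Then the system of root functions of the problem $-iBy'+Q(x)y=\lambda y$, $Cy(0)+Dy(1)=0$ is complete and minimal in $L^2([0,1];\mathbb{C}^2)$.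
   Context: The functions $Q_{12},Q_{21}$ are complex-valued, and $\operatorname{rank}(C\ D)=2$ is assumed. The problem is identified with the operator $L_{C,D}(Q)$ in $L^2([0,1];\mathbb{C}^2)$ acting by $Ly=-iBy'+Q(x)y$ on $\{y\in W^1_2([0,1];\mathbb{C}^2): Cy(0)+Dy(1)=0\}$. Root functions are eigenfunctions and associated functions; the system of root functions is the union, over all eigenvalues $\lambda$, of bases of the root subspaces $\operatorname{span}\{\ker(L_{C,D}(Q)-\lambda)^k: k\in\mathbb{N}\}$. A system is complete if its closed linear span is the whole space, and minimal if no element belongs to the closed linear span of the others. *)

theory Defs
  imports "HOL-Analysis.Analysis" "HOL-Library.Function_Algebras"
begin

text \<open>
  A function on \<open>[0,1]\<close> is represented by its extension by \<open>0\<close> to the real line.  Elements of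
  \<open>L\<^sup>2([0,1]; \<complex>\<^sup>2)\<close> are represented by functions, not by almost-everywhere classes; the operators
  below are closed under almost-everywhere changes of their values, and elements of the Sobolev
  space are represented by their unique continuous representatives.
\<close>

definition cscale :: "complex \<Rightarrow> (real \<Rightarrow> complex^2) \<Rightarrow> real \<Rightarrow> complex^2" where
  "cscale c f = (\<lambda>x. c *s f x)"

interpretation cfun: vector_space cscale
  by unfold_locales (auto simp: cscale_def fun_eq_iff vec_eq_iff algebra_simps)

definition L2 :: "(real \<Rightarrow> complex^2) set" where
  "L2 = {f. (\<forall>x. x \<notin> {0..1} \<longrightarrow> f x = 0) \<and>
            f \<in> borel_measurable (lebesgue_on {0..1}) \<and>
            integrable (lebesgue_on {0..1}) (\<lambda>x. (norm (f x))\<^sup>2)}"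

definition L2_norm :: "(real \<Rightarrow> complex^2) \<Rightarrow> real" where
  "L2_norm f = sqrt (LINT x|lebesgue_on {0..1}. (norm (f x))\<^sup>2)"

definition L2_closure :: "(real \<Rightarrow> complex^2) set \<Rightarrow> (real \<Rightarrow> complex^2) set" where
  "L2_closure S = {f \<in> L2. \<forall>\<epsilon>>0. \<exists>g\<in>S. L2_norm (f - g) < \<epsilon>}"

definition complete_system :: "(real \<Rightarrow> complex^2) set \<Rightarrow> bool" where
  "complete_system S \<longleftrightarrow> S \<subseteq> L2 \<and> L2_closure (cfun.span S) = L2"

definition minimal_system :: "(real \<Rightarrow> complex^2) set \<Rightarrow> bool" where
  "minimal_system S \<longleftrightarrow> S \<subseteq> L2 \<and> (\<forall>f\<in>S. f \<notin> L2_closure (cfun.span (S - {f})))"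

text \<open>
  \<open>W12_derivative y g\<close>: the function \<open>y\<close> is absolutely continuous on \<open>[0,1]\<close> and its derivative
  is (almost everywhere) the function \<open>g \<in> L\<^sup>2\<close>.
\<close>

definition W12_derivative :: "(real \<Rightarrow> complex^2) \<Rightarrow> (real \<Rightarrow> complex^2) \<Rightarrow> bool" where
  "W12_derivative y g \<longleftrightarrow> (\<forall>x. x \<notin> {0..1} \<longrightarrow> y x = 0) \<and> g \<in> L2 \<and>
     (\<forall>x\<in>{0..1}. y x = y 0 + (LINT t|lebesgue_on {0..x}. g t))"

definition B_mat :: "complex^2^2" where
  "B_mat = vector [vector [-1, 0], vector [0, 1]]"

definition Q_mat :: "(real \<Rightarrow> complex) \<Rightarrow> (real \<Rightarrow> complex) \<Rightarrow> real \<Rightarrow> complex^2^2" where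
  "Q_mat Q12 Q21 x = vector [vector [0, Q12 x], vector [Q21 x, 0]]"

text \<open>The \<open>2 \<times> 4\<close> block matrix \<open>(C D)\<close>, with columns indexed by the disjoint sum.\<close>

definition block_row :: "complex^2^2 \<Rightarrow> complex^2^2 \<Rightarrow> complex^(2 + 2)^2" where
  "block_row C D = (\<chi> i j. case j of Inl k \<Rightarrow> C $ i $ k | Inr k \<Rightarrow> D $ i $ k)"

text \<open>Unbounded operators are represented by their graphs.\<close>

definition op_L :: "complex^2^2 \<Rightarrow> complex^2^2 \<Rightarrow> (real \<Rightarrow> complex^2^2)
    \<Rightarrow> ((real \<Rightarrow> complex^2) \<times> (real \<Rightarrow> complex^2)) set" where
  "op_L C D Q = {(y, f). f \<in> L2 \<and> C *v y 0 + D *v y 1 = 0 \<and>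
     (\<exists>y'. W12_derivative y y' \<and>
        (AE x in lebesgue_on {0..1}. f x = (- \<i>) *s (B_mat *v y' x) + Q x *v y x))}"

definition op_shift :: "((real \<Rightarrow> complex^2) \<times> (real \<Rightarrow> complex^2)) set \<Rightarrow> complex
    \<Rightarrow> ((real \<Rightarrow> complex^2) \<times> (real \<Rightarrow> complex^2)) set" where
  "op_shift L \<mu> = {(y, f - cscale \<mu> y) | y f. (y, f) \<in> L}"

definition op_ker :: "((real \<Rightarrow> complex^2) \<times> (real \<Rightarrow> complex^2)) set
    \<Rightarrow> (real \<Rightarrow> complex^2) set" where
  "op_ker T = {y. (y, 0) \<in> T}"

definition eigenvalues :: "((real \<Rightarrow> complex^2) \<times> (real \<Rightarrow> complex^2)) set \<Rightarrow> complex set" where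
  "eigenvalues L = {\<mu>. \<exists>y. y \<noteq> 0 \<and> y \<in> op_ker (op_shift L \<mu>)}"

text \<open>Powers of operators are relational powers of their graphs, with the natural domains.\<close>

definition root_subspace :: "((real \<Rightarrow> complex^2) \<times> (real \<Rightarrow> complex^2)) set \<Rightarrow> complex
    \<Rightarrow> (real \<Rightarrow> complex^2) set" where
  "root_subspace L \<mu> = cfun.span (\<Union>k::nat. op_ker (op_shift L \<mu> ^^ k))"

text \<open>
  A system of root functions depends on the choice of a basis in each root subspace.
\<close>

definition root_function_system :: "((real \<Rightarrow> complex^2) \<times> (real \<Rightarrow> complex^2)) set
    \<Rightarrow> (real \<Rightarrow> complex^2) set \<Rightarrow> bool" where
  "root_function_system L S \<longleftrightarrow>
     (\<exists>b. (\<forall>\<mu>\<in>eigenvalues L. cfun.independent (b \<mu>) \<and> cfun.span (b \<mu>) = root_subspace L \<mu>) \<and>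
          S = (\<Union>\<mu>\<in>eigenvalues L. b \<mu>))"

definition J13 :: "complex^2^2 \<Rightarrow> complex^2^2 \<Rightarrow> complex" where
  "J13 C D = det (vector [vector [C $ 1 $ 1, D $ 1 $ 1],
                          vector [C $ 2 $ 1, D $ 2 $ 1]] :: complex^2^2)"

definition J42 :: "complex^2^2 \<Rightarrow> complex^2^2 \<Rightarrow> complex" where
  "J42 C D = det (vector [vector [D $ 1 $ 2, C $ 1 $ 2],
                          vector [D $ 2 $ 2, C $ 2 $ 2]] :: complex^2^2)"

end

theory Submission
  imports Defs "HOL-Complex_Analysis.Complex_Analysis"
begin

text \<open>
  Let \<open>\<phi>(\<cdot>, \<lambda>), \<psi>(\<cdot>, \<lambda>)\<close> be the fundamental solutions, \<open>U\<^sub>1, U\<^sub>2\<close> the two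
  boundary forms and \<open>\<Delta>(\<lambda>) = det M(\<lambda>)\<close>, where \<open>M\<close> is the matrix of the values of \<open>U\<^sub>1, U\<^sub>2\<close>
  on \<open>\<phi>, \<psi>\<close>. If \<open>h\<close> is orthogonal to all root functions, then there are entire functions
  \<open>q\<^sub>1, q\<^sub>2\<close> of exponential type with \<open>q\<^sub>1 U\<^sub>1(y) + q\<^sub>2 U\<^sub>2(y) = (y, h)\<close> for every solution \<open>y\<close>:
  the zeros of \<open>\<Delta>\<close> cancel because \<open>h\<close> annihilates the Jordan chains. The two nondegeneracy
  hypotheses say that, in sectors around the two imaginary half-axes, the determinant of the
  boundary forms on the pair of exponentially decaying solutions is at least of order
  \<open>1/\<bar>\<lambda>\<bar>\<close>. Hence \<open>q\<^sub>1, q\<^sub>2\<close> grow at most linearly there, and they are affine by the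
  Phragmen--Lindelof principle. The solution of the transposed system with right-hand side \<open>h\<close>
  and boundary values given by \<open>q\<^sub>1, q\<^sub>2\<close> is then affine in \<open>\<lambda>\<close> as well, which forces \<open>h = 0\<close>.

  For minimality, let \<open>\<eta>(\<lambda>; g) = adj M(\<lambda>) \<cdot> U(z)\<close>, where \<open>z\<close> solves the inhomogeneous system
  for \<open>g\<close> with zero initial value. The Taylor coefficients of \<open>\<eta>(\<cdot>; g)\<close> at an eigenvalue \<open>\<mu>\<close>
  of orders below the multiplicity of \<open>\<mu>\<close> as a zero of \<open>\<Delta>\<close> are bounded linear functionals of
  \<open>g\<close>. They vanish on the other root subspaces and jointly separate the points of the root
  subspace of \<open>\<mu>\<close>; a linear combination of them separates a root function from all the others.
\<close>

no_notation fps_nth (infixl \<open>$\<close> 75)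

section \<open>Entire functions of exponential type\<close>

text \<open>The boundary conditions may be irregular: the constant leading term of the determinant
  on the decaying pair can vanish, and then only the end values of Q keep it of order 1/\<lambda>.
  This is why the multipliers are bounded linearly and not by a constant, and why affine dependence
  on \<lambda> has to be ruled out at the end. Asymptotics of eigenvalues are avoided; division by
  \<Delta> is paid for by a growth theorem for entire quotients. The sectors |\<lambda>| \<le> 3 |Im
  \<lambda>| must be so wide that Re \<lambda>^2 is positive and comparable to |\<lambda>|^2 on
  their complement; any factor above sqrt 2 achieves this. Sobolev functions are differentiable only
  almost everywhere, so differential equations are kept in integral form, and holomorphy in
  \<lambda> is derived from Taylor estimates that are uniform in x. Point values, boundary forms and
  pairings with h are all bounded functionals on continuous functions, hence holomorphy and
  exponential type are proved once for all of them. Conjugation is applied to h at the very end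
  only, so that everything else is bilinear and holomorphic.\<close>

lemma holomorphic_zero_factor:
  assumes holf: "f holomorphic_on UNIV" and nz: "f p \<noteq> 0"
  obtains g r and n::nat where "0 < r" "g holomorphic_on ball z r"
    "\<And>w. w \<in> ball z r \<Longrightarrow> f w = (w - z) ^ n * g w"
    "\<And>w. w \<in> ball z r \<Longrightarrow> g w \<noteq> 0" "f z = 0 \<longleftrightarrow> n \<noteq> 0"
proof (cases "f z = 0")
  case True
  have "\<not> f constant_on UNIV"
    using True nz by (metis UNIV_I constant_on_def)
  then show ?thesis
    using holomorphic_factor_zero_nonconstant[OF holf open_UNIV connected_UNIV UNIV_I True] that True
    by (metis less_irrefl)
next
  case False
  have "isCont f z"
    using holf holomorphic_on_imp_continuous_on continuous_on_eq_continuous_at by blast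
  then obtain r where "r > 0" "\<And>w. w \<in> ball z r \<Longrightarrow> f w \<noteq> 0"
    using continuous_at_avoid[of z f "0::complex"] False by (auto simp: dist_commute)
  then show ?thesis
    using that[of r f 0] holf holomorphic_on_subset False by auto
qed

text \<open>The local cofactor near \<open>z\<close> and the quotient off \<open>z\<close> agree
  where both are defined; glued together they are holomorphic on the whole plane.\<close>

lemma holomorphic_zero_factor_global:
  assumes "f holomorphic_on UNIV" "f p \<noteq> 0"
  obtains g and n::nat where "g holomorphic_on UNIV" "\<And>w. f w = (w - z) ^ n * g w" "g z \<noteq> 0"
proof -
  obtain g r n where r: "0 < r" "g holomorphic_on ball z r"
    "\<And>w. w \<in> ball z r \<Longrightarrow> f w = (w - z) ^ n * g w"
    "\<And>w. w \<in> ball z r \<Longrightarrow> g w \<noteq> 0" "f z = 0 \<longleftrightarrow> n \<noteq> (0::nat)"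
    using holomorphic_zero_factor[OF assms] by metis
  define k where "k w = (if w = z then g z else f w / (w - z) ^ n)" for w
  have kg: "k w = g w" if "w \<in> ball z r" for w
    using r(3)[OF that] by (auto simp: k_def)
  have k1: "k holomorphic_on ball z r"
    using r(2) by (rule holomorphic_transform) (simp add: kg)
  have "(\<lambda>w. f w / (w - z) ^ n) holomorphic_on (- {z})"
    by (intro holomorphic_intros holomorphic_on_subset[OF assms(1)]) auto
  then have "k holomorphic_on (- {z})"
    by (rule holomorphic_transform) (auto simp: k_def)
  with k1 have "k holomorphic_on (ball z r \<union> (- {z}))"
    by (intro holomorphic_on_Un) auto
  moreover have "ball z r \<union> (- {z}) = UNIV" using r(1) by auto
  ultimately have "k holomorphic_on UNIV" by simp
  moreover have "f w = (w - z) ^ n * k w" for w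
    using r(3)[of z] r(1) by (cases "w = z") (auto simp: k_def)
  moreover have "k z \<noteq> 0" using kg r by simp
  ultimately show ?thesis using that by blast
qed

text \<open>Divisibility is tested one point at a time. The order hypothesis is an estimate near
  \<open>z\<close>, with \<open>m\<close> the order of the zero of \<open>D\<close> (possibly 0),
  because this is the form in which Taylor remainders deliver it.\<close>

lemma entire_quotient:
  fixes N D :: "complex \<Rightarrow> complex"
  assumes N: "N holomorphic_on UNIV" and D: "D holomorphic_on UNIV" and nz: "D p \<noteq> 0"
    and ord: "\<And>z m. (\<exists>g. g holomorphic_on UNIV \<and> g z \<noteq> 0 \<and> (\<forall>w. D w = (w - z) ^ m * g w)) \<Longrightarrow>
       \<exists>K. \<forall>\<^sub>F w in at z. norm (N w) \<le> K * norm (w - z) ^ m"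
  obtains q where "q holomorphic_on UNIV" "\<And>z. N z = q z * D z"
proof (cases "\<forall>z. N z = 0")
  case True
  then show ?thesis using that[of "\<lambda>_. 0"] by auto
next
  case False
  then obtain p' where p': "N p' \<noteq> 0" by blast
  have loc: "\<exists>r k. 0 < r \<and> k holomorphic_on ball z r \<and>
      (\<forall>w\<in>ball z r. N w = k w * D w \<and> (w \<noteq> z \<longrightarrow> D w \<noteq> 0))" for z
  proof -
    obtain g m where g: "g holomorphic_on UNIV" "\<And>w. D w = (w - z) ^ m * g w" "g z \<noteq> 0"
      using holomorphic_zero_factor_global[OF D nz] by metis
    obtain h n where h: "h holomorphic_on UNIV" "\<And>w. N w = (w - z) ^ n * h w" "h z \<noteq> 0"
      using holomorphic_zero_factor_global[OF N p'] by metis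
    obtain K where K: "\<forall>\<^sub>F w in at z. norm (N w) \<le> K * norm (w - z) ^ m"
      using ord g by blast
    have contg: "isCont g z" and conth: "isCont h z"
      using g(1) h(1) holomorphic_on_imp_continuous_on continuous_on_eq_continuous_at by blast+
    have "m \<le> n"
    proof (rule ccontr)
      assume "\<not> m \<le> n"
      \<comment> \<open>If the order \<open>m\<close> of \<open>D\<close> exceeded the order
        \<open>n\<close> of \<open>N\<close>, cancelling (w - z)^n would leave a positive power on
        the right and force \<open>h z = 0\<close>.\<close>
      then obtain j where j: "m = n + Suc j" using less_iff_Suc_add[of n m] by auto
      have "\<forall>\<^sub>F w in at z. norm (h w) \<le> K * norm (w - z) ^ Suc j"
        using K eventually_neq_at_within[of z z UNIV]
      proof eventually_elim
        case (elim w)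
        have "norm (w - z) ^ n * norm (h w) \<le> norm (w - z) ^ n * (K * norm (w - z) ^ Suc j)"
          using elim h(2)[of w] by (simp add: norm_mult norm_power j power_add mult_ac)
        then show ?case using elim(2) by (simp add: mult_le_cancel_left)
      qed
      moreover have "((\<lambda>w. K * norm (w - z) ^ Suc j) \<longlongrightarrow> K * norm (z - z) ^ Suc j) (at z)"
        by (intro tendsto_intros)
      moreover have "((\<lambda>w. norm (h w)) \<longlongrightarrow> norm (h z)) (at z)"
        using conth by (intro tendsto_norm) (simp add: isCont_def)
      ultimately have "norm (h z) \<le> K * norm (z - z) ^ Suc j"
        by (intro tendsto_le[of "at z"]) auto
      with h(3) show False by simp
    qed
    obtain r where r: "r > 0" "\<And>w. w \<in> ball z r \<Longrightarrow> g w \<noteq> 0"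
      using continuous_at_avoid[OF contg g(3)] by (auto simp: dist_commute)
    have "(\<lambda>w. (w - z) ^ (n - m) * h w / g w) holomorphic_on ball z r"
      using g(1) h(1) r(2) by (intro holomorphic_intros) (auto intro: holomorphic_on_subset)
    moreover have "\<forall>w\<in>ball z r. N w = ((w - z) ^ (n - m) * h w / g w) * D w \<and> (w \<noteq> z \<longrightarrow> D w \<noteq> 0)"
      using r(2) \<open>m \<le> n\<close> by (auto simp: g(2) h(2) power_add[symmetric])
    ultimately show ?thesis using r(1) by blast
  qed
  then obtain r k where rk: "\<And>z. 0 < r z" "\<And>z. k z holomorphic_on ball z (r z)"
    "\<And>z w. w \<in> ball z (r z) \<Longrightarrow> N w = k z w * D w"
    "\<And>z w. w \<in> ball z (r z) \<Longrightarrow> w \<noteq> z \<Longrightarrow> D w \<noteq> 0"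
    by metis
  \<comment> \<open>The local quotients fit together: off the centre of each ball \<open>D\<close>
    does not vanish, so the value of the quotient is determined by \<open>N\<close> and
    \<open>D\<close>.\<close>
  define q where "q z = k z z" for z
  have qk: "q w = k z w" if "w \<in> ball z (r z)" for z w
  proof (cases "w = z")
    case False
    have "k w w * D w = k z w * D w" using rk(3)[OF that] rk(3)[of w w] rk(1)[of w] by simp
    with rk(4)[OF that False] show ?thesis by (simp add: q_def)
  qed (simp add: q_def)
  have "q holomorphic_on (\<Union>z. ball z (r z))"
  proof (rule holomorphic_on_UN_open)
    show "q holomorphic_on ball z (r z)" for z
      using rk(2)[of z] by (rule holomorphic_transform) (simp add: qk)
  qed auto
  moreover have "(\<Union>z. ball z (r z)) = UNIV" using rk(1) by force
  ultimately have "q holomorphic_on UNIV" by simp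
  moreover have "N z = q z * D z" for z
    using rk(3)[of z z] rk(1)[of z] by (simp add: q_def)
  ultimately show ?thesis using that by blast
qed

text \<open>Borel--Caratheodory for a branch of the logarithm of \<open>E\<close>.\<close>

lemma zero_free_lower_bound:
  fixes E :: "complex \<Rightarrow> complex"
  assumes R: "0 < R" and E: "E holomorphic_on ball 0 R"
    and nz: "\<And>z. z \<in> ball 0 R \<Longrightarrow> E z \<noteq> 0"
    and ub: "\<And>z. z \<in> ball 0 R \<Longrightarrow> norm (E z) < M"
    and z: "norm z \<le> R / 2"
  shows "norm (E 0) ^ 3 \<le> M\<^sup>2 * norm (E z)"
proof -
  obtain g where g: "g holomorphic_on ball 0 R" "\<And>x. x \<in> ball 0 R \<Longrightarrow> exp (g x) = E x"
    using holomorphic_logarithm_exists[OF convex_ball open_ball E nz, of 0] R by (metis centre_in_ball)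
  have M: "M > 0" using ub[of 0] R by (metis centre_in_ball norm_ge_zero order.strict_trans1)
  have norm_E: "norm (E x) = exp (Re (g x))" if "x \<in> ball 0 R" for x
    using g(2)[OF that] norm_exp_eq_Re by metis
  define a where "a = ln M - Re (g 0)"
  have lt: "Re (g x) < ln M" if "x \<in> ball 0 R" for x
    using ub[OF that] norm_E[OF that] M by (metis exp_less_cancel_iff exp_ln)
  then have a: "a > 0" using R by (simp add: a_def)
  \<comment> \<open>The map w / (2 a - w) sends the half plane Re w < a into the unit disc and fixes
    0, so the Schwarz lemma applies after rescaling the disc.\<close>
  define f where "f \<zeta> = (g (of_real R * \<zeta>) - g 0) / (2 * of_real a - (g (of_real R * \<zeta>) - g 0))" for \<zeta>
  have inb: "of_real R * \<zeta> \<in> ball 0 R" if "norm \<zeta> < 1" for \<zeta> :: complex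
    using that R by (simp add: norm_mult)
  have key: "norm w < norm (2 * of_real a - w)" if "Re w < a" for w
  proof -
    have "(norm w)\<^sup>2 < (norm (2 * of_real a - w))\<^sup>2"
    proof -
      have "(norm (2 * of_real a - w))\<^sup>2 - (norm w)\<^sup>2 = 4 * a * (a - Re w)"
        by (simp only: cmod_power2) (simp add: power2_eq_square algebra_simps)
      moreover have "4 * a * (a - Re w) > 0" using that a by simp
      ultimately show ?thesis by linarith
    qed
    then show ?thesis by (rule power_less_imp_less_base) simp
  qed
  have ne: "2 * of_real a - (g (of_real R * \<zeta>) - g 0) \<noteq> 0" and lt1: "norm (f \<zeta>) < 1" if "norm \<zeta> < 1" for \<zeta>
  proof -
    have "Re (g (of_real R * \<zeta>) - g 0) < a" using lt[OF inb[OF that]] by (simp add: a_def)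
    from key[OF this] have *: "norm (g (of_real R * \<zeta>) - g 0) < norm (2 * of_real a - (g (of_real R * \<zeta>) - g 0))" .
    then show "2 * of_real a - (g (of_real R * \<zeta>) - g 0) \<noteq> 0"
      by (metis norm_not_less_zero norm_zero)
    show "norm (f \<zeta>) < 1" unfolding f_def norm_divide
      using * by (metis divide_less_eq_1 norm_ge_zero order.strict_trans1)
  qed
  have "(g \<circ> (\<lambda>\<zeta>. of_real R * \<zeta>)) holomorphic_on ball 0 1"
    by (rule holomorphic_on_compose_gen[OF _ g(1)]) (use inb[unfolded mem_ball_0] in \<open>auto intro!: holomorphic_intros simp: image_subset_iff simp del: norm_mult\<close>)
  then have "f holomorphic_on ball 0 1"
    unfolding f_def comp_def by (intro holomorphic_intros) (use ne in auto)
  then have S: "norm (f \<zeta>) \<le> norm \<zeta>" if "norm \<zeta> < 1" for \<zeta>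
    by (rule Schwarz_Lemma(1)) (use lt1 that in \<open>auto simp: f_def\<close>)
  define \<zeta> where "\<zeta> = z / of_real R"
  have n\<zeta>: "norm \<zeta> \<le> 1/2" using z R by (simp add: \<zeta>_def norm_divide field_simps)
  have Rz: "of_real R * \<zeta> = z" using R by (simp add: \<zeta>_def)
  define w where "w = g z - g 0"
  have "norm w / norm (2 * of_real a - w) \<le> 1/2"
  proof -
    have "norm (f \<zeta>) \<le> 1/2" using S[of \<zeta>] n\<zeta> by linarith
    then show ?thesis by (simp only: f_def Rz w_def norm_divide)
  qed
  moreover have "2 * of_real a - w \<noteq> 0" using ne[of \<zeta>] n\<zeta> by (simp add: Rz w_def)
  ultimately have "norm w \<le> norm (2 * of_real a - w) / 2" by (simp add: field_simps)
  also have "\<dots> \<le> (2 * a + norm w) / 2"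
    using norm_triangle_ineq4[of "2 * of_real a" w] a by (simp add: norm_mult)
  finally have "norm w \<le> 2 * a" by simp
  then have "Re (g z) \<ge> Re (g 0) - 2 * a"
    using abs_Re_le_cmod[of w] by (auto simp: w_def)
  \<comment> \<open>On half the radius the Schwarz lemma costs \<open>2 * a\<close> with a = ln M -
    Re (g 0); this is the origin of the exponents 3 and 2 in the conclusion.\<close>
  then have "3 * Re (g 0) \<le> 2 * ln M + Re (g z)" by (simp add: a_def)
  then have "exp (3 * Re (g 0)) \<le> exp (2 * ln M + Re (g z))" by simp
  also have "\<dots> = M\<^sup>2 * norm (E z)"
    using M norm_E[of z] z R by (simp add: exp_add exp_double)
  finally have "exp (3 * Re (g 0)) \<le> M\<^sup>2 * norm (E z)" .
  moreover have "exp (3 * Re (g 0)) = norm (E 0) ^ 3"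
    using norm_E[of 0] R exp_of_nat_mult[of 3 "Re (g 0)"] by simp
  ultimately show ?thesis by simp
qed

text \<open>Zeros of the denominator are removed by Blaschke factors, which have modulus \<open>1\<close> on the
  circle and do not decrease the value at the origin.\<close>

lemma quotient_bound:
  fixes G D :: "complex \<Rightarrow> complex"
  assumes R: "0 < R" and G: "G holomorphic_on UNIV" and D: "D holomorphic_on UNIV" and D0: "D 0 \<noteq> 0"
    and ubN: "\<And>z. norm z = R \<Longrightarrow> norm (G z * D z) \<le> K"
    and ubD: "\<And>z. norm z = R \<Longrightarrow> norm (D z) < M"
    and z: "norm z \<le> R / 2"
  shows "norm (G z) * norm (D 0) ^ 3 \<le> K * M\<^sup>2"
  using D D0 ubN ubD
proof (induction "card {w\<in>ball 0 R. D w = 0}" arbitrary: D rule: less_induct)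
  case less
  have nc: "D constant_on UNIV \<Longrightarrow> D = (\<lambda>_. D 0)" by (auto simp: constant_on_def)
  have fin: "finite {w\<in>ball 0 R. D w = 0}"
  proof (cases "D constant_on UNIV")
    case True
    then show ?thesis using nc less.prems(2) by (metis (mono_tags, lifting) Collect_empty_eq finite.emptyI)
  next
    case False
    have "finite {w\<in>cball 0 R. D w = 0}"
      by (rule holomorphic_compact_finite_zeros[OF less.prems(1)]) (use False in auto)
    then show ?thesis by (rule rev_finite_subset) auto
  qed
  show ?case
  proof (cases "\<exists>a\<in>ball 0 R. D a = 0")
    case False
    have cD: "continuous_on A D" and cG: "continuous_on A G" for A
      using less.prems(1) G holomorphic_on_imp_continuous_on continuous_on_subset by blast+
    have fr: "frontier (ball 0 R) = {z::complex. norm z = R}"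
      using R by (auto simp: frontier_ball sphere_def)
    obtain z1 :: complex where z1: "norm z1 = R" "\<And>y. norm y = R \<Longrightarrow> norm (D y) \<le> norm (D z1)"
    proof -
      have "\<exists>x\<in>sphere (0::complex) R. \<forall>y\<in>sphere 0 R. norm (D y) \<le> norm (D x)"
        by (rule continuous_attains_sup) (use R cD in \<open>auto intro!: continuous_intros\<close>)
      then show ?thesis using that by auto
    qed
    have "norm (D w) \<le> norm (D z1)" if "w \<in> ball 0 R" for w
      by (rule maximum_modulus_frontier[where S = "ball 0 R"])
        (use that less.prems(1) cD fr z1 in \<open>auto intro: holomorphic_on_subset\<close>)
    then have Dlt: "norm (D w) < M" if "w \<in> ball 0 R" for w
      using that less.prems(4)[OF z1(1)] by (meson le_less_trans)
    have GD: "norm (G z * D z) \<le> K"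
      by (rule maximum_modulus_frontier[where S = "ball 0 R" and f = "\<lambda>z. G z * D z"])
        (use z R less.prems(1,3) G cD cG fr in \<open>auto intro!: holomorphic_intros continuous_intros intro: holomorphic_on_subset\<close>)
    have "norm (D 0) ^ 3 \<le> M\<^sup>2 * norm (D z)"
      by (rule zero_free_lower_bound[OF R _ _ Dlt z])
         (use less.prems(1) False in \<open>auto intro: holomorphic_on_subset\<close>)
    then have "norm (G z) * norm (D 0) ^ 3 \<le> norm (G z) * (M\<^sup>2 * norm (D z))"
      by (intro mult_left_mono) auto
    also have "\<dots> = M\<^sup>2 * norm (G z * D z)" by (simp add: norm_mult)
    also have "\<dots> \<le> M\<^sup>2 * K" using GD by (intro mult_left_mono) auto
    finally show ?thesis by (simp add: mult.commute)
  next
    case True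
    then obtain a where a: "a \<in> ball 0 R" "D a = 0" by blast
    have a0: "a \<noteq> 0" using a less.prems(2) by auto
    obtain g n where g: "g holomorphic_on UNIV" "\<And>w. D w = (w - a) ^ n * g w" "g a \<noteq> 0"
      using holomorphic_zero_factor_global[OF less.prems(1,2), of a] by metis
    \<comment> \<open>\<open>b\<close> replaces the factor w - a by the denominator of the Blaschke
      factor: equal modulus on the circle, no zeros inside, and modulus \<open>R\<close> > |a| at
      the origin. The full multiplicity \<open>n\<close> is removed at once, so the number of
      distinct zeros drops.\<close>
    define b where "b w = ((of_real R)\<^sup>2 - cnj a * w) / of_real R" for w
    define D' where "D' w = b w ^ n * g w" for w
    have nb: "norm (b w) = norm (w - a)" if "norm w = R" for w
    proof -
      have "(of_real R)\<^sup>2 = w * cnj w" using complex_norm_square[of w] that by simp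
      then have "(of_real R)\<^sup>2 - cnj a * w = w * cnj (w - a)" by (simp add: algebra_simps)
      then have "norm ((of_real R)\<^sup>2 - cnj a * w) = R * norm (w - a)"
        by (simp only: norm_mult complex_mod_cnj that)
      then show ?thesis using R by (simp add: b_def norm_divide)
    qed
    have b_nz: "b w \<noteq> 0" if "w \<in> ball 0 R" for w
    proof
      assume "b w = 0"
      then have "(of_real R)\<^sup>2 = cnj a * w" using R by (simp add: b_def)
      from arg_cong[OF this, of norm] have "R\<^sup>2 = norm a * norm w"
        by (simp add: norm_mult norm_power)
      moreover have "norm a * norm w < R * R" using a that by (intro mult_strict_mono') auto
      ultimately show False by (simp add: power2_eq_square)
    qed
    have holD': "D' holomorphic_on UNIV"
      unfolding D'_def b_def using R by (intro holomorphic_intros g) auto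
    have nD': "norm (D' w) = norm (D w)" if "norm w = R" for w
      using nb[OF that] by (simp add: D'_def g(2) norm_mult norm_power)
    have sub: "{w\<in>ball 0 R. D' w = 0} \<subset> {w\<in>ball 0 R. D w = 0}"
    proof -
      have "{w\<in>ball 0 R. D' w = 0} \<subseteq> {w\<in>ball 0 R. D w = 0}"
        using b_nz by (auto simp: D'_def g(2))
      moreover have "a \<notin> {w\<in>ball 0 R. D' w = 0}" using b_nz[OF a(1)] g(3) by (auto simp: D'_def)
      ultimately show ?thesis using a by blast
    qed
    have D'0: "D' 0 \<noteq> 0" using g(2)[of 0] less.prems(2) b_nz[of 0] R by (auto simp: D'_def)
    have "norm (D 0) \<le> norm (D' 0)"
    proof -
      have "norm a \<le> norm (b 0)" using a R by (simp add: b_def norm_divide power2_eq_square)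
      then have "norm a ^ n \<le> norm (b 0) ^ n" by (intro power_mono) auto
      then show ?thesis by (simp add: D'_def g(2) norm_mult norm_power mult_right_mono)
    qed
    then have "norm (D 0) ^ 3 \<le> norm (D' 0) ^ 3" by (intro power_mono) auto
    then have "norm (G z) * norm (D 0) ^ 3 \<le> norm (G z) * norm (D' 0) ^ 3"
      by (intro mult_left_mono) auto
    also have "\<dots> \<le> K * M\<^sup>2"
    proof (rule less.hyps)
      show "card {w\<in>ball 0 R. D' w = 0} < card {w\<in>ball 0 R. D w = 0}"
        by (rule psubset_card_mono[OF fin sub])
      show "norm (G z * D' z) \<le> K" if "norm z = R" for z
        using less.prems(3)[OF that] nD'[OF that] by (simp add: norm_mult)
      show "norm (D' z) < M" if "norm z = R" for z
        using less.prems(4)[OF that] nD'[OF that] by simp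
    qed (use holD' D'0 in auto)
    finally show ?thesis .
  qed
qed

section \<open>Calculus of exponential type, including entire quotients\<close>

definition exp_type :: "(complex \<Rightarrow> complex) \<Rightarrow> bool" where
  "exp_type f \<longleftrightarrow> (\<exists>K. \<forall>z. norm (f z) \<le> exp (K * (1 + norm z)))"

lemma exp_typeI:
  assumes "\<And>z. norm (f z) \<le> A * exp (K * norm z)"
  shows "exp_type f"
proof -
  let ?L = "max (\<bar>ln (max A 1)\<bar>) \<bar>K\<bar>"
  have "norm (f z) \<le> exp (?L * (1 + norm z))" for z
  proof -
    have "A * exp (K * norm z) \<le> max A 1 * exp (K * norm z)"
      by (intro mult_right_mono) auto
    also have "\<dots> = exp (ln (max A 1) + K * norm z)" by (simp add: exp_add)
    also have "\<dots> \<le> exp (?L * (1 + norm z))"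
    proof -
      have "ln (max A 1) \<le> ?L" "K * norm z \<le> ?L * norm z"
        by (auto intro!: mult_right_mono)
      then have "ln (max A 1) + K * norm z \<le> ?L + ?L * norm z" by (rule add_mono)
      then show ?thesis by (simp add: distrib_left)
    qed
    finally show ?thesis using assms[of z] by linarith
  qed
  then show ?thesis unfolding exp_type_def by blast
qed

lemma exp_type_mult:
  assumes "exp_type f" "exp_type g" shows "exp_type (\<lambda>z. f z * g z)"
proof -
  obtain K L where K: "\<And>z. norm (f z) \<le> exp (K * (1 + norm z))" and L: "\<And>z. norm (g z) \<le> exp (L * (1 + norm z))"
    using assms unfolding exp_type_def by metis
  have "norm (f z * g z) \<le> exp ((K + L) * (1 + norm z))" for z
    unfolding norm_mult using mult_mono[OF K[of z] L[of z]]
    by (simp add: distrib_right exp_add)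
  then show ?thesis unfolding exp_type_def by blast
qed

lemma exp_type_add:
  assumes "exp_type f" "exp_type g" shows "exp_type (\<lambda>z. f z + g z)"
proof -
  obtain K L where K: "\<And>z. norm (f z) \<le> exp (K * (1 + norm z))" and L: "\<And>z. norm (g z) \<le> exp (L * (1 + norm z))"
    using assms unfolding exp_type_def by metis
  have "norm (f z + g z) \<le> (2 * exp (max K L)) * exp (max K L * norm z)" for z
  proof -
    have "exp (K * (1 + norm z)) \<le> exp (max K L * (1 + norm z))"
      "exp (L * (1 + norm z)) \<le> exp (max K L * (1 + norm z))"
      by (auto intro!: mult_right_mono)
    then have "norm (f z + g z) \<le> 2 * exp (max K L * (1 + norm z))"
      using K[of z] L[of z] norm_triangle_ineq[of "f z" "g z"] by linarith
    then show ?thesis by (simp add: distrib_left exp_add)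
  qed
  then show ?thesis by (rule exp_typeI)
qed

lemma exp_type_const: "exp_type (\<lambda>_. c)"
  by (rule exp_typeI[where A = "norm c" and K = 0]) simp

lemma exp_type_minus: "exp_type f \<Longrightarrow> exp_type (\<lambda>z. - f z)"
  unfolding exp_type_def by simp

lemma exp_type_diff: "exp_type f \<Longrightarrow> exp_type g \<Longrightarrow> exp_type (\<lambda>z. f z - g z)"
  using exp_type_add[OF _ exp_type_minus, of f g] by simp

lemma exp_type_ident: "exp_type (\<lambda>z. z)"
proof (rule exp_typeI[where A = 1 and K = 1])
  show "norm z \<le> 1 * exp (1 * norm z)" for z :: complex
    using exp_ge_add_one_self[of "norm z"] by (simp; linarith)
qed

lemma exp_type_shift:
  assumes "exp_type f" shows "exp_type (\<lambda>z. f (z + c))"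
proof -
  obtain K where K: "\<And>z. norm (f z) \<le> exp (K * (1 + norm z))"
    using assms unfolding exp_type_def by metis
  have "norm (f (z + c)) \<le> exp (\<bar>K\<bar> * (1 + norm c)) * exp (\<bar>K\<bar> * norm z)" for z
  proof -
    have "K * (1 + norm (z + c)) \<le> \<bar>K\<bar> * (1 + norm (z + c))"
      by (intro mult_right_mono) auto
    also have "\<dots> \<le> \<bar>K\<bar> * (1 + norm c + norm z)"
      using norm_triangle_ineq[of z c] by (intro mult_left_mono) auto
    finally have "exp (K * (1 + norm (z + c))) \<le> exp (\<bar>K\<bar> * (1 + norm c) + \<bar>K\<bar> * norm z)"
      by (simp add: algebra_simps)
    then show ?thesis using K[of "z + c"] by (simp add: exp_add)
  qed
  then show ?thesis by (rule exp_typeI)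
qed

text \<open>The quotient bound is applied on a circle whose radius grows linearly with |z|, so that
  the boundary exponents stay linear in |z|.\<close>

lemma exp_type_quotient_0:
  assumes G: "G holomorphic_on UNIV" and D: "D holomorphic_on UNIV" and D0: "D 0 \<noteq> 0"
    and N: "exp_type (\<lambda>z. G z * D z)" and eD: "exp_type D"
  shows "exp_type G"
proof -
  obtain K L where K: "\<And>z. norm (G z * D z) \<le> exp (K * (1 + norm z))" and L: "\<And>z. norm (D z) \<le> exp (L * (1 + norm z))"
    using N eD unfolding exp_type_def by metis
  define c where "c = \<bar>K\<bar> + 2 * (\<bar>L\<bar> + 1)"
  have "norm (G z) \<le> (exp (3 * c) / norm (D 0) ^ 3) * exp ((2 * c) * norm z)" for z
  proof -
    \<comment> \<open>\<open>z\<close> lies in the disc of half the radius and \<open>R\<close>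
      stays positive at z = 0. The enlarged rate |L| + 1 below supplies the strict bound on
      \<open>D\<close>.\<close>
    define R where "R = 2 * (norm z + 1)"
    have "norm (G z) * norm (D 0) ^ 3 \<le> exp (\<bar>K\<bar> * (1 + R)) * (exp ((\<bar>L\<bar> + 1) * (1 + R)))\<^sup>2"
    proof (rule quotient_bound[OF _ G D D0])
      show "R > 0" by (simp add: R_def add_nonneg_pos)
      show "norm z \<le> R / 2" by (simp add: R_def)
      show "norm (G w * D w) \<le> exp (\<bar>K\<bar> * (1 + R))" if "norm w = R" for w
        using K[of w] that \<open>R > 0\<close> by (smt (verit) exp_le_cancel_iff mult_right_mono)
      show "norm (D w) < exp ((\<bar>L\<bar> + 1) * (1 + R))" if "norm w = R" for w
        using L[of w] that \<open>R > 0\<close> by (smt (verit) exp_less_cancel_iff mult_strict_right_mono)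
    qed
    also have "\<dots> = exp (c * (1 + R))"
      by (simp add: c_def exp_double[symmetric] exp_add[symmetric] algebra_simps)
    also have "\<dots> = exp (3 * c) * exp ((2 * c) * norm z)"
      by (simp add: R_def exp_add[symmetric] algebra_simps)
    finally show ?thesis using D0 by (simp add: field_simps)
  qed
  then show ?thesis by (rule exp_typeI)
qed

lemma exp_type_quotient:
  assumes G: "G holomorphic_on UNIV" and D: "D holomorphic_on UNIV" and Dp: "D p \<noteq> 0"
    and N: "exp_type (\<lambda>z. G z * D z)" and eD: "exp_type D"
  shows "exp_type G"
proof -
  have sh: "(\<lambda>z. f (z + p)) holomorphic_on UNIV" if "f holomorphic_on UNIV" for f
    using holomorphic_on_compose_gen[of "\<lambda>z. z + p" UNIV f UNIV] that
    by (simp add: comp_def holomorphic_on_add)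
  have "exp_type (\<lambda>z. G (z + p))"
    by (rule exp_type_quotient_0[of _ "\<lambda>z. D (z + p)"])
      (use sh G D Dp exp_type_shift[OF N] exp_type_shift[OF eD] in auto)
  from exp_type_shift[OF this, of "- p"] show ?thesis by simp
qed

text \<open>Phragmen--Lindelof: the weight \<open>exp (- \<epsilon> z\<^sup>2)\<close> decays quadratically in the
  sector, which beats the exponential type of \<open>f\<close>.\<close>

lemma sector_growth:
  fixes f :: "complex \<Rightarrow> complex"
  assumes f: "f holomorphic_on UNIV" and ft: "exp_type f" and C: "1 \<le> C"
    and bd: "\<And>z. norm z \<le> 3 * \<bar>Im z\<bar> \<Longrightarrow> norm (f z) \<le> C * (1 + norm z)"
    and z: "3 * \<bar>Im z\<bar> \<le> norm z" "0 \<le> Re z"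
  shows "norm (f z) \<le> 2 * C * (1 + norm z)"
proof -
  obtain L where L: "\<And>z. norm (f z) \<le> exp (L * (1 + norm z))"
    using ft unfolding exp_type_def by blast
  have n1: "1 + norm w \<le> 2 * norm (1 + w)" if "0 \<le> Re w" for w :: complex
  proof -
    have "(norm (1 + w))\<^sup>2 = (norm w)\<^sup>2 + 2 * Re w + 1"
      by (simp add: cmod_power2) (simp add: power2_eq_square algebra_simps)
    then have "(norm w)\<^sup>2 \<le> (norm (1 + w))\<^sup>2" using that by simp
    then have "norm w \<le> norm (1 + w)" by (rule power2_le_imp_le) simp
    moreover have "1 \<le> norm (1 + w)" using complex_Re_le_cmod[of "1 + w"] that by simp
    ultimately show ?thesis by simp
  qed
  have key: "norm (f z) * exp (- \<epsilon> * Re (z\<^sup>2)) \<le> 2 * C * norm (1 + z)" if \<epsilon>: "\<epsilon> > 0" for \<epsilon>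
  proof -
    \<comment> \<open>The second entry makes the quadratic decay beat exp (L (1 + R)) on the outer
      arc; the first puts \<open>z\<close> inside the region.\<close>
    define R where "R = max (norm z + 1) (2 * (\<bar>L\<bar> + 1) * 2 / \<epsilon>)"
    define S where "S = {w. 3 * \<bar>Im w\<bar> \<le> norm w \<and> 0 \<le> Re w \<and> norm w \<le> R}"
    \<comment> \<open>Dividing by 1 + w absorbs the linear growth allowed on the boundary rays; the
      zero -1 of this factor lies in the left half plane.\<close>
    define g where "g w = f w * exp (- of_real \<epsilon> * w\<^sup>2) / (1 + w)" for w
    have R1: "R \<ge> 1" unfolding R_def by (meson le_add_same_cancel2 max.coboundedI1 norm_ge_zero)
    have R2: "R \<ge> 2 * (\<bar>L\<bar> + 1) * 2 / \<epsilon>" by (simp add: R_def)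
    have clS: "closed S" unfolding S_def
      by (intro closed_Collect_conj closed_Collect_le continuous_intros)
    have ne: "1 + w \<noteq> 0" if "0 \<le> Re w" for w
    proof
      assume "1 + w = 0"
      then have "Re (1 + w) = 0" by simp
      with that show False by simp
    qed
    have norm_g: "norm (g w) = norm (f w) * exp (- \<epsilon> * Re (w\<^sup>2)) / norm (1 + w)" for w
      by (simp add: g_def norm_mult norm_divide)
    have Re_sq: "Re (w\<^sup>2) \<ge> (norm w)\<^sup>2 / 2" if "3 * \<bar>Im w\<bar> \<le> norm w" for w
    proof -
      have "(3 * \<bar>Im w\<bar>)\<^sup>2 \<le> (norm w)\<^sup>2" using that by (intro power_mono) auto
      then have "9 * (Im w)\<^sup>2 \<le> (Re w)\<^sup>2 + (Im w)\<^sup>2"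
        unfolding cmod_power2 by (simp add: power_mult_distrib)
      moreover have "(norm w)\<^sup>2 = (Re w)\<^sup>2 + (Im w)\<^sup>2" by (rule cmod_power2)
      moreover have "Re (w\<^sup>2) = (Re w)\<^sup>2 - (Im w)\<^sup>2" by (rule Re_power2)
      ultimately show ?thesis using zero_le_power2[of "Im w"] by linarith
    qed
    have "norm (g z) \<le> 2 * C"
    proof (rule maximum_modulus_frontier[where S = S and f = g and \<xi> = z])
      have hol: "g holomorphic_on {w. 0 \<le> Re w}"
        unfolding g_def by (intro holomorphic_intros holomorphic_on_subset[OF f]) (use ne in auto)
      then show "g holomorphic_on interior S"
        by (rule holomorphic_on_subset) (use interior_subset in \<open>auto simp: S_def\<close>)
      show "continuous_on (closure S) g"
        using clS holomorphic_on_imp_continuous_on[OF hol] by (rule_tac continuous_on_subset) (auto simp: S_def)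
      show "bounded S" unfolding bounded_iff S_def by blast
      show "z \<in> S" using z by (simp add: S_def R_def)
      show "norm (g w) \<le> 2 * C" if w: "w \<in> frontier S" for w
      proof -
        have wS: "w \<in> S" using w clS frontier_subset_closed by blast
        have "w \<notin> interior S" using w by (simp add: frontier_def)
        have "\<not> (3 * \<bar>Im w\<bar> < norm w \<and> 0 < Re w \<and> norm w < R)"
        proof
          assume *: "3 * \<bar>Im w\<bar> < norm w \<and> 0 < Re w \<and> norm w < R"
          have "open {w. 3 * \<bar>Im w\<bar> < norm w \<and> 0 < Re w \<and> norm w < R}"
            by (intro open_Collect_conj open_Collect_less continuous_intros)
          then have "w \<in> interior S"
            using * by (intro interiorI[of "{w. 3 * \<bar>Im w\<bar> < norm w \<and> 0 < Re w \<and> norm w < R}"]) (auto simp: S_def)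
          with \<open>w \<notin> interior S\<close> show False ..
        qed
        \<comment> \<open>The frontier consists of the two rays, where the hypothesis applies, and
          of the outer arc; within \<open>S\<close> the condition Re w = 0 leaves only the
          origin.\<close>
        then consider "norm w \<le> 3 * \<bar>Im w\<bar>" | "Re w = 0" | "norm w = R"
          using wS by (force simp: S_def)
        then have "norm (f w) * exp (- \<epsilon> * Re (w\<^sup>2)) \<le> C * (1 + norm w)"
        proof cases
          case 1
          have "exp (- \<epsilon> * Re (w\<^sup>2)) \<le> 1"
          proof -
            have "Re (w\<^sup>2) \<ge> 0" using Re_sq[of w] wS by (simp add: S_def) (smt (verit) zero_le_power2)
            then show ?thesis using \<epsilon> by (simp del: Re_power2)
          qed
          then show ?thesis using mult_mono[OF bd[OF 1], of "exp (- \<epsilon> * Re (w\<^sup>2))" 1] C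
            by (simp del: Re_power2)
        next
          case 2
          then have "w = 0" using wS by (auto simp: S_def complex_eq_iff cmod_def)
          then show ?thesis using bd[of 0] by simp
        next
          case 3
          have "norm (f w) * exp (- \<epsilon> * Re (w\<^sup>2)) \<le> exp (L * (1 + R)) * exp (- \<epsilon> * (R\<^sup>2 / 2))"
            using L[of w] 3 Re_sq[of w] wS \<epsilon> by (intro mult_mono) (auto simp: S_def simp del: Re_power2)
          also have "\<dots> = exp (L * (1 + R) - \<epsilon> * R * R / 2)"
            by (simp add: exp_add[symmetric] power2_eq_square)
          also have "\<dots> \<le> exp 0"
          proof -
            have "L * (1 + R) \<le> \<bar>L\<bar> * (2 * R)" using R1 by (intro mult_mono) auto
            moreover have "(2 * (\<bar>L\<bar> + 1) * 2) * R \<le> (\<epsilon> * R) * R"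
              using R2 \<epsilon> R1 by (intro mult_right_mono) (auto simp: field_simps)
            ultimately have "L * (1 + R) - \<epsilon> * R * R / 2 \<le> 0"
              using R1 by (simp add: algebra_simps)
            then show ?thesis by simp
          qed
          also have "\<dots> \<le> C * (1 + norm w)" using C mult_mono[of 1 C 1 "1 + norm w"] by simp
          finally show ?thesis .
        qed
        also have "\<dots> \<le> C * (2 * norm (1 + w))"
          using n1[of w] wS C by (intro mult_left_mono) (auto simp: S_def)
        finally show ?thesis
          unfolding norm_g using ne[of w] wS by (simp add: S_def divide_le_eq del: Re_power2)
      qed
    qed
    then show ?thesis unfolding norm_g using ne[OF z(2)] by (simp add: divide_le_eq del: Re_power2)
  qed
  \<comment> \<open>The bound is independent of \<epsilon>, so the weight disappears as \<epsilon>
    tends to 0.\<close>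
  have "norm (f z) \<le> 2 * C * norm (1 + z)"
  proof (rule tendsto_upperbound)
    show "((\<lambda>\<epsilon>. norm (f z) * exp (- \<epsilon> * Re (z\<^sup>2))) \<longlongrightarrow> norm (f z)) (at_right 0)"
      by (rule tendsto_eq_intros refl | simp)+
    show "\<forall>\<^sub>F \<epsilon> in at_right 0. norm (f z) * exp (- \<epsilon> * Re (z\<^sup>2)) \<le> 2 * C * norm (1 + z)"
      using eventually_at_right_less[of "0::real"] by eventually_elim (use key in blast)
  qed auto
  also have "\<dots> \<le> 2 * C * (1 + norm z)"
    using norm_triangle_ineq[of 1 z] C by (intro mult_left_mono) auto
  finally show ?thesis .
qed

text \<open>After enlarging \<open>C\<close> to cover the disc of radius \<open>r\<close>, the
  sectors around the positive real axis and, by z to -z, around the negative one are filled in;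
  linear growth on the plane leaves a polynomial of degree at most 1.\<close>

proposition exp_type_affine:
  fixes f :: "complex \<Rightarrow> complex"
  assumes f: "f holomorphic_on UNIV" and ft: "exp_type f"
    and bd: "\<And>z. r \<le> norm z \<Longrightarrow> norm z \<le> 3 * \<bar>Im z\<bar> \<Longrightarrow> norm (f z) \<le> C * (1 + norm z)"
  shows "\<exists>a b. \<forall>z. f z = a + b * z"
proof -
  have "compact (f ` cball 0 r)"
    by (intro compact_continuous_image holomorphic_on_imp_continuous_on holomorphic_on_subset[OF f]) auto
  from compact_imp_bounded[OF this] obtain B where "\<forall>x\<in>f ` cball 0 r. norm x \<le> B"
    unfolding bounded_iff by blast
  then have B: "norm (f z) \<le> B" if "norm z \<le> r" for z using that by simp
  define C' where "C' = max 1 (max B C)"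
  have C': "1 \<le> C'" "B \<le> C'" "C \<le> C'" by (auto simp: C'_def)
  have bd': "norm (f z) \<le> C' * (1 + norm z)" if "norm z \<le> 3 * \<bar>Im z\<bar>" for z
  proof (cases "r \<le> norm z")
    case True
    have "norm (f z) \<le> C * (1 + norm z)" by (rule bd[OF True that])
    also have "\<dots> \<le> C' * (1 + norm z)" using C' by (intro mult_right_mono) auto
    finally show ?thesis .
  next
    case False
    then have "norm (f z) \<le> C'" using B[of z] C' by simp
    also have "\<dots> \<le> C' * (1 + norm z)" using C'(1) by (simp add: mult_le_cancel_left1)
    finally show ?thesis .
  qed
  have all: "norm (f z) \<le> 2 * C' * (1 + norm z)" for z
  proof -
    consider "norm z \<le> 3 * \<bar>Im z\<bar>" | "3 * \<bar>Im z\<bar> \<le> norm z" "0 \<le> Re z" | "3 * \<bar>Im z\<bar> \<le> norm z" "Re z \<le> 0"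
      by linarith
    then show ?thesis
    proof cases
      case 1
      have "C' * (1 + norm z) \<ge> 0" using C' by simp
      then show ?thesis using bd'[OF 1] by (simp add: algebra_simps)
    next
      case 2
      then show ?thesis using sector_growth[OF f ft C'(1) bd'] by blast
    next
      case 3
      have "(\<lambda>z. f (- z)) holomorphic_on UNIV"
        using holomorphic_on_compose_gen[of uminus UNIV f UNIV] f
        by (simp add: comp_def holomorphic_on_minus)
      moreover have "exp_type (\<lambda>z. f (- z))"
        using ft unfolding exp_type_def by (metis norm_minus_cancel)
      moreover have "norm (f (- w)) \<le> C' * (1 + norm w)" if "norm w \<le> 3 * \<bar>Im w\<bar>" for w
        using bd'[of "- w"] that by simp
      ultimately have "norm (f (- (- z))) \<le> 2 * C' * (1 + norm (- z))"
        by (rule sector_growth[OF _ _ C'(1)]) (use 3 in auto)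
      then show ?thesis by simp
    qed
  qed
  have L: "f z = (\<Sum>k\<le>1. (deriv ^^ k) f 0 / fact k * z ^ k)" for z
  proof (rule Liouville_polynomial[OF f])
    show "norm (f w) \<le> (4 * C') * norm w ^ 1" if "1 \<le> norm w" for w
    proof -
      have "norm (f w) \<le> 2 * C' * (1 + norm w)" by (rule all)
      also have "\<dots> \<le> 2 * C' * (2 * norm w)" using that C' by (intro mult_left_mono) auto
      finally show ?thesis by simp
    qed
  qed
  have "f z = f 0 + deriv f 0 * z" for z
  proof -
    have "(\<Sum>k\<le>1. (deriv ^^ k) f 0 / fact k * z ^ k) = f 0 + deriv f 0 * z" by simp
    with L[of z] show ?thesis by (rule trans)
  qed
  then have "\<forall>z. f z = f 0 + deriv f 0 * z" ..
  then show ?thesis by (intro exI)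
qed

section \<open>The Hilbert space of square-integrable functions\<close>

abbreviation I01 :: "real measure" where
  "I01 \<equiv> lebesgue_on {0..1}"

text \<open>The real part of the Hermitian product. It induces the same norm, and orthogonality to a
  complex subspace in this weaker sense already implies Hermitian orthogonality, because the
  subspace contains -i s along with s.\<close>

definition ip :: "(real \<Rightarrow> complex^2) \<Rightarrow> (real \<Rightarrow> complex^2) \<Rightarrow> real" where
  "ip f g = (LINT x|I01. f x \<bullet> g x)"

lemma finite_I01: "finite_measure I01"
  by (rule finite_measure_lebesgue_on) simp

lemma L2D:
  assumes "f \<in> L2"
  shows "x \<notin> {0..1} \<Longrightarrow> f x = 0" "f \<in> borel_measurable I01" "integrable I01 (\<lambda>x. (norm (f x))\<^sup>2)"
  using assms by (auto simp: L2_def)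

lemma L2I_bound:
  assumes "\<And>x. x \<notin> {0..1} \<Longrightarrow> f x = 0" "f \<in> borel_measurable I01" "integrable I01 g"
    "\<And>x. x \<in> {0..1} \<Longrightarrow> (norm (f x))\<^sup>2 \<le> g x"
  shows "f \<in> L2"
proof -
  have "integrable I01 (\<lambda>x. (norm (f x))\<^sup>2)"
    by (rule Bochner_Integration.integrable_bound[OF assms(3)])
      (use assms(2,4) in \<open>auto intro!: AE_I2 intro: order_trans[OF _ abs_ge_self]\<close>)
  then show ?thesis using assms by (auto simp: L2_def)
qed

lemma zero_L2: "0 \<in> L2"
  by (simp add: L2_def zero_fun_def)

lemma add_L2:
  assumes "f \<in> L2" "g \<in> L2" shows "f + g \<in> L2"
proof (rule L2I_bound)
  show "integrable I01 (\<lambda>x. 2 * (norm (f x))\<^sup>2 + 2 * (norm (g x))\<^sup>2)"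
    using L2D(3) assms by auto
  fix x :: real
  have "(norm (f x + g x))\<^sup>2 \<le> (norm (f x) + norm (g x))\<^sup>2"
    by (intro power_mono norm_triangle_ineq) auto
  also have "\<dots> \<le> 2 * (norm (f x))\<^sup>2 + 2 * (norm (g x))\<^sup>2"
    using sum_squares_ge_zero[of "norm (f x) - norm (g x)" 0] by (simp add: power2_eq_square algebra_simps)
  finally show "(norm ((f + g) x))\<^sup>2 \<le> 2 * (norm (f x))\<^sup>2 + 2 * (norm (g x))\<^sup>2" by simp
next
  have "(\<lambda>x. f x + g x) \<in> borel_measurable I01"
    using L2D(2) assms by (intro borel_measurable_add) auto
  then show "f + g \<in> borel_measurable I01" by (simp add: plus_fun_def)
qed (use L2D(1)[OF assms(1)] L2D(1)[OF assms(2)] in \<open>simp del: atLeastAtMost_iff\<close>)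

lemma norm_vector_smult: "norm (c *s (z :: complex^2)) = norm c * norm z"
  by (simp add: norm_vec_def L2_set_def norm_mult power_mult_distrib real_sqrt_mult flip: sum_distrib_left)

lemma bounded_linear_vector_smult: "bounded_linear (\<lambda>z :: complex^2. c *s z)"
  by (rule bounded_linear_intro[where K = "norm c"])
    (simp_all add: vec_eq_iff algebra_simps norm_vector_smult)

lemma cscale_L2:
  assumes "f \<in> L2" shows "cscale c f \<in> L2"
proof (rule L2I_bound)
  show "integrable I01 (\<lambda>x. (norm c)\<^sup>2 * (norm (f x))\<^sup>2)"
    using L2D(3)[OF assms] by auto
  show "cscale c f \<in> borel_measurable I01"
    unfolding cscale_def
    using borel_measurable_continuous_onI[OF linear_continuous_on[OF bounded_linear_vector_smult]] L2D(2)[OF assms]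
    by (rule measurable_compose[rotated])
qed (use L2D[OF assms] in \<open>auto simp: cscale_def norm_vector_smult power_mult_distrib\<close>)

lemma cscale_minus1: "cscale (- 1) f = - f"
  by (simp add: cscale_def fun_eq_iff vec_eq_iff)

lemma uminus_L2: "f \<in> L2 \<Longrightarrow> - f \<in> L2"
  using cscale_L2[of f "- 1"] by (simp add: cscale_minus1)

lemma diff_L2: "f \<in> L2 \<Longrightarrow> g \<in> L2 \<Longrightarrow> f - g \<in> L2"
  using add_L2[of f "- g"] uminus_L2[of g] by simp

lemma subspace_L2: "cfun.subspace L2"
  by (simp add: cfun.subspace_def zero_L2 add_L2 cscale_L2)

lemma inner_integrable:
  assumes "f \<in> L2" "g \<in> L2" shows "integrable I01 (\<lambda>x. f x \<bullet> g x)"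
proof (rule Bochner_Integration.integrable_bound)
  show "integrable I01 (\<lambda>x. (norm (f x))\<^sup>2 + (norm (g x))\<^sup>2)"
    using L2D(3) assms by auto
  show "(\<lambda>x. f x \<bullet> g x) \<in> borel_measurable I01"
    using L2D(2) assms by (intro borel_measurable_inner) auto
  have "\<bar>f x \<bullet> g x\<bar> \<le> (norm (f x))\<^sup>2 + (norm (g x))\<^sup>2" for x
  proof -
    have "\<bar>f x \<bullet> g x\<bar> \<le> norm (f x) * norm (g x)" by (rule Cauchy_Schwarz_ineq2)
    also have "\<dots> \<le> (norm (f x))\<^sup>2 + (norm (g x))\<^sup>2"
      using sum_squares_bound[of "norm (f x)" "norm (g x)"] mult_nonneg_nonneg[OF norm_ge_zero[of "f x"] norm_ge_zero[of "g x"]]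
      by linarith
    finally show ?thesis .
  qed
  then show "AE x in I01. norm (f x \<bullet> g x) \<le> norm ((norm (f x))\<^sup>2 + (norm (g x))\<^sup>2)" by simp
qed

lemma ip_commute: "ip f g = ip g f"
  by (simp add: ip_def inner_commute)

lemma ip_add_left: "f \<in> L2 \<Longrightarrow> g \<in> L2 \<Longrightarrow> h \<in> L2 \<Longrightarrow> ip (f + g) h = ip f h + ip g h"
  by (simp add: ip_def inner_add_left inner_integrable)

lemma ip_diff_left: "f \<in> L2 \<Longrightarrow> g \<in> L2 \<Longrightarrow> h \<in> L2 \<Longrightarrow> ip (f - g) h = ip f h - ip g h"
  by (simp add: ip_def inner_diff_left inner_integrable)

lemma ip_add_right: "f \<in> L2 \<Longrightarrow> g \<in> L2 \<Longrightarrow> h \<in> L2 \<Longrightarrow> ip h (f + g) = ip h f + ip h g"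
  by (simp add: ip_commute[of h] ip_add_left)

lemma ip_diff_right: "f \<in> L2 \<Longrightarrow> g \<in> L2 \<Longrightarrow> h \<in> L2 \<Longrightarrow> ip h (f - g) = ip h f - ip h g"
  by (simp add: ip_commute[of h] ip_diff_left)

lemma cscale_of_real: "cscale (of_real t) f x = t *\<^sub>R f x"
  unfolding cscale_def vec_eq_iff
  by (simp only: vector_smult_component vector_scaleR_component) (simp add: scaleR_conv_of_real)

lemma ip_scale_left: "ip (cscale (of_real t) f) g = t * ip f g"
  by (simp add: ip_def cscale_of_real)

lemma ip_scale_right: "ip g (cscale (of_real t) f) = t * ip g f"
  by (simp add: ip_def cscale_of_real)

lemma ip_ge_0: "0 \<le> ip f f"
  by (simp add: ip_def)

lemma ip_self: "ip f f = (LINT x|I01. (norm (f x))\<^sup>2)"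
  by (simp add: ip_def power2_norm_eq_inner)

lemma L2_norm_ip: "L2_norm f = sqrt (ip f f)"
  by (simp add: L2_norm_def ip_self)

lemmas L2_intros = add_L2 diff_L2 cscale_L2 zero_L2
lemmas ip_simps = ip_add_left ip_diff_left ip_add_right ip_diff_right ip_scale_left ip_scale_right L2_intros

text \<open>A vector whose norm is nearly minimal on the line through it in direction
  \<open>s\<close> is nearly orthogonal to \<open>s\<close>: expand the square at t = \<epsilon> and
  t = -\<epsilon>.\<close>

lemma abs_ip_le:
  assumes L2: "u \<in> L2" "s \<in> L2" and \<epsilon>: "0 < \<epsilon>"
    and low: "\<And>t. \<delta> \<le> ip (u - cscale (of_real t) s) (u - cscale (of_real t) s)" and up: "ip u u \<le> \<delta> + \<epsilon>\<^sup>2"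
  shows "2 * \<bar>ip u s\<bar> \<le> \<epsilon> * (1 + ip s s)"
proof -
  have *: "2 * t * ip u s \<le> \<epsilon>\<^sup>2 + t\<^sup>2 * ip s s" for t
  proof -
    have "ip (u - cscale (of_real t) s) (u - cscale (of_real t) s) = ip u u - 2 * t * ip u s + t\<^sup>2 * ip s s"
      using ip_commute[of s u] by (simp add: ip_simps L2) (simp add: power2_eq_square algebra_simps)
    then show ?thesis using low[of t] up by linarith
  qed
  have "\<epsilon> * (2 * \<bar>ip u s\<bar>) \<le> \<epsilon> * (\<epsilon> * (1 + ip s s))"
    using *[of \<epsilon>] *[of "- \<epsilon>"] by (simp add: abs_if algebra_simps power2_eq_square)
  with \<epsilon> show ?thesis by simp
qed

text \<open>Summable L1 norms of the increments give pointwise convergence almost everywhere. They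
  come from the L2 bounds through 2 u \<le> 4^(-n) + 4^n u^2, with weights balanced against the rate
  16^(-n).\<close>

lemma AE_convergent_L2:
  fixes h :: "nat \<Rightarrow> real \<Rightarrow> complex^2"
  assumes h: "\<And>n. h n \<in> L2"
    and ub: "\<And>n. ip (h (Suc n) - h n) (h (Suc n) - h n) \<le> 4 * (1/16) ^ n"
  shows "AE x in I01. convergent (\<lambda>n. h n x)"
proof -
  define u where "u n x = norm (h (Suc n) x - h n x)" for n x
  have meas [measurable]: "h n \<in> borel_measurable I01" for n using L2D(2)[OF h] .
  have um [measurable]: "u n \<in> borel_measurable I01" for n unfolding u_def by measurable
  interpret finite_measure I01 by (rule finite_I01)
  have measI: "measure I01 (space I01) = 1" by (simp add: measure_restrict_space)
  have u2: "integrable I01 (\<lambda>x. (u n x)\<^sup>2)" "(LINT x|I01. (u n x)\<^sup>2) \<le> 4 * (1/16) ^ n" for n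
  proof -
    have "h (Suc n) - h n \<in> L2" by (intro L2_intros h)
    from L2D(3)[OF this] show "integrable I01 (\<lambda>x. (u n x)\<^sup>2)" by (simp add: u_def)
    show "(LINT x|I01. (u n x)\<^sup>2) \<le> 4 * (1/16) ^ n"
      using ub[of n] by (simp add: ip_self u_def)
  qed
  have le: "u n x \<le> (1/4) ^ n + 4 ^ n * (u n x)\<^sup>2" for n x
  proof -
    define p q :: real where "p = (1/2) ^ n" and "q = 2 ^ n"
    have pq: "p * q = 1" "p * p = (1/4) ^ n" "q * q = 4 ^ n"
      by (simp_all add: p_def q_def flip: power_mult_distrib)
    have "0 \<le> (p - q * u n x)\<^sup>2" by simp
    also have "\<dots> = p * p - 2 * (p * q) * u n x + (q * q) * (u n x)\<^sup>2"
      by (simp add: power2_eq_square algebra_simps)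
    finally have "2 * u n x \<le> (1/4) ^ n + 4 ^ n * (u n x)\<^sup>2" by (simp add: pq)
    moreover have "0 \<le> u n x" by (simp add: u_def)
    ultimately show ?thesis by linarith
  qed
  have "(\<integral>\<^sup>+ x. (\<Sum>n. ennreal (u n x)) \<partial>I01) = (\<Sum>n. \<integral>\<^sup>+ x. ennreal (u n x) \<partial>I01)"
    by (rule nn_integral_suminf) measurable
  also have "\<dots> \<le> (\<Sum>n. ennreal (5 * (1/4) ^ n))"
  proof (rule suminf_le)
    fix n
    have "(\<integral>\<^sup>+ x. ennreal (u n x) \<partial>I01) \<le> (\<integral>\<^sup>+ x. ennreal ((1/4) ^ n + 4 ^ n * (u n x)\<^sup>2) \<partial>I01)"
      by (intro nn_integral_mono ennreal_leI le)
    also have "\<dots> = ennreal (LINT x|I01. (1/4) ^ n + 4 ^ n * (u n x)\<^sup>2)"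
      using u2(1) by (intro nn_integral_eq_integral) auto
    also have "(LINT x|I01. (1/4) ^ n + 4 ^ n * (u n x)\<^sup>2) = (1/4) ^ n + 4 ^ n * (LINT x|I01. (u n x)\<^sup>2)"
      using u2(1) measI by simp
    also have "\<dots> \<le> (1/4) ^ n + 4 ^ n * (4 * (1/16) ^ n)"
      using u2(2) by (intro add_left_mono mult_left_mono) auto
    also have "\<dots> = 5 * (1/4) ^ n"
    proof -
      have "(4::real) ^ n * (1/16) ^ n = (1/4) ^ n" by (simp flip: power_mult_distrib)
      then show ?thesis by (simp add: mult.left_commute)
    qed
    finally show "(\<integral>\<^sup>+ x. ennreal (u n x) \<partial>I01) \<le> ennreal (5 * (1/4) ^ n)"
      by (simp add: ennreal_leI)
  qed auto
  also have "\<dots> = ennreal (\<Sum>n. 5 * (1/4) ^ n)"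
    by (rule suminf_ennreal2) (auto intro!: summable_mult summable_geometric)
  also have "\<dots> < \<infinity>" by simp
  finally have "(\<integral>\<^sup>+ x. (\<Sum>n. ennreal (u n x)) \<partial>I01) \<noteq> \<infinity>" by simp
  then have "AE x in I01. (\<Sum>n. ennreal (u n x)) \<noteq> \<infinity>"
    by (rule nn_integral_noteq_infinite[rotated]) measurable
  then show ?thesis
  proof eventually_elim
    case (elim x)
    then have "summable (\<lambda>n. u n x)"
      by (intro summable_suminf_not_top) (auto simp: u_def)
    then have "summable (\<lambda>n. h (Suc n) x - h n x)"
      unfolding u_def by (rule summable_norm_cancel)
    then have "convergent (\<lambda>n. \<Sum>i<n. h (Suc i) x - h i x)"
      by (simp add: summable_iff_convergent)
    then have "convergent (\<lambda>n. h n x - h 0 x)"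
      by (simp only: sum_lessThan_telescope[of "\<lambda>n. h n x"])
    then show ?case
      using convergent_diff_const_right_iff by blast
  qed
qed

text \<open>Pointwise limits exist almost everywhere, and Fatou's lemma carries the Cauchy estimate
  to the limit with the same rate. On the exceptional null set the value of \<open>lim\<close> is
  immaterial.\<close>

lemma Riesz_Fischer_L2:
  fixes h :: "nat \<Rightarrow> real \<Rightarrow> complex^2"
  assumes h: "\<And>n. h n \<in> L2"
    and ub: "\<And>n m. n \<le> m \<Longrightarrow> ip (h n - h m) (h n - h m) \<le> 4 * (1/16) ^ n"
  obtains k where "k \<in> L2" "\<And>n. ip (h n - k) (h n - k) \<le> 4 * (1/16) ^ n"
proof -
  have meas [measurable]: "h n \<in> borel_measurable I01" for n using L2D(2)[OF h] .
  define k where "k x = lim (\<lambda>n. h n x)" for x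
  have km [measurable]: "k \<in> borel_measurable I01"
    unfolding k_def by measurable
  have "ip (h (Suc n) - h n) (h (Suc n) - h n) \<le> 4 * (1/16) ^ n" for n
  proof -
    have "ip (h (Suc n) - h n) (h (Suc n) - h n) = ip (h n - h (Suc n)) (h n - h (Suc n))"
      by (simp add: ip_simps h)
    then show ?thesis using ub[of n "Suc n"] by simp
  qed
  then have conv: "AE x in I01. convergent (\<lambda>n. h n x)"
    by (intro AE_convergent_L2 h)
  have int: "integrable I01 (\<lambda>x. (norm (h n x - k x))\<^sup>2) \<and> (LINT x|I01. (norm (h n x - k x))\<^sup>2) \<le> 4 * (1/16) ^ n" for n
  proof -
    have "(\<integral>\<^sup>+ x. ennreal ((norm (h n x - k x))\<^sup>2) \<partial>I01)
        = (\<integral>\<^sup>+ x. liminf (\<lambda>m. ennreal ((norm (h n x - h m x))\<^sup>2)) \<partial>I01)"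
    proof (rule nn_integral_cong_AE, use conv in eventually_elim)
      fix x assume "convergent (\<lambda>n. h n x)"
      then have "(\<lambda>m. h m x) \<longlonglongrightarrow> k x" by (simp add: k_def convergent_LIMSEQ_iff)
      then have "(\<lambda>m. ennreal ((norm (h n x - h m x))\<^sup>2)) \<longlonglongrightarrow> ennreal ((norm (h n x - k x))\<^sup>2)"
        by (intro tendsto_ennrealI tendsto_intros)
      then show "ennreal ((norm (h n x - k x))\<^sup>2) = liminf (\<lambda>m. ennreal ((norm (h n x - h m x))\<^sup>2))"
        by (intro lim_imp_Liminf[symmetric]) simp_all
    qed
    also have "\<dots> \<le> liminf (\<lambda>m. \<integral>\<^sup>+ x. ennreal ((norm (h n x - h m x))\<^sup>2) \<partial>I01)"
      by (rule nn_integral_liminf) measurable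
    also have "\<dots> \<le> ennreal (4 * (1/16) ^ n)"
    proof (rule Liminf_le)
      show "\<forall>\<^sub>F m in sequentially. (\<integral>\<^sup>+ x. ennreal ((norm (h n x - h m x))\<^sup>2) \<partial>I01) \<le> ennreal (4 * (1/16) ^ n)"
        using eventually_ge_at_top[of n]
      proof eventually_elim
        case (elim m)
        have "h n - h m \<in> L2" by (intro L2_intros h)
        from L2D(3)[OF this] have "(\<integral>\<^sup>+ x. ennreal ((norm (h n x - h m x))\<^sup>2) \<partial>I01) = ennreal (ip (h n - h m) (h n - h m))"
          unfolding ip_self by (subst nn_integral_eq_integral) auto
        then show ?case using ub[OF elim] by (simp add: ennreal_leI)
      qed
    qed simp
    finally have fin: "(\<integral>\<^sup>+ x. ennreal ((norm (h n x - k x))\<^sup>2) \<partial>I01) \<le> ennreal (4 * (1/16) ^ n)" .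
    have "integrable I01 (\<lambda>x. (norm (h n x - k x))\<^sup>2)"
      using fin by (intro integrableI_bounded) (auto simp: order.strict_trans1)
    moreover from nn_integral_eq_integral[OF this] fin
    have "(LINT x|I01. (norm (h n x - k x))\<^sup>2) \<le> 4 * (1/16) ^ n" by simp
    ultimately show ?thesis ..
  qed
  have k0: "k x = 0" if "x \<notin> {0..1}" for x
    using L2D(1)[OF h that] by (simp add: k_def)
  have hk: "h 0 - k \<in> L2"
    unfolding L2_def using int[of 0] k0 L2D(1)[OF h] by (auto simp: fun_diff_def)
  have "h 0 - (h 0 - k) \<in> L2" by (intro diff_L2 h hk)
  then have "k \<in> L2" by simp
  then show ?thesis
    by (rule that) (use int in \<open>simp add: ip_self\<close>)
qed

text \<open>Residuals of a minimizing sequence converge in L2 to a vector orthogonal to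
  \<open>W\<close>. By hypothesis that vector is null, so the residuals themselves become small.
  Elements are functions and not classes, hence the almost-everywhere form of the
  hypothesis.\<close>

lemma L2_closure_eqI:
  assumes sub: "cfun.subspace W" and W: "W \<subseteq> L2"
    and orth: "\<And>h. h \<in> L2 \<Longrightarrow> (\<And>s. s \<in> W \<Longrightarrow> ip h s = 0) \<Longrightarrow> AE x in I01. h x = 0"
  shows "L2_closure W = L2"
proof -
  have "f \<in> L2_closure W" if f: "f \<in> L2" for f
  proof -
    define d where "d = (INF g\<in>W. ip (f - g) (f - g))"
    have W0: "0 \<in> W" using sub by (rule cfun.subspace_0)
    have bdd: "bdd_below ((\<lambda>g. ip (f - g) (f - g)) ` W)"
      by (rule bdd_belowI2[where m = 0]) (rule ip_ge_0)
    have dle: "d \<le> ip (f - g) (f - g)" if "g \<in> W" for g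
      unfolding d_def by (rule cINF_lower[OF bdd that])
    have "\<exists>g\<in>W. ip (f - g) (f - g) < d + (1/16) ^ n" for n
    proof -
      have "(INF g\<in>W. ip (f - g) (f - g)) < d + (1/16) ^ n" by (simp add: d_def)
      then show ?thesis using cINF_less_iff[OF _ bdd] W0 by blast
    qed
    then obtain g where g: "\<And>n. g n \<in> W" "\<And>n. ip (f - g n) (f - g n) < d + (1/16) ^ n" by metis
    define h where "h n = f - g n" for n
    have gL: "g n \<in> L2" for n using g W by blast
    have hL: "h n \<in> L2" for n unfolding h_def by (intro L2_intros f gL)
    have diff: "ip (h n - h m) (h n - h m) \<le> 4 * (1/16) ^ n" if "n \<le> m" for n m
    proof -
      \<comment> \<open>The midpoint of two approximants lies in \<open>W\<close> and cannot be
        closer to \<open>f\<close> than the infimum allows; the parallelogram law turns this into a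
        Cauchy estimate.\<close>
      define c where "c = cscale (of_real (1/2)) (g n + g m)"
      have cW: "c \<in> W" unfolding c_def using g sub by (intro cfun.subspace_scale cfun.subspace_add) auto
      have "h n + h m = cscale (of_real 2) (f - c)"
      proof (rule ext)
        fix x
        have "c x = (1/2) *\<^sub>R (g n x + g m x)" unfolding c_def cscale_of_real by simp
        then show "(h n + h m) x = cscale (of_real 2) (f - c) x"
          unfolding cscale_of_real by (simp add: h_def scaleR_right_diff_distrib scaleR_2)
      qed
      then have "ip (h n + h m) (h n + h m) = 4 * ip (f - c) (f - c)"
        by (simp add: ip_scale_left ip_scale_right del: of_real_numeral)
      then have "ip (h n + h m) (h n + h m) \<ge> 4 * d" using dle[OF cW] by simp
      moreover have "ip (h n - h m) (h n - h m) = 2 * ip (h n) (h n) + 2 * ip (h m) (h m) - ip (h n + h m) (h n + h m)"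
        by (simp add: ip_simps hL)
      moreover have "ip (h n) (h n) \<le> d + (1/16) ^ n" "ip (h m) (h m) \<le> d + (1/16) ^ n"
      proof -
        have "(1/16::real) ^ m \<le> (1/16) ^ n" using that by (intro power_decreasing) auto
        then show "ip (h n) (h n) \<le> d + (1/16) ^ n" "ip (h m) (h m) \<le> d + (1/16) ^ n"
          using g(2)[of n] g(2)[of m] unfolding h_def by linarith+
      qed
      ultimately show ?thesis by linarith
    qed
    obtain k where k: "k \<in> L2" "\<And>n. ip (h n - k) (h n - k) \<le> 4 * (1/16) ^ n"
      using Riesz_Fischer_L2[OF hL diff] by blast
    have "ip k s = 0" if s: "s \<in> W" for s
    proof -
      have sL: "s \<in> L2" using s W by blast
      have b1: "2 * \<bar>ip (h n) s\<bar> \<le> (1/4) ^ n * (1 + ip s s)" for n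
      proof (rule abs_ip_le[OF hL sL])
        show "d \<le> ip (h n - cscale (of_real t) s) (h n - cscale (of_real t) s)" for t
        proof -
          have "g n + cscale (of_real t) s \<in> W"
            using g s sub by (intro cfun.subspace_scale cfun.subspace_add) auto
          from dle[OF this] show ?thesis by (simp add: h_def diff_diff_eq)
        qed
        show "ip (h n) (h n) \<le> d + ((1/4) ^ n)\<^sup>2"
        proof -
          have "((1/4::real) ^ n)\<^sup>2 = (1/16) ^ n" by (simp add: power2_eq_square flip: power_mult_distrib)
          then show ?thesis using g(2)[of n] by (simp add: h_def)
        qed
      qed simp
      have b2: "2 * \<bar>ip (h n - k) s\<bar> \<le> (2 * (1/4) ^ n) * (1 + ip s s)" for n
      proof (rule abs_ip_le[OF _ sL])
        show "0 \<le> ip (h n - k - cscale (of_real t) s) (h n - k - cscale (of_real t) s)" for t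
          by (rule ip_ge_0)
        show "ip (h n - k) (h n - k) \<le> 0 + (2 * (1/4) ^ n)\<^sup>2"
        proof -
          have "(2 * (1/4::real) ^ n)\<^sup>2 = 4 * (1/16) ^ n"
            by (simp add: power2_eq_square flip: power_mult_distrib)
          then show ?thesis using k(2)[of n] by simp
        qed
      qed (use hL k in \<open>auto intro: L2_intros\<close>)
      have "2 * \<bar>ip k s\<bar> \<le> (3 * (1 + ip s s)) * (1/4) ^ n" for n
      proof -
        have "ip k s = ip (h n) s - ip (h n - k) s" using k sL hL by (simp add: ip_simps)
        then show ?thesis using b1[of n] b2[of n] by (simp add: algebra_simps)
      qed
      moreover have "(\<lambda>n. (3 * (1 + ip s s)) * (1/4) ^ n) \<longlonglongrightarrow> (3 * (1 + ip s s)) * 0"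
        by (intro tendsto_intros LIMSEQ_power_zero) simp
      ultimately have "2 * \<bar>ip k s\<bar> \<le> (3 * (1 + ip s s)) * 0"
        by (intro LIMSEQ_le_const) auto
      then show ?thesis by simp
    qed
    then have ae: "AE x in I01. k x = 0" by (rule orth[OF k(1)])
    have hsmall: "ip (h n) (h n) \<le> 4 * (1/16) ^ n" for n
    proof -
      have "ip (h n) (h n) = ip (h n - k) (h n - k)"
        unfolding ip_self
        by (rule integral_cong_AE) (use ae L2D(2)[OF hL] L2D(2)[OF k(1)] in auto)
      then show ?thesis using k(2) by simp
    qed
    show ?thesis
      unfolding L2_closure_def
    proof (intro CollectI conjI f allI impI)
      fix \<epsilon> :: real assume \<epsilon>: "0 < \<epsilon>"
      have "(\<lambda>n. 4 * (1/16::real) ^ n) \<longlonglongrightarrow> 4 * 0"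
        by (intro tendsto_intros LIMSEQ_power_zero) simp
      then have "\<forall>\<^sub>F n in sequentially. 4 * (1/16::real) ^ n < \<epsilon>\<^sup>2"
        by (rule order_tendstoD) (use \<epsilon> in auto)
      then obtain n where "4 * (1/16::real) ^ n < \<epsilon>\<^sup>2" by (auto simp: eventually_sequentially)
      then have "ip (h n) (h n) < \<epsilon>\<^sup>2" using hsmall[of n] by linarith
      then have "L2_norm (f - g n) < \<epsilon>"
        using \<epsilon> by (simp add: L2_norm_ip h_def real_less_lsqrt ip_ge_0)
      then show "\<exists>g\<in>W. L2_norm (f - g) < \<epsilon>" using g(1) by blast
    qed
  qed
  then show ?thesis by (auto simp: L2_closure_def)
qed

section \<open>Volterra equations and the Dirac system\<close>

lemmas HK_norm_bound = Henstock_Kurzweil_Integration.integral_norm_bound_integral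

lemma integral_exp_weight:
  fixes K x :: real
  assumes "0 < K" "0 \<le> x"
  shows "integral {0..x} (\<lambda>t. K * exp (2 * K * t)) \<le> exp (2 * K * x) / 2"
proof -
  have "((\<lambda>t. K * exp (2 * K * t)) has_integral exp (2 * K * x) / 2 - exp (2 * K * 0) / 2) {0..x}"
    using assms
    by (intro fundamental_theorem_of_calculus)
      (auto intro!: derivative_eq_intros simp: has_real_derivative_iff_has_vector_derivative[symmetric])
  from integral_unique[OF this] show ?thesis by simp
qed

lemma exp_weight_cancel:
  fixes K x z :: real
  shows "exp (2 * K * x) * (exp (- 2 * K * x) * z) = z" "exp (- 2 * K * x) * (exp (2 * K * x) * z) = z"
  by (simp_all add: exp_minus)

text \<open>The weight \<open>exp (- 2 K x)\<close> turns the Volterra operator into a contraction on \<open>[0,1]\<close>.\<close>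

lemma volterra_exists:
  fixes v :: "real \<Rightarrow> 'a::euclidean_space"
  assumes K: "0 < K" and v: "continuous_on {0..1} v"
    and cont: "\<And>y. continuous_on {0..1} y \<Longrightarrow> continuous_on {0..1} (\<lambda>t. F t (y t))"
    and lip: "\<And>t z z'. t \<in> {0..1} \<Longrightarrow> norm (F t z - F t z') \<le> K * norm (z - z')"
  obtains y where "continuous_on {0..1} y"
    "\<And>x. x \<in> {0..1} \<Longrightarrow> y x = v x + integral {0..x} (\<lambda>t. F t (y t))"
proof -
  define \<Psi> where "\<Psi> f x = exp (- 2 * K * x) *\<^sub>R (v x + integral {0..x} (\<lambda>t. F t (exp (2 * K * t) *\<^sub>R f t)))"
    for f :: "real \<Rightarrow> 'a" and x
  have contF: "continuous_on {0..1} (\<lambda>t. F t (exp (2 * K * t) *\<^sub>R apply_bcontfun f t))" for f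
    by (intro cont continuous_intros continuous_on_apply_bcontfun)
  have cont\<Psi>: "continuous_on {0..1} (\<Psi> (apply_bcontfun f))" for f
    unfolding \<Psi>_def
    by (intro continuous_intros v indefinite_integral_continuous_1 integrable_continuous_real contF)
  \<comment> \<open>Functions on [0,1] are extended to the line by clamping the argument, which
    makes them points of the complete space of bounded continuous functions.\<close>
  define c where "c x = clamp 0 1 (x :: real)" for x
  have c01: "c x \<in> {0..1}" for x
    using clamp_in_interval[of "0::real" 1 x] by (simp add: c_def)
  have mem: "\<Psi> (apply_bcontfun f) \<circ> c \<in> bcontfun" for f
  proof -
    have "continuous_on (cbox 0 1) (\<Psi> (apply_bcontfun f))" using cont\<Psi> by simp
    from clamp_continuous_on[OF this, of UNIV]
    have "continuous_on UNIV (\<Psi> (apply_bcontfun f) \<circ> c)" by (simp add: comp_def c_def)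
    moreover have "bounded (range (\<Psi> (apply_bcontfun f) \<circ> c))"
    proof (rule bounded_subset)
      show "bounded (\<Psi> (apply_bcontfun f) ` {0..1})"
        by (intro compact_imp_bounded compact_continuous_image cont\<Psi>) auto
      show "range (\<Psi> (apply_bcontfun f) \<circ> c) \<subseteq> \<Psi> (apply_bcontfun f) ` {0..1}"
        using c01 by auto
    qed
    ultimately show ?thesis by (simp add: bcontfun_def)
  qed
  define T where "T f = Bcontfun (\<Psi> (apply_bcontfun f) \<circ> c)" for f
  have T: "apply_bcontfun (T f) x = \<Psi> (apply_bcontfun f) (c x)" for f x
    unfolding T_def using Bcontfun_inverse[OF mem] by simp
  have "\<exists>!f. T f = f"
  proof (rule banach_fix_type[where c = "1/2"])
    show "\<forall>f g. dist (T f) (T g) \<le> 1/2 * dist f g"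
    proof (intro allI dist_bound)
      fix f g x
      have x: "c x \<in> {0..1}" by (rule c01)
      let ?F = "\<lambda>f t. F t (exp (2 * K * t) *\<^sub>R apply_bcontfun f t)"
      have int: "?F h integrable_on {0..c x}" for h
        by (intro integrable_continuous_real continuous_on_subset[OF contF]) (use x in auto)
      have "norm (integral {0..c x} (\<lambda>t. ?F f t - ?F g t)) \<le> integral {0..c x} (\<lambda>t. (K * exp (2 * K * t)) * dist f g)"
      proof (rule HK_norm_bound)
        show "(\<lambda>t. ?F f t - ?F g t) integrable_on {0..c x}" by (intro integrable_diff int)
        show "(\<lambda>t. (K * exp (2 * K * t)) * dist f g) integrable_on {0..c x}"
          by (intro integrable_continuous_real continuous_intros)
        fix t assume t: "t \<in> {0..c x}"
        have "norm (?F f t - ?F g t) \<le> K * norm (exp (2 * K * t) *\<^sub>R apply_bcontfun f t - exp (2 * K * t) *\<^sub>R apply_bcontfun g t)"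
          by (rule lip) (use t x in auto)
        also have "\<dots> = (K * exp (2 * K * t)) * dist (apply_bcontfun f t) (apply_bcontfun g t)"
          by (simp add: dist_norm flip: scaleR_right_diff_distrib)
        also have "\<dots> \<le> (K * exp (2 * K * t)) * dist f g"
          using K by (intro mult_left_mono dist_bounded) auto
        finally show "norm (?F f t - ?F g t) \<le> (K * exp (2 * K * t)) * dist f g" .
      qed
      also have "\<dots> = integral {0..c x} (\<lambda>t. K * exp (2 * K * t)) * dist f g" by simp
      also have "\<dots> \<le> (exp (2 * K * c x) / 2) * dist f g"
        using x by (intro mult_right_mono integral_exp_weight K) auto
      finally have *: "norm (integral {0..c x} (\<lambda>t. ?F f t - ?F g t)) \<le> (exp (2 * K * c x) / 2) * dist f g" .
      have "dist (apply_bcontfun (T f) x) (apply_bcontfun (T g) x)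
          = norm (exp (- 2 * K * c x) *\<^sub>R integral {0..c x} (\<lambda>t. ?F f t - ?F g t))"
        unfolding T \<Psi>_def dist_norm integral_diff[OF int int] by (simp add: scaleR_right_diff_distrib[symmetric])
      also have "\<dots> = exp (- 2 * K * c x) * norm (integral {0..c x} (\<lambda>t. ?F f t - ?F g t))" by simp
      also have "\<dots> \<le> exp (- 2 * K * c x) * ((exp (2 * K * c x) / 2) * dist f g)"
        by (intro mult_left_mono *) auto
      also have "\<dots> = 1/2 * dist f g"
        using exp_weight_cancel(2)[of K "c x" "dist f g"] by simp
      finally show "dist (apply_bcontfun (T f) x) (apply_bcontfun (T g) x) \<le> 1/2 * dist f g" .
    qed
  qed auto
  then obtain f where f: "T f = f" by blast
  have fx: "apply_bcontfun f x = \<Psi> (apply_bcontfun f) x" if "x \<in> {0..1}" for x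
    using T[of f x] that clamp_cancel_cbox[of x 0 1] by (simp add: f c_def)
  show ?thesis
  proof (rule that)
    show "continuous_on {0..1} (\<lambda>x. exp (2 * K * x) *\<^sub>R apply_bcontfun f x)"
      by (intro continuous_intros continuous_on_apply_bcontfun)
    show "exp (2 * K * x) *\<^sub>R apply_bcontfun f x = v x + integral {0..x} (\<lambda>t. F t (exp (2 * K * t) *\<^sub>R apply_bcontfun f t))"
      if "x \<in> {0..1}" for x
      unfolding fx[OF that] \<Psi>_def by (simp add: exp_weight_cancel(1)[of K x 1, simplified])
  qed
qed

text \<open>Gronwall by maximization: at the point where the weighted norm is largest, the integral
  contributes at most half of the maximum and is absorbed.\<close>

lemma volterra_bound:
  fixes y :: "real \<Rightarrow> 'a::euclidean_space"
  assumes K: "0 < K" and y: "continuous_on {0..1} y" and f: "f integrable_on {0..1}"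
    and eq: "\<And>x. x \<in> {0..1} \<Longrightarrow> y x = v x + integral {0..x} f"
    and v: "\<And>x. x \<in> {0..1} \<Longrightarrow> norm (v x) \<le> M"
    and fb: "\<And>t. t \<in> {0..1} \<Longrightarrow> norm (f t) \<le> K * norm (y t)"
    and x: "x \<in> {0..1}"
  shows "norm (y x) \<le> 2 * M * exp (2 * K * x)"
proof -
  have "continuous_on {0..1} (\<lambda>x. exp (- 2 * K * x) * norm (y x))"
    by (intro continuous_intros y)
  from continuous_attains_sup[OF _ _ this] obtain s where s: "s \<in> {0..1}"
    "\<And>t. t \<in> {0..1} \<Longrightarrow> exp (- 2 * K * t) * norm (y t) \<le> exp (- 2 * K * s) * norm (y s)" by auto
  define N where "N = exp (- 2 * K * s) * norm (y s)"
  have N: "norm (y t) \<le> N * exp (2 * K * t)" if "t \<in> {0..1}" for t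
  proof -
    have "exp (2 * K * t) * (exp (- 2 * K * t) * norm (y t)) \<le> exp (2 * K * t) * N"
      using s(2)[OF that] by (intro mult_left_mono) (auto simp: N_def)
    then show ?thesis unfolding exp_weight_cancel by (simp only: mult.commute)
  qed
  have "norm (integral {0..s} f) \<le> integral {0..s} (\<lambda>t. (K * exp (2 * K * t)) * N)"
  proof (rule HK_norm_bound)
    show "f integrable_on {0..s}" by (rule integrable_on_subinterval[OF f]) (use s in auto)
    show "(\<lambda>t. (K * exp (2 * K * t)) * N) integrable_on {0..s}"
      by (intro integrable_continuous_real continuous_intros)
    fix t assume "t \<in> {0..s}"
    then have t: "t \<in> {0..1}" using s by auto
    have "norm (f t) \<le> K * norm (y t)" by (rule fb[OF t])
    also have "\<dots> \<le> K * (N * exp (2 * K * t))" using N[OF t] K by (intro mult_left_mono) auto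
    finally show "norm (f t) \<le> (K * exp (2 * K * t)) * N" by (simp add: mult_ac)
  qed
  also have "\<dots> = integral {0..s} (\<lambda>t. K * exp (2 * K * t)) * N" by simp
  also have "\<dots> \<le> (exp (2 * K * s) / 2) * N"
    using s by (intro mult_right_mono integral_exp_weight K) (auto simp: N_def)
  finally have "norm (y s) \<le> M + (exp (2 * K * s) / 2) * N"
    unfolding eq[OF s(1)] using v[OF s(1)] norm_triangle_ineq[of "v s" "integral {0..s} f"] by linarith
  then have "N \<le> exp (- 2 * K * s) * (M + (exp (2 * K * s) / 2) * N)"
    unfolding N_def by (intro mult_left_mono) auto
  also have "\<dots> = exp (- 2 * K * s) * M + N / 2"
    using exp_weight_cancel(2)[of K s "N / 2"] by (simp add: distrib_left)
  also have "exp (- 2 * K * s) * M \<le> 1 * M"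
    using K s v[OF s(1)] norm_ge_zero[of "v s"] by (intro mult_right_mono) (auto intro: order_trans simp del: norm_ge_zero)
  finally have "N \<le> 2 * M" by simp
  then have "N * exp (2 * K * x) \<le> 2 * M * exp (2 * K * x)" by (intro mult_right_mono) auto
  then show ?thesis using N[OF x] by linarith
qed

lemma absolutely_integrable_continuous_mult:
  fixes e g :: "real \<Rightarrow> complex"
  assumes "continuous_on {a..b} e" "g absolutely_integrable_on {a..b}"
  shows "(\<lambda>t. e t * g t) absolutely_integrable_on {a..b}"
proof (rule absolutely_integrable_bounded_measurable_product[where h = "(*)"])
  show "bilinear ((*) :: complex \<Rightarrow> _)" by (rule bilinear_times)
  show "e \<in> borel_measurable (lebesgue_on {a..b})"
    using assms(1) by (intro continuous_imp_measurable_on_sets_lebesgue) auto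
  show "bounded (e ` {a..b})"
    by (intro compact_imp_bounded compact_continuous_image assms) auto
qed (use assms in auto)

lemma integral_diff_Icc:
  fixes f :: "real \<Rightarrow> 'a::banach"
  assumes "f integrable_on {0..1}" "0 \<le> a" "a \<le> x" "x \<le> 1"
  shows "integral {0..x} f - integral {0..a} f = integral {a..x} f"
  using Henstock_Kurzweil_Integration.integral_combine[of 0 a x f] integrable_on_subinterval[OF assms(1), of 0 x] assms
  by (auto simp: algebra_simps)

text \<open>The difference of the two sides moves from \<open>a\<close> to \<open>x\<close> by at most
  \<open>\<bar>x - a\<bar>\<close> times the integral of \<open>\<bar>g\<bar>\<close> over \<open>[a,x]\<close>, up to a constant, so its derivative vanishes.\<close>

lemma integral_product_rule:
  fixes e p g :: "real \<Rightarrow> complex"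
  assumes g: "g absolutely_integrable_on {0..1}"
    and p: "\<And>x. x \<in> {0..1} \<Longrightarrow> p x = p 0 + integral {0..x} g"
    and e: "\<And>x. x \<in> {0..1} \<Longrightarrow> (e has_vector_derivative e' x) (at x within {0..1})"
    and e': "continuous_on {0..1} e'"
    and x: "x \<in> {0..1}"
  shows "e x * p x = e 0 * p 0 + integral {0..x} (\<lambda>t. e t * g t + e' t * p t)"
proof -
  have gi: "g integrable_on {0..1}" and gn: "(\<lambda>t. norm (g t)) integrable_on {0..1}"
    using g by (auto simp: absolutely_integrable_on_def)
  have conte: "continuous_on {0..1} e"
    using e by (intro continuous_on_vector_derivative) auto
  have contp: "continuous_on {0..1} p"
  proof (rule continuous_on_eq)
    show "continuous_on {0..1} (\<lambda>x. p 0 + integral {0..x} g)"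
      by (intro continuous_intros indefinite_integral_continuous_1[OF gi])
  qed (rule p[symmetric])
  have Fi: "(\<lambda>t. e t * g t + e' t * p t) integrable_on {0..1}"
  proof (rule integrable_add)
    show "(\<lambda>t. e t * g t) integrable_on {0..1}"
      using absolutely_integrable_continuous_mult[OF conte g] by (auto simp: absolutely_integrable_on_def)
    show "(\<lambda>t. e' t * p t) integrable_on {0..1}"
      by (intro integrable_continuous_real continuous_intros e' contp)
  qed
  obtain L where L: "0 \<le> L" "\<And>t. t \<in> {0..1} \<Longrightarrow> norm (e' t) \<le> L"
  proof -
    have "bounded (e' ` {0..1})" by (intro compact_imp_bounded compact_continuous_image e') auto
    then obtain L where "\<And>t. t \<in> {0..1} \<Longrightarrow> norm (e' t) \<le> L" unfolding bounded_iff by blast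
    moreover have "0 \<le> L" using calculation[of 0] norm_ge_zero[of "e' 0"] by (meson atLeastAtMost_iff order_refl order_trans zero_le_one)
    ultimately show ?thesis using that by blast
  qed
  have lip: "norm (e s - e t) \<le> L * \<bar>s - t\<bar>" if "s \<in> {0..1}" "t \<in> {0..1}" for s t
  proof -
    have "norm (e s - e t) \<le> L * norm (s - t)"
    proof (rule differentiable_bound[where S = "{0..1}" and f' = "\<lambda>x h. h *\<^sub>R e' x"])
      show "(e has_derivative (\<lambda>h. h *\<^sub>R e' x)) (at x within {0..1})" if "x \<in> {0..1}" for x
        using e[OF that] by (simp add: has_vector_derivative_def)
      show "onorm (\<lambda>h. h *\<^sub>R e' x) \<le> L" if "x \<in> {0..1}" for x
      proof (rule onorm_le)
        show "norm (h *\<^sub>R e' x) \<le> L * norm h" for h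
          using mult_right_mono[OF L(2)[OF that], of "\<bar>h\<bar>"] by (simp add: mult.commute)
      qed
    qed (use that in auto)
    then show ?thesis by simp
  qed
  define \<Gamma> where "\<Gamma> x = integral {0..x} (\<lambda>t. norm (g t))" for x
  have cont\<Gamma>: "continuous_on {0..1} \<Gamma>"
    unfolding \<Gamma>_def by (rule indefinite_integral_continuous_1[OF gn])
  define D where "D x = e x * p x - integral {0..x} (\<lambda>t. e t * g t + e' t * p t)" for x
  have key: "norm (D x - D a) \<le> 2 * L * (x - a) * (\<Gamma> x - \<Gamma> a)" if ax: "0 \<le> a" "a \<le> x" "x \<le> 1" for a x
  proof -
    have sub: "{a..x} \<subseteq> {0..1}" using ax by auto
    have pd: "p s - p r = integral {r..s} g" if "a \<le> r" "r \<le> s" "s \<le> x" for r s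
      using p[of s] p[of r] integral_diff_Icc[OF gi, of r s] that ax by simp
    have \<Gamma>d: "\<Gamma> s - \<Gamma> r = integral {r..s} (\<lambda>t. norm (g t))" if "a \<le> r" "r \<le> s" "s \<le> x" for r s
      unfolding \<Gamma>_def using integral_diff_Icc[OF gn, of r s] that ax by simp
    have pg: "norm (p s - p r) \<le> \<Gamma> s - \<Gamma> r" if "a \<le> r" "r \<le> s" "s \<le> x" for r s
      unfolding pd[OF that] \<Gamma>d[OF that]
      by (rule HK_norm_bound) (use that ax in \<open>auto intro: integrable_on_subinterval[OF gi] integrable_on_subinterval[OF gn]\<close>)
    have gax: "g integrable_on {a..x}" "(\<lambda>t. norm (g t)) integrable_on {a..x}"
      using integrable_on_subinterval[OF gi sub] integrable_on_subinterval[OF gn sub] by auto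
    have e'ax: "e' integrable_on {a..x}"
      by (intro integrable_continuous_real continuous_on_subset[OF e' sub])
    have Fax: "(\<lambda>t. e t * g t + e' t * p t) integrable_on {a..x}"
      by (rule integrable_on_subinterval[OF Fi sub])
    have i1: "integral {a..x} (\<lambda>t. e x * g t) = e x * (p x - p a)"
      using pd[of a x] ax by simp
    have i2: "integral {a..x} (\<lambda>t. e' t * p a) = (e x - e a) * p a"
    proof -
      have "(e' has_integral (e x - e a)) {a..x}"
        using ax by (intro fundamental_theorem_of_calculus has_vector_derivative_within_subset[OF e sub]) auto
      then show ?thesis by (simp add: integral_unique)
    qed
    have int1: "(\<lambda>t. e x * g t) integrable_on {a..x}" "(\<lambda>t. e' t * p a) integrable_on {a..x}"
      by (rule integrable_on_mult_right[OF gax(1)], rule integrable_on_mult_left[OF e'ax])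
    \<comment> \<open>The increment of the product is split with \<open>e\<close> frozen at
      \<open>x\<close> and \<open>p\<close> frozen at \<open>a\<close>; each remainder term then
      carries a small increment of \<open>e\<close> or of \<open>p\<close>. A pointwise product rule
      is not at hand since \<open>p\<close> is only the integral of \<open>g\<close>.\<close>
    have "D x - D a = (e x * (p x - p a) + (e x - e a) * p a) - integral {a..x} (\<lambda>t. e t * g t + e' t * p t)"
      unfolding D_def using integral_diff_Icc[OF Fi ax] by (simp add: algebra_simps)
    also have "\<dots> = integral {a..x} (\<lambda>t. (e x * g t + e' t * p a) - (e t * g t + e' t * p t))"
      unfolding integral_diff[OF integrable_add[OF int1] Fax] integral_add[OF int1] i1 i2 ..
    finally have "norm (D x - D a) \<le> integral {a..x} (\<lambda>t. L * (x - a) * norm (g t) + L * (\<Gamma> x - \<Gamma> a))"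
    proof (simp only:, intro HK_norm_bound)
      show "(\<lambda>t. e x * g t + e' t * p a - (e t * g t + e' t * p t)) integrable_on {a..x}"
        by (intro integrable_diff integrable_add[OF int1] Fax)
      show "(\<lambda>t. L * (x - a) * norm (g t) + L * (\<Gamma> x - \<Gamma> a)) integrable_on {a..x}"
        by (rule integrable_add[OF integrable_on_mult_right[OF gax(2)] integrable_const_ivl])
      fix t assume t: "t \<in> {a..x}"
      have \<Gamma>t: "0 \<le> \<Gamma> x - \<Gamma> t" by (rule order_trans[OF norm_ge_zero pg]) (use t in auto)
      have "e x * g t + e' t * p a - (e t * g t + e' t * p t) = (e x - e t) * g t + e' t * (p a - p t)"
        by (simp add: algebra_simps)
      also have "norm \<dots> \<le> norm (e x - e t) * norm (g t) + norm (e' t) * norm (p t - p a)"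
        by (metis norm_triangle_ineq norm_mult norm_minus_commute)
      also have "\<dots> \<le> (L * (x - a)) * norm (g t) + L * (\<Gamma> x - \<Gamma> a)"
      proof (intro add_mono mult_mono)
        have "norm (e x - e t) \<le> L * \<bar>x - t\<bar>" using lip[of x t] t sub ax by auto
        also have "\<dots> \<le> L * (x - a)" using t L(1) by (intro mult_left_mono) auto
        finally show "norm (e x - e t) \<le> L * (x - a)" .
        have "norm (p t - p a) \<le> \<Gamma> t - \<Gamma> a" by (rule pg) (use t in auto)
        then show "norm (p t - p a) \<le> \<Gamma> x - \<Gamma> a" using \<Gamma>t by linarith
      qed (use L t sub ax in auto)
      finally show "norm (e x * g t + e' t * p a - (e t * g t + e' t * p t)) \<le> L * (x - a) * norm (g t) + L * (\<Gamma> x - \<Gamma> a)" .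
    qed
    also have "\<dots> = L * (x - a) * (\<Gamma> x - \<Gamma> a) + L * (\<Gamma> x - \<Gamma> a) * (x - a)"
      unfolding integral_add[OF integrable_on_mult_right[OF gax(2)] integrable_const_ivl]
      using ax \<Gamma>d[of a x] by simp
    finally show ?thesis by (simp add: algebra_simps)
  qed
  have keyabs: "norm (D x - D a) \<le> 2 * L * \<bar>x - a\<bar> * \<bar>\<Gamma> x - \<Gamma> a\<bar>" if "x \<in> {0..1}" "a \<in> {0..1}" for a x
  proof (cases "a \<le> x")
    case True
    then have "norm (D x - D a) \<le> 2 * L * \<bar>x - a\<bar> * (\<Gamma> x - \<Gamma> a)" using key[of a x] that by simp
    also have "\<dots> \<le> 2 * L * \<bar>x - a\<bar> * \<bar>\<Gamma> x - \<Gamma> a\<bar>" using L by (intro mult_left_mono) auto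
    finally show ?thesis .
  next
    case False
    then have "norm (D a - D x) \<le> 2 * L * \<bar>x - a\<bar> * (\<Gamma> a - \<Gamma> x)" using key[of x a] that by simp
    also have "\<dots> \<le> 2 * L * \<bar>x - a\<bar> * \<bar>\<Gamma> x - \<Gamma> a\<bar>" using L by (intro mult_left_mono) auto
    finally show ?thesis by (simp add: norm_minus_commute)
  qed
  have "(D has_vector_derivative 0) (at a within {0..1})" if a: "a \<in> {0..1}" for a
    unfolding has_vector_derivative_def has_derivative_within
  proof (intro conjI)
    show "bounded_linear (\<lambda>x. x *\<^sub>R (0::complex))" by (simp add: bounded_linear_zero)
    have "((\<lambda>x. 2 * L * \<bar>\<Gamma> x - \<Gamma> a\<bar>) \<longlongrightarrow> 2 * L * \<bar>\<Gamma> a - \<Gamma> a\<bar>) (at a within {0..1})"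
      using cont\<Gamma> a by (intro tendsto_intros) (auto simp: continuous_on_def)
    then have "((\<lambda>x. 2 * L * \<bar>\<Gamma> x - \<Gamma> a\<bar>) \<longlongrightarrow> 0) (at a within {0..1})" by simp
    then show "((\<lambda>y. (1 / norm (y - a)) *\<^sub>R (D y - (D a + (y - a) *\<^sub>R 0))) \<longlongrightarrow> 0) (at a within {0..1})"
    proof (rule Lim_null_comparison[rotated])
      show "\<forall>\<^sub>F x in at a within {0..1}. norm ((1 / norm (x - a)) *\<^sub>R (D x - (D a + (x - a) *\<^sub>R 0))) \<le> 2 * L * \<bar>\<Gamma> x - \<Gamma> a\<bar>"
        unfolding eventually_at_filter
      proof (intro always_eventually allI impI)
        fix x assume "x \<noteq> a" "x \<in> {0..1}"
        with keyabs[OF \<open>x \<in> {0..1}\<close> a] show "norm ((1 / norm (x - a)) *\<^sub>R (D x - (D a + (x - a) *\<^sub>R 0))) \<le> 2 * L * \<bar>\<Gamma> x - \<Gamma> a\<bar>"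
          by (simp add: divide_le_eq mult_ac)
      qed
    qed
  qed
  then obtain c where c: "\<And>x. x \<in> {0..1} \<Longrightarrow> D x = c"
    using has_vector_derivative_zero_constant[of "{0..1::real}" D] by auto
  have "D x = D 0" using c[OF x] c[of 0] by simp
  then show ?thesis by (simp add: D_def algebra_simps)
qed

section \<open>The Dirac system in integral form\<close>

lemma norm_complex2_le: "norm (z :: complex^2) \<le> norm (z $ 1) + norm (z $ 2)"
  unfolding norm_vec_def by (rule order_trans[OF L2_set_le_sum]) (simp_all add: sum_2)

lemma complex2_eqI: "(z :: complex^2) $ 1 = w $ 1 \<Longrightarrow> z $ 2 = w $ 2 \<Longrightarrow> z = w"
  by (simp add: vec_eq_iff forall_2)

text \<open>Since B^2 = 1, this map inverts multiplication by -i B. Solving the differential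
  expression for y' therefore produces \<open>iB\<close> of the remaining terms.\<close>

definition iB :: "complex^2 \<Rightarrow> complex^2" where
  "iB z = vector [- \<i> * z $ 1, \<i> * z $ 2]"

definition dirac :: "(real \<Rightarrow> complex) \<Rightarrow> (real \<Rightarrow> complex) \<Rightarrow> complex \<Rightarrow> real \<Rightarrow> complex^2 \<Rightarrow> complex^2" where
  "dirac P R l t z = vector [- \<i> * l * z $ 1 + \<i> * P t * z $ 2, \<i> * l * z $ 2 - \<i> * R t * z $ 1]"

lemma iB_nth [simp]: "iB z $ 1 = - \<i> * z $ 1" "iB z $ 2 = \<i> * z $ 2"
  by (simp_all add: iB_def)

lemma dirac_nth [simp]:
  "dirac P R l t z $ 1 = - \<i> * l * z $ 1 + \<i> * P t * z $ 2"
  "dirac P R l t z $ 2 = \<i> * l * z $ 2 - \<i> * R t * z $ 1"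
  by (simp_all add: dirac_def)

lemma norm_iB: "norm (iB z) = norm z"
  by (simp add: norm_vec_def L2_set_def sum_2 norm_mult)

lemma linear_iB: "bounded_linear iB"
  by (rule bounded_linear_intro[where K = 1])
    (auto intro!: complex2_eqI simp: algebra_simps norm_iB)

lemma continuous_on_complex2:
  fixes f :: "real \<Rightarrow> complex^2"
  assumes "continuous_on S (\<lambda>t. f t $ 1)" "continuous_on S (\<lambda>t. f t $ 2)"
  shows "continuous_on S f"
proof -
  have "continuous_on S (\<lambda>t. \<chi> i. f t $ i)"
  proof (rule continuous_on_vec_lambda)
    show "continuous_on S (\<lambda>t. f t $ i)" for i
      using assms exhaust_2[of i] by auto
  qed
  then show ?thesis by simp
qed

text \<open>\<open>dsys P R l g y\<close> is the integral form of
  \<open>y' = i B (l - Q) y + g\<close> with \<open>Q\<^sub>1\<^sub>2 = P\<close> and \<open>Q\<^sub>2\<^sub>1 = R\<close>. The transposed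
  system is obtained for \<open>(R, P, - l)\<close>, and exchanging the two components of \<open>y\<close>
  gives the system for \<open>(- R, - P, - l)\<close>.\<close>

definition dsys :: "(real \<Rightarrow> complex) \<Rightarrow> (real \<Rightarrow> complex) \<Rightarrow> complex \<Rightarrow> (real \<Rightarrow> complex^2) \<Rightarrow> (real \<Rightarrow> complex^2) \<Rightarrow> bool" where
  "dsys P R l g y \<longleftrightarrow> continuous_on {0..1} y \<and> g absolutely_integrable_on {0..1} \<and>
     (\<forall>x\<in>{0..1}. y x = y 0 + integral {0..x} (\<lambda>t. dirac P R l t (y t) + g t))"

lemma dsysD:
  assumes "dsys P R l g y"
  shows "continuous_on {0..1} y" "g absolutely_integrable_on {0..1}"
    "x \<in> {0..1} \<Longrightarrow> y x = y 0 + integral {0..x} (\<lambda>t. dirac P R l t (y t) + g t)"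
  using assms unfolding dsys_def by blast+

locale potential =
  fixes P R :: "real \<Rightarrow> complex"
  assumes contP: "continuous_on {0..1} P" and contR: "continuous_on {0..1} R"
begin

lemma continuous_on_dirac:
  assumes "continuous_on {0..1} y" shows "continuous_on {0..1} (\<lambda>t. dirac P R l t (y t))"
  by (rule continuous_on_complex2) (auto intro!: continuous_intros contP contR assms)

lemma bound_ex: "\<exists>K\<ge>1. \<forall>t\<in>{0..1}. norm (P t) \<le> K \<and> norm (R t) \<le> K"
proof -
  have "bounded (P ` {0..1})" "bounded (R ` {0..1})"
    by (intro compact_imp_bounded compact_continuous_image contP contR; simp)+
  then obtain a b where "\<And>t. t \<in> {0..1} \<Longrightarrow> norm (P t) \<le> a" "\<And>t. t \<in> {0..1} \<Longrightarrow> norm (R t) \<le> b"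
    unfolding bounded_iff by blast
  then show ?thesis by (intro exI[of _ "max 1 (max a b)"]) (auto simp: le_max_iff_disj)
qed

definition K0 :: real where
  "K0 = (SOME K. K \<ge> 1 \<and> (\<forall>t\<in>{0..1}. norm (P t) \<le> K \<and> norm (R t) \<le> K))"

lemma K0: "1 \<le> K0" "t \<in> {0..1} \<Longrightarrow> norm (P t) \<le> K0" "t \<in> {0..1} \<Longrightarrow> norm (R t) \<le> K0"
  using someI_ex[OF bound_ex[unfolded Bex_def]] unfolding K0_def by blast+

lemma norm_dirac:
  assumes "t \<in> {0..1}"
  shows "norm (dirac P R l t z) \<le> 2 * (norm l + K0) * norm z"
proof -
  have "norm (dirac P R l t z) \<le> norm (- \<i> * l * z $ 1 + \<i> * P t * z $ 2) + norm (\<i> * l * z $ 2 - \<i> * R t * z $ 1)"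
    using norm_complex2_le[of "dirac P R l t z"] by simp
  also have "\<dots> \<le> (norm l * norm (z $ 1) + norm (P t) * norm (z $ 2)) + (norm l * norm (z $ 2) + norm (R t) * norm (z $ 1))"
    by (intro add_mono order_trans[OF norm_triangle_ineq] order_trans[OF norm_triangle_ineq4]) (simp_all add: norm_mult)
  also have "\<dots> \<le> (norm l * norm z + K0 * norm z) + (norm l * norm z + K0 * norm z)"
    using K0(2,3)[OF assms] by (intro add_mono mult_mono) (use K0(1) in \<open>auto simp: Finite_Cartesian_Product.norm_nth_le\<close>)
  finally show ?thesis by (simp add: algebra_simps)
qed

lemma dirac_diff: "dirac P R l t z - dirac P R l t z' = dirac P R l t (z - z')"
  by (rule complex2_eqI) (simp_all add: algebra_simps)

lemma dirac_shift: "dirac P R l t z = dirac P R m t z + (l - m) *s iB z"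
  by (rule complex2_eqI) (simp_all add: algebra_simps)

lemma kpos: "0 < 2 * (norm l + K0)"
  using K0(1) by (simp add: add_nonneg_pos)

lemma dsys_integrable:
  assumes "dsys P R l g y"
  shows "(\<lambda>t. dirac P R l t (y t) + g t) absolutely_integrable_on {0..1}"
  by (rule set_integral_add(1)[OF absolutely_integrable_continuous_real[OF continuous_on_dirac[OF dsysD(1)[OF assms]]] dsysD(2)[OF assms]])

lemma absint_D:
  fixes g :: "real \<Rightarrow> 'a::euclidean_space"
  assumes "g absolutely_integrable_on {0..1}" "x \<in> {0..1}"
  shows "g integrable_on {0..x}" "(\<lambda>t. norm (g t)) integrable_on {0..x}"
proof -
  have "{0..x} \<subseteq> {0..1}" using assms(2) by auto
  then show "g integrable_on {0..x}" "(\<lambda>t. norm (g t)) integrable_on {0..x}"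
    using assms(1) by (auto simp: absolutely_integrable_on_def intro: integrable_on_subinterval)
qed

lemma dsys_exists:
  assumes g: "g absolutely_integrable_on {0..1}"
  shows "\<exists>y. dsys P R l g y \<and> y 0 = a \<and> (\<forall>x. x \<notin> {0..1} \<longrightarrow> y x = 0)"
proof -
  obtain y where y: "continuous_on {0..1} y"
    "\<And>x. x \<in> {0..1} \<Longrightarrow> y x = (a + integral {0..x} g) + integral {0..x} (\<lambda>t. dirac P R l t (y t))"
  proof (rule volterra_exists[OF kpos])
    show "continuous_on {0..1} (\<lambda>x. a + integral {0..x} g)"
      by (intro continuous_intros indefinite_integral_continuous_1 absint_D[OF g]) simp
    show "norm (dirac P R l t z - dirac P R l t z') \<le> 2 * (norm l + K0) * norm (z - z')" if "t \<in> {0..1}" for t z z'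
      unfolding dirac_diff by (rule norm_dirac[OF that])
  qed (use continuous_on_dirac in auto)
  define w where "w x = (if x \<in> {0..1} then y x else 0)" for x
  have w: "w x = y x" if "x \<in> {0..1}" for x using that by (simp add: w_def)
  have cw: "continuous_on {0..1} w"
    using y(1) by (rule continuous_on_eq) (simp add: w)
  have w0: "w 0 = a" using y(2)[of 0] w[of 0] by simp
  have "w x = w 0 + integral {0..x} (\<lambda>t. dirac P R l t (w t) + g t)" if x: "x \<in> {0..1}" for x
  proof -
    have "integral {0..x} (\<lambda>t. dirac P R l t (w t) + g t) = integral {0..x} (\<lambda>t. dirac P R l t (w t)) + integral {0..x} g"
      using x by (intro integral_add absint_D[OF g] integrable_continuous_real continuous_on_subset[OF continuous_on_dirac[OF cw]]) auto
    also have "integral {0..x} (\<lambda>t. dirac P R l t (w t)) = integral {0..x} (\<lambda>t. dirac P R l t (y t))"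
      by (rule integral_cong) (use x w in auto)
    finally show ?thesis using y(2)[OF x] by (simp add: w[OF x] w0)
  qed
  then have "dsys P R l g w" using cw g unfolding dsys_def by blast
  then show ?thesis using w0 by (intro exI[of _ w]) (auto simp: w_def)
qed

text \<open>The source of exponential type: the exponent is linear in |l|, and the inhomogeneity
  enters only through its L1 norm.\<close>

lemma dsys_bound:
  assumes y: "dsys P R l g y" and x: "x \<in> {0..1}"
  shows "norm (y x) \<le> 2 * (norm (y 0) + integral {0..1} (\<lambda>t. norm (g t))) * exp (4 * (norm l + K0))"
proof -
  note D = dsysD[OF y]
  have nn: "norm (integral {0..s} g) \<le> integral {0..1} (\<lambda>t. norm (g t))" if "s \<in> {0..1}" for s
  proof -
    have "norm (integral {0..s} g) \<le> integral {0..s} (\<lambda>t. norm (g t))"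
      by (rule HK_norm_bound) (use absint_D[OF D(2) that] in auto)
    also have "\<dots> \<le> integral {0..1} (\<lambda>t. norm (g t))"
      by (rule integral_subset_le) (use that absint_D[OF D(2)] in auto)
    finally show ?thesis .
  qed
  have int: "(\<lambda>t. dirac P R l t (y t)) integrable_on {0..s}" if "s \<in> {0..1}" for s
    by (intro integrable_continuous_real continuous_on_subset[OF continuous_on_dirac[OF D(1)]]) (use that in auto)
  have "norm (y x) \<le> 2 * (norm (y 0) + integral {0..1} (\<lambda>t. norm (g t))) * exp (2 * (2 * (norm l + K0)) * x)"
  proof (rule volterra_bound[OF kpos D(1) _ _ _ _ x])
    show "(\<lambda>t. dirac P R l t (y t)) integrable_on {0..1}" by (rule int) simp
    show "y s = (y 0 + integral {0..s} g) + integral {0..s} (\<lambda>t. dirac P R l t (y t))" if "s \<in> {0..1}" for s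
      using D(3)[OF that] integral_add[OF int[OF that] absint_D(1)[OF D(2) that]] by simp
    show "norm (y 0 + integral {0..s} g) \<le> norm (y 0) + integral {0..1} (\<lambda>t. norm (g t))" if "s \<in> {0..1}" for s
      using norm_triangle_ineq[of "y 0" "integral {0..s} g"] nn[OF that] by linarith
  qed (rule norm_dirac)
  also have "\<dots> \<le> 2 * (norm (y 0) + integral {0..1} (\<lambda>t. norm (g t))) * exp (4 * (norm l + K0))"
  proof (intro mult_left_mono)
    have "(4 * (norm l + K0)) * x \<le> (4 * (norm l + K0)) * 1"
      using x K0(1) by (intro mult_left_mono) auto
    then show "exp (2 * (2 * (norm l + K0)) * x) \<le> exp (4 * (norm l + K0))" by simp
    show "0 \<le> 2 * (norm (y 0) + integral {0..1} (\<lambda>t. norm (g t)))"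
      by (simp add: integral_nonneg[OF absint_D(2)[OF D(2)]])
  qed
  finally show ?thesis .
qed

lemma absint_smult:
  fixes g :: "real \<Rightarrow> complex^2"
  assumes "g absolutely_integrable_on S"
  shows "(\<lambda>t. c *s g t) absolutely_integrable_on S"
proof -
  have "bounded_linear (\<lambda>z :: complex^2. c *s z)"
    by (auto intro!: linear_conv_bounded_linear[THEN iffD1] linearI complex2_eqI simp: algebra_simps)
  from absolutely_integrable_linear[OF assms this] show ?thesis by (simp add: comp_def)
qed

lemma dsys_lincomb:
  assumes y: "dsys P R l g y" and y': "dsys P R l g' y'"
  shows "dsys P R l (\<lambda>t. g t + c *s g' t) (\<lambda>t. y t + c *s y' t)"
  unfolding dsys_def
proof (intro conjI ballI)
  note D = dsysD[OF y] dsysD[OF y']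
  have lin: "bounded_linear (\<lambda>z :: complex^2. c *s z)"
    by (auto intro!: linear_conv_bounded_linear[THEN iffD1] linearI complex2_eqI simp: algebra_simps)
  show "continuous_on {0..1} (\<lambda>t. y t + c *s y' t)"
    by (intro continuous_intros D bounded_linear.continuous_on[OF lin])
  show "(\<lambda>t. g t + c *s g' t) absolutely_integrable_on {0..1}"
    by (intro set_integral_add D absint_smult)
  fix x :: real assume x: "x \<in> {0..1}"
  note I = absint_D(1)[OF dsys_integrable[OF y] x] absint_D(1)[OF dsys_integrable[OF y'] x]
  have "integral {0..x} (\<lambda>t. dirac P R l t (y t + c *s y' t) + (g t + c *s g' t))
      = integral {0..x} (\<lambda>t. (dirac P R l t (y t) + g t) + c *s (dirac P R l t (y' t) + g' t))"
    by (rule integral_cong) (auto intro!: complex2_eqI simp: algebra_simps)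
  also have "\<dots> = integral {0..x} (\<lambda>t. dirac P R l t (y t) + g t) + c *s integral {0..x} (\<lambda>t. dirac P R l t (y' t) + g' t)"
    using integral_linear[OF I(2) lin] integral_add[OF I(1) integrable_linear[OF I(2) lin]] by (simp add: comp_def)
  finally show "y x + c *s y' x = y 0 + c *s y' 0 + integral {0..x} (\<lambda>t. dirac P R l t (y t + c *s y' t) + (g t + c *s g' t))"
    using D(3)[OF x] D(6)[OF x] by (simp add: algebra_simps vector_add_ldistrib)
qed

lemma dsys_cong:
  assumes "dsys P R l g y" "\<And>t. t \<in> {0..1} \<Longrightarrow> g t = g' t" "\<And>t. t \<in> {0..1} \<Longrightarrow> y t = y' t"
  shows "dsys P R l g' y'"
  unfolding dsys_def
proof (intro conjI ballI)
  note D = dsysD[OF assms(1)]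
  show "continuous_on {0..1} y'" using D(1) assms(3) by (rule continuous_on_eq)
  show "g' absolutely_integrable_on {0..1}"
    using D(2) assms(2) by (subst set_integrable_cong[OF refl refl, of _ _ g]) auto
  fix x :: real assume x: "x \<in> {0..1}"
  have "integral {0..x} (\<lambda>t. dirac P R l t (y t) + g t) = integral {0..x} (\<lambda>t. dirac P R l t (y' t) + g' t)"
    by (rule integral_cong) (use x assms in auto)
  then show "y' x = y' 0 + integral {0..x} (\<lambda>t. dirac P R l t (y' t) + g' t)"
    using D(3)[OF x] assms(3)[OF x] assms(3)[of 0] by simp
qed

lemma dsys_unique:
  assumes y: "dsys P R l g y" and y': "dsys P R l g y'" and "y 0 = y' 0" and x: "x \<in> {0..1}"
  shows "y x = y' x"
proof -
  have "dsys P R l (\<lambda>_. 0) (\<lambda>t. y t - y' t)"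
    by (rule dsys_cong[OF dsys_lincomb[OF y y', of "- 1"]]) (auto intro!: complex2_eqI)
  from dsys_bound[OF this x] show ?thesis using assms(3) by simp
qed

lemma absint_continuous:
  fixes y :: "real \<Rightarrow> complex^2"
  assumes "continuous_on {0..1} y"
  shows "(\<lambda>t. iB (y t)) absolutely_integrable_on {0..1}"
  by (intro absolutely_integrable_continuous_real bounded_linear.continuous_on[OF linear_iB] assms)

text \<open>A change of the parameter is moved into the inhomogeneity. Taylor remainders, Jordan
  chains and resolvents can thereby be compared at one fixed parameter.\<close>

lemma dsys_shift:
  assumes y: "dsys P R l g y"
  shows "dsys P R m (\<lambda>t. g t + (l - m) *s iB (y t)) y"
  unfolding dsys_def
proof (intro conjI ballI)
  note D = dsysD[OF y]
  show "continuous_on {0..1} y" by (rule D)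
  show "(\<lambda>t. g t + (l - m) *s iB (y t)) absolutely_integrable_on {0..1}"
    by (intro set_integral_add D absint_smult absint_continuous)
  show "y x = y 0 + integral {0..x} (\<lambda>t. dirac P R m t (y t) + (g t + (l - m) *s iB (y t)))" if "x \<in> {0..1}" for x
  proof -
    have "(\<lambda>t. dirac P R m t (y t) + (g t + (l - m) *s iB (y t))) = (\<lambda>t. dirac P R l t (y t) + g t)"
      using dirac_shift[of l _ _ m] by (simp add: fun_eq_iff add_ac)
    then show ?thesis using D(3)[OF that] by simp
  qed
qed

end

section \<open>Dependence on the spectral parameter\<close>

lemma entire_taylor:
  assumes f: "f holomorphic_on UNIV"
  shows "\<exists>C\<ge>0. \<forall>l. norm (l - m) \<le> 1 \<longrightarrow>
    norm (f l - (\<Sum>k<n. (l - m) ^ k * ((deriv ^^ k) f m / fact k))) \<le> C * norm (l - m) ^ n"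
proof (cases n)
  case 0
  have "compact (f ` cball m 1)"
    by (intro compact_continuous_image holomorphic_on_imp_continuous_on holomorphic_on_subset[OF f]) auto
  from compact_imp_bounded[OF this] obtain B where B: "\<forall>x\<in>f ` cball m 1. norm x \<le> B"
    unfolding bounded_iff by blast
  have "norm (f l) \<le> max 0 B" if "norm (l - m) \<le> 1" for l
    using B[rule_format, of "f l"] that by (simp add: dist_norm norm_minus_commute)
  then show ?thesis using 0 by (intro exI[of _ "max 0 B"]) auto
next
  case (Suc j)
  have hol: "(deriv ^^ i) f holomorphic_on UNIV" for i
    by (intro holomorphic_higher_deriv f) auto
  have "compact ((deriv ^^ n) f ` cball m 1)"
    by (intro compact_continuous_image holomorphic_on_imp_continuous_on holomorphic_on_subset[OF hol]) auto
  from compact_imp_bounded[OF this] obtain B where B: "\<forall>x\<in>(deriv ^^ n) f ` cball m 1. norm x \<le> B"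
    unfolding bounded_iff by blast
  have "norm (f l - (\<Sum>k<n. (l - m) ^ k * ((deriv ^^ k) f m / fact k))) \<le> (max 0 B / fact j) * norm (l - m) ^ n"
    if l: "norm (l - m) \<le> 1" for l
  proof -
    have "norm ((deriv ^^ 0) f l - (\<Sum>i\<le>j. (deriv ^^ i) f m * (l - m) ^ i / fact i)) \<le> max 0 B * norm (l - m) ^ Suc j / fact j"
    proof (rule complex_Taylor[where S = "cball m 1"])
      show "((deriv ^^ i) f has_field_derivative (deriv ^^ Suc i) f x) (at x within cball m 1)" for i x
        using holomorphic_derivI[OF hol[of i] open_UNIV UNIV_I] by (auto intro: has_field_derivative_at_within)
      show "norm ((deriv ^^ Suc j) f x) \<le> max 0 B" if "x \<in> cball m 1" for x
        using B that Suc by force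
      show "l \<in> cball m 1" using l by (simp add: dist_norm norm_minus_commute)
    qed auto
    moreover have "(\<Sum>i\<le>j. (deriv ^^ i) f m * (l - m) ^ i / fact i) = (\<Sum>k<n. (l - m) ^ k * ((deriv ^^ k) f m / fact k))"
      unfolding Suc lessThan_Suc_atMost by (intro sum.cong) auto
    ultimately show ?thesis by (simp add: Suc)
  qed
  then show ?thesis by (intro exI[of _ "max 0 B / fact j"]) auto
qed

text \<open>Divided by l - m, the remainder tends to 0, so \<open>b\<close> is the derivative at
  \<open>m\<close>. Second-order estimates at every point thus replace differentiation under the
  integral.\<close>

lemma entire_of_quadratic_remainder:
  fixes f :: "complex \<Rightarrow> complex"
  assumes "\<And>m. \<exists>a b C. \<forall>l. norm (l - m) \<le> 1 \<longrightarrow> norm (f l - (a + (l - m) * b)) \<le> C * norm (l - m) ^ 2"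
  shows "f holomorphic_on UNIV"
proof -
  have "\<exists>b. (f has_field_derivative b) (at m)" for m
  proof -
    obtain a b C where C: "\<And>l. norm (l - m) \<le> 1 \<Longrightarrow> norm (f l - (a + (l - m) * b)) \<le> C * norm (l - m) ^ 2"
      using assms[of m] by blast
    have a: "f m = a" using C[of m] by simp
    have "((\<lambda>l. (f l - f m) / (l - m) - b) \<longlongrightarrow> 0) (at m)"
    proof (rule Lim_null_comparison)
      have "((\<lambda>l. C * norm (l - m)) \<longlongrightarrow> C * norm (m - m)) (at m)" by (intro tendsto_intros)
      then show "((\<lambda>l. C * norm (l - m)) \<longlongrightarrow> 0) (at m)" by simp
      show "\<forall>\<^sub>F l in at m. norm ((f l - f m) / (l - m) - b) \<le> C * norm (l - m)"
        unfolding eventually_at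
      proof (intro exI[of _ 1] conjI ballI impI)
        fix l assume l: "l \<noteq> m \<and> dist l m < 1"
        have "(f l - f m) / (l - m) - b = (f l - (a + (l - m) * b)) / (l - m)"
          using l by (simp add: a field_simps)
        also have "norm \<dots> \<le> C * norm (l - m) ^ 2 / norm (l - m)"
          unfolding norm_divide using C[of l] l by (intro divide_right_mono) (auto simp: dist_norm)
        also have "\<dots> = C * norm (l - m)" using l by (simp add: power2_eq_square)
        finally show "norm ((f l - f m) / (l - m) - b) \<le> C * norm (l - m)" .
      qed auto
    qed
    then have "((\<lambda>l. (f l - f m) / (l - m)) \<longlongrightarrow> b) (at m)" by (simp add: LIM_zero_iff)
    then show ?thesis by (auto simp: has_field_derivative_iff)
  qed
  then show ?thesis by (auto simp: holomorphic_on_def field_differentiable_def)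
qed

text \<open>A complex-linear functional on continuous functions on [0,1], bounded for the supremum
  norm. The bound also makes the values off the interval irrelevant.\<close>

definition cfunctional :: "((real \<Rightarrow> complex^2) \<Rightarrow> complex) \<Rightarrow> bool" where
  "cfunctional \<Lambda> \<longleftrightarrow>
    (\<exists>B\<ge>0. \<forall>y M. continuous_on {0..1} y \<longrightarrow> (\<forall>x\<in>{0..1}. norm (y x) \<le> M) \<longrightarrow> norm (\<Lambda> y) \<le> B * M) \<and>
    (\<forall>y y' c. continuous_on {0..1} y \<longrightarrow> continuous_on {0..1} y' \<longrightarrow>
       \<Lambda> (\<lambda>t. y t + c *s y' t) = \<Lambda> y + c * \<Lambda> y')"

lemma cfunctional_bound:
  assumes "cfunctional \<Lambda>"
  obtains B where "0 \<le> B" "\<And>y M. continuous_on {0..1} y \<Longrightarrow> (\<And>x. x \<in> {0..1} \<Longrightarrow> norm (y x) \<le> M) \<Longrightarrow> norm (\<Lambda> y) \<le> B * M"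
  using assms unfolding cfunctional_def by blast

lemma cfunctional_lincomb:
  assumes "cfunctional \<Lambda>" "continuous_on {0..1} y" "continuous_on {0..1} y'"
  shows "\<Lambda> (\<lambda>t. y t + c *s y' t) = \<Lambda> y + c * \<Lambda> y'"
  using assms unfolding cfunctional_def by blast

lemma cfunctional_eval: "x \<in> {0..1} \<Longrightarrow> cfunctional (\<lambda>y. y x $ i)"
  unfolding cfunctional_def
  by (auto intro!: exI[of _ "1::real"] intro: order_trans[OF Finite_Cartesian_Product.norm_nth_le])

definition bc :: "complex^2 \<Rightarrow> complex^2 \<Rightarrow> (real \<Rightarrow> complex^2) \<Rightarrow> complex" where
  "bc c d y = c $ 1 * y 0 $ 1 + c $ 2 * y 0 $ 2 + d $ 1 * y 1 $ 1 + d $ 2 * y 1 $ 2"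

lemma bc_bound:
  assumes "norm (y 0) \<le> M" "norm (y 1) \<le> M"
  shows "norm (bc c d y) \<le> (norm (c $ 1) + norm (c $ 2) + norm (d $ 1) + norm (d $ 2)) * M"
proof -
  have "norm (bc c d y) \<le> norm (c $ 1 * y 0 $ 1) + norm (c $ 2 * y 0 $ 2) + norm (d $ 1 * y 1 $ 1) + norm (d $ 2 * y 1 $ 2)"
    unfolding bc_def by (intro norm_triangle_le add_mono order_refl)
  also have "\<dots> \<le> norm (c $ 1) * M + norm (c $ 2) * M + norm (d $ 1) * M + norm (d $ 2) * M"
    unfolding norm_mult using assms
    by (intro add_mono mult_left_mono order_trans[OF Finite_Cartesian_Product.norm_nth_le]) auto
  finally show ?thesis by (simp add: algebra_simps)
qed

lemma cfunctional_bc: "cfunctional (bc c d)"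
  unfolding cfunctional_def
proof (intro conjI allI impI)
  show "\<exists>B\<ge>0. \<forall>y M. continuous_on {0..1} y \<longrightarrow> (\<forall>x\<in>{0..1}. norm (y x) \<le> M) \<longrightarrow> norm (bc c d y) \<le> B * M"
    by (rule exI[of _ "norm (c $ 1) + norm (c $ 2) + norm (d $ 1) + norm (d $ 2)"]) (auto intro: bc_bound)
qed (simp add: bc_def algebra_simps)

text \<open>Free of conjugation, so that Lagrange's identity involves the transposed system and
  everything stays holomorphic in the parameter.\<close>

definition pairing :: "(real \<Rightarrow> complex^2) \<Rightarrow> (real \<Rightarrow> complex^2) \<Rightarrow> complex" where
  "pairing h y = integral {0..1} (\<lambda>t. h t $ 1 * y t $ 1 + h t $ 2 * y t $ 2)"

lemma absint_nth:
  fixes h :: "real \<Rightarrow> complex^2"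
  assumes "h absolutely_integrable_on S" shows "(\<lambda>t. h t $ i) absolutely_integrable_on S"
  using absolutely_integrable_linear[OF assms bounded_linear_vec_nth[of i]] by (simp add: comp_def)

lemma pairing_absint:
  fixes h y :: "real \<Rightarrow> complex^2"
  assumes h: "h absolutely_integrable_on {0..1}" and y: "continuous_on {0..1} y"
  shows "(\<lambda>t. h t $ 1 * y t $ 1 + h t $ 2 * y t $ 2) absolutely_integrable_on {0..1}"
proof -
  have "(\<lambda>t. y t $ i * h t $ i) absolutely_integrable_on {0..1}" for i
    by (intro absolutely_integrable_continuous_mult absint_nth h continuous_intros y)
  from set_integral_add(1)[OF this[of 1] this[of 2]] show ?thesis by (simp add: mult.commute)
qed

lemma cfunctional_pairing:
  fixes h :: "real \<Rightarrow> complex^2"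
  assumes h: "h absolutely_integrable_on {0..1}"
  shows "cfunctional (pairing h)"
  unfolding cfunctional_def
proof (intro conjI allI impI)
  have int: "(\<lambda>t. h t $ 1 * y t $ 1 + h t $ 2 * y t $ 2) integrable_on {0..1}" if "continuous_on {0..1} y" for y :: "real \<Rightarrow> complex^2"
    using pairing_absint[OF h that] by (simp add: absolutely_integrable_on_def)
  have hn: "(\<lambda>t. norm (h t)) integrable_on {0..1}" using h by (simp add: absolutely_integrable_on_def)
  show "\<exists>B\<ge>0. \<forall>y M. continuous_on {0..1} y \<longrightarrow> (\<forall>x\<in>{0..1}. norm (y x) \<le> M) \<longrightarrow> norm (pairing h y) \<le> B * M"
  proof (intro exI conjI allI impI)
    show "0 \<le> 2 * integral {0..1} (\<lambda>t. norm (h t))" by (simp add: integral_nonneg[OF hn])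
    fix y :: "real \<Rightarrow> complex^2" and M assume y: "continuous_on {0..1} y" "\<forall>x\<in>{0..1}. norm (y x) \<le> M"
    have "norm (pairing h y) \<le> integral {0..1} (\<lambda>t. norm (h t) * (2 * M))"
      unfolding pairing_def
    proof (rule HK_norm_bound[OF int[OF y(1)]])
      show "(\<lambda>t. norm (h t) * (2 * M)) integrable_on {0..1}" by (rule integrable_on_mult_left[OF hn])
      fix t :: real assume t: "t \<in> {0..1}"
      have yt: "norm (y t $ i) \<le> M" for i using y(2) t Finite_Cartesian_Product.norm_nth_le[of "y t" i] by (meson order_trans)
      have "norm (h t $ 1 * y t $ 1 + h t $ 2 * y t $ 2) \<le> norm (h t $ 1) * norm (y t $ 1) + norm (h t $ 2) * norm (y t $ 2)"
        by (metis norm_triangle_ineq norm_mult)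
      also have "\<dots> \<le> norm (h t) * M + norm (h t) * M"
        by (intro add_mono mult_mono yt Finite_Cartesian_Product.norm_nth_le) auto
      finally show "norm (h t $ 1 * y t $ 1 + h t $ 2 * y t $ 2) \<le> norm (h t) * (2 * M)" by (simp add: algebra_simps)
    qed
    then show "norm (pairing h y) \<le> 2 * integral {0..1} (\<lambda>t. norm (h t)) * M" by (simp add: mult_ac)
  qed
  fix y y' :: "real \<Rightarrow> complex^2" and c assume y: "continuous_on {0..1} y" "continuous_on {0..1} y'"
  have "pairing h (\<lambda>t. y t + c *s y' t)
      = integral {0..1} (\<lambda>t. (h t $ 1 * y t $ 1 + h t $ 2 * y t $ 2) + c * (h t $ 1 * y' t $ 1 + h t $ 2 * y' t $ 2))"
    unfolding pairing_def by (rule integral_cong) (simp add: algebra_simps)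
  also have "\<dots> = pairing h y + c * pairing h y'"
    unfolding pairing_def integral_add[OF int[OF y(1)] integrable_on_mult_right[OF int[OF y(2)]]] by simp
  finally show "pairing h (\<lambda>t. y t + c *s y' t) = pairing h y + c * pairing h y'" .
qed

context potential
begin

definition sol :: "complex \<Rightarrow> (real \<Rightarrow> complex^2) \<Rightarrow> complex^2 \<Rightarrow> real \<Rightarrow> complex^2" where
  "sol l g a = (SOME y. dsys P R l g y \<and> y 0 = a \<and> (\<forall>x. x \<notin> {0..1} \<longrightarrow> y x = 0))"

lemma sol:
  assumes "g absolutely_integrable_on {0..1}"
  shows "dsys P R l g (sol l g a)" "sol l g a 0 = a" "x \<notin> {0..1} \<Longrightarrow> sol l g a x = 0"
  using someI_ex[OF dsys_exists[OF assms, of l a]] unfolding sol_def by blast+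

text \<open>\<open>tay m g a k\<close> is the coefficient of \<open>(l - m)\<^sup>k\<close> in the solution with parameter \<open>l\<close>,
  right-hand side \<open>g\<close> and initial value \<open>\<Sum>k. (l - m)\<^sup>k a k\<close>.\<close>

fun tay :: "complex \<Rightarrow> (real \<Rightarrow> complex^2) \<Rightarrow> (nat \<Rightarrow> complex^2) \<Rightarrow> nat \<Rightarrow> real \<Rightarrow> complex^2" where
  "tay m g a 0 = sol m g (a 0)"
| "tay m g a (Suc k) = sol m (\<lambda>t. iB (tay m g a k t)) (a (Suc k))"

lemma tay:
  assumes g: "g absolutely_integrable_on {0..1}"
  shows "dsys P R m (case k of 0 \<Rightarrow> g | Suc j \<Rightarrow> (\<lambda>t. iB (tay m g a j t))) (tay m g a k)
    \<and> tay m g a k 0 = a k \<and> (\<forall>x. x \<notin> {0..1} \<longrightarrow> tay m g a k x = 0)"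
proof (induction k)
  case 0
  show ?case using sol[OF g] by simp
next
  case (Suc k)
  have "(\<lambda>t. iB (tay m g a k t)) absolutely_integrable_on {0..1}"
    using Suc dsysD(1) by (blast intro: absint_continuous)
  then show ?case using sol by simp
qed

lemma cont_tay: "g absolutely_integrable_on {0..1} \<Longrightarrow> continuous_on {0..1} (tay m g a k)"
  using tay dsysD(1) by blast

text \<open>The remainder after n + 1 terms solves the system at \<open>m\<close> with inhomogeneity
  l - m times \<open>iB\<close> of the remainder after n terms. Each step therefore gains one factor
  l - m, uniformly in x.\<close>

lemma taylor_bound:
  assumes u: "\<And>l. dsys P R l g (u l)"
    and a: "\<And>n. \<exists>C\<ge>0. \<forall>l. norm (l - m) \<le> 1 \<longrightarrow> norm (u l 0 - (\<Sum>k<n. (l - m) ^ k *s a k)) \<le> C * norm (l - m) ^ n"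
  shows "\<exists>C\<ge>0. \<forall>l x. norm (l - m) \<le> 1 \<longrightarrow> x \<in> {0..1} \<longrightarrow>
    norm (u l x - (\<Sum>k<n. (l - m) ^ k *s tay m g a k x)) \<le> C * norm (l - m) ^ n"
proof -
  have g: "g absolutely_integrable_on {0..1}" using u dsysD(2) by blast
  define r where "r l n x = u l x - (\<Sum>k<n. (l - m) ^ k *s tay m g a k x)" for l n x
  have rS: "r l (Suc n) = (\<lambda>x. r l n x + (- ((l - m) ^ n)) *s tay m g a n x)" for l n
    by (rule ext, rule complex2_eqI) (simp_all add: r_def)
  have sys: "dsys P R m (case n of 0 \<Rightarrow> (\<lambda>t. g t + (l - m) *s iB (u l t)) | Suc j \<Rightarrow> (\<lambda>t. (l - m) *s iB (r l j t))) (r l n)" for l n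
  proof (induction n)
    case 0
    have "r l 0 = u l" by (simp add: r_def fun_eq_iff)
    then show ?case using dsys_shift[OF u] by simp
  next
    case (Suc n)
    have T: "dsys P R m (case n of 0 \<Rightarrow> g | Suc j \<Rightarrow> (\<lambda>t. iB (tay m g a j t))) (tay m g a n)"
      using tay[OF g] by blast
    show ?case
      unfolding rS[of l n]
    proof (rule dsys_cong[OF dsys_lincomb[OF Suc T, of "- ((l - m) ^ n)"]], goal_cases)
      case (1 t)
      show ?case
      proof (cases n)
        case 0
        have "r l 0 = u l" by (simp add: r_def fun_eq_iff)
        then show ?thesis using 0 by (auto intro!: complex2_eqI)
      next
        case (Suc j)
        show ?thesis
          unfolding Suc nat.case rS[of l j]
          by (rule complex2_eqI) (simp_all add: algebra_simps)
      qed
    qed simp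
  qed
  have "\<exists>C\<ge>0. \<forall>l x. norm (l - m) \<le> 1 \<longrightarrow> x \<in> {0..1} \<longrightarrow> norm (r l n x) \<le> C * norm (l - m) ^ n"
  proof (induction n)
    case 0
    obtain C where C: "0 \<le> C" "\<And>l. norm (l - m) \<le> 1 \<Longrightarrow> norm (u l 0) \<le> C"
      using a[of 0] by auto
    define C' where "C' = 2 * (C + integral {0..1} (\<lambda>t. norm (g t))) * exp (4 * (norm m + 1 + K0))"
    have G: "0 \<le> integral {0..1} (\<lambda>t. norm (g t))"
      using absint_D(2)[OF g, of 1] by (auto intro: integral_nonneg)
    have "norm (r l 0 x) \<le> C'" if l: "norm (l - m) \<le> 1" and x: "x \<in> {0..1}" for l x
    proof -
      have "norm (u l x) \<le> 2 * (norm (u l 0) + integral {0..1} (\<lambda>t. norm (g t))) * exp (4 * (norm l + K0))"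
        by (rule dsys_bound[OF u x])
      also have "\<dots> \<le> C'"
        unfolding C'_def
      proof (intro mult_mono add_mono C(2)[OF l])
        have "norm l \<le> norm m + 1" using norm_triangle_sub[of l m] l by linarith
        then show "exp (4 * (norm l + K0)) \<le> exp (4 * (norm m + 1 + K0))" by simp
      qed (use G C in auto)
      finally show ?thesis by (simp add: r_def)
    qed
    moreover have "0 \<le> C'" unfolding C'_def using G C by auto
    ultimately show ?case by (intro exI[of _ C']) auto
  next
    case (Suc n)
    obtain C where C: "0 \<le> C" "\<And>l x. norm (l - m) \<le> 1 \<Longrightarrow> x \<in> {0..1} \<Longrightarrow> norm (r l n x) \<le> C * norm (l - m) ^ n"
      using Suc.IH by blast
    obtain C1 where C1: "0 \<le> C1" "\<And>l. norm (l - m) \<le> 1 \<Longrightarrow> norm (u l 0 - (\<Sum>k<Suc n. (l - m) ^ k *s a k)) \<le> C1 * norm (l - m) ^ Suc n"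
      using a[of "Suc n"] by blast
    have r0: "norm (r l (Suc n) 0) \<le> C1 * norm (l - m) ^ Suc n" if "norm (l - m) \<le> 1" for l
      using C1(2)[OF that] tay[OF g, where m = m and a = a] by (simp add: r_def)
    define C' where "C' = 2 * (C1 + C) * exp (4 * (norm m + K0))"
    have "norm (r l (Suc n) x) \<le> C' * norm (l - m) ^ Suc n" if l: "norm (l - m) \<le> 1" and x: "x \<in> {0..1}" for l x
    proof -
      have S: "dsys P R m (\<lambda>t. (l - m) *s iB (r l n t)) (r l (Suc n))" using sys[where n = "Suc n" and l = l] by simp
      have b: "norm (r l (Suc n) x) \<le> 2 * (norm (r l (Suc n) 0) + integral {0..1} (\<lambda>t. norm ((l - m) *s iB (r l n t)))) * exp (4 * (norm m + K0))"
        by (rule dsys_bound[OF S x])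
      have I: "integral {0..1} (\<lambda>t. norm ((l - m) *s iB (r l n t))) \<le> integral {0..1} (\<lambda>t::real. C * norm (l - m) ^ Suc n)"
      proof (rule integral_le)
        show "(\<lambda>t. norm ((l - m) *s iB (r l n t))) integrable_on {0..1}"
          by (rule absint_D(2)[OF dsysD(2)[OF S]]) simp
        show "norm ((l - m) *s iB (r l n t)) \<le> C * norm (l - m) ^ Suc n" if t: "t \<in> {0..1}" for t
        proof -
          have "norm ((l - m) *s iB (r l n t)) = norm (l - m) * norm (r l n t)"
            by (simp only: norm_vector_smult norm_iB)
          also have "\<dots> \<le> norm (l - m) * (C * norm (l - m) ^ n)"
            using C(2)[OF l t] by (intro mult_left_mono) auto
          finally show ?thesis by (simp add: mult_ac)
        qed
      qed (rule integrable_const_ivl)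
      note b
      also have "2 * (norm (r l (Suc n) 0) + integral {0..1} (\<lambda>t. norm ((l - m) *s iB (r l n t)))) * exp (4 * (norm m + K0))
          \<le> 2 * (C1 * norm (l - m) ^ Suc n + C * norm (l - m) ^ Suc n) * exp (4 * (norm m + K0))"
        using r0[OF l] I by (intro mult_right_mono mult_left_mono add_mono) simp_all
      finally show ?thesis by (simp add: C'_def algebra_simps)
    qed
    moreover have "0 \<le> C'" using C C1 by (simp add: C'_def)
    ultimately show ?case by (intro exI[of _ C']) auto
  qed
  then show ?thesis unfolding r_def .
qed

lemma taylor_functional:
  assumes \<Lambda>: "cfunctional \<Lambda>" and u: "\<And>l. dsys P R l g (u l)"
    and a: "\<And>n. \<exists>C\<ge>0. \<forall>l. norm (l - m) \<le> 1 \<longrightarrow> norm (u l 0 - (\<Sum>k<n. (l - m) ^ k *s a k)) \<le> C * norm (l - m) ^ n"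
  shows "\<exists>C\<ge>0. \<forall>l. norm (l - m) \<le> 1 \<longrightarrow>
    norm (\<Lambda> (u l) - (\<Sum>k<n. (l - m) ^ k * \<Lambda> (tay m g a k))) \<le> C * norm (l - m) ^ n"
proof -
  have g: "g absolutely_integrable_on {0..1}" using u dsysD(2) by blast
  obtain C where C: "0 \<le> C" "\<And>l x. norm (l - m) \<le> 1 \<Longrightarrow> x \<in> {0..1} \<Longrightarrow>
      norm (u l x - (\<Sum>k<n. (l - m) ^ k *s tay m g a k x)) \<le> C * norm (l - m) ^ n"
    using taylor_bound[OF u a, of n] by blast
  obtain B where B: "0 \<le> B" "\<And>y M. continuous_on {0..1} y \<Longrightarrow> (\<And>x. x \<in> {0..1} \<Longrightarrow> norm (y x) \<le> M) \<Longrightarrow> norm (\<Lambda> y) \<le> B * M"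
    using cfunctional_bound[OF \<Lambda>] by blast
  have eq: "\<Lambda> (\<lambda>x. u l x - (\<Sum>k<n. (l - m) ^ k *s tay m g a k x)) = \<Lambda> (u l) - (\<Sum>k<n. (l - m) ^ k * \<Lambda> (tay m g a k))
    \<and> continuous_on {0..1} (\<lambda>x. u l x - (\<Sum>k<n. (l - m) ^ k *s tay m g a k x))" for l n
  proof (induction n)
    case 0
    show ?case using dsysD(1)[OF u] by simp
  next
    case (Suc n)
    have *: "(\<lambda>x. u l x - (\<Sum>k<Suc n. (l - m) ^ k *s tay m g a k x)) =
        (\<lambda>x. (u l x - (\<Sum>k<n. (l - m) ^ k *s tay m g a k x)) + (- ((l - m) ^ n)) *s tay m g a n x)"
      by (rule ext, rule complex2_eqI) simp_all
    have "continuous_on {0..1} (\<lambda>x. (- ((l - m) ^ n)) *s tay m g a n x)"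
      by (rule continuous_on_complex2) (auto intro!: continuous_intros cont_tay[OF g])
    then have "continuous_on {0..1} (\<lambda>x. (u l x - (\<Sum>k<n. (l - m) ^ k *s tay m g a k x)) + (- ((l - m) ^ n)) *s tay m g a n x)"
      by (rule continuous_on_add[OF conjunct2[OF Suc.IH]])
    then show ?case
      unfolding * cfunctional_lincomb[OF \<Lambda> conjunct2[OF Suc.IH] cont_tay[OF g]] conjunct1[OF Suc.IH] by simp
  qed
  have "norm (\<Lambda> (u l) - (\<Sum>k<n. (l - m) ^ k * \<Lambda> (tay m g a k))) \<le> (B * C) * norm (l - m) ^ n" if "norm (l - m) \<le> 1" for l
    using B(2)[OF conjunct2[OF eq[where l = l and n = n]] C(2)[OF that]] conjunct1[OF eq[where l = l and n = n]] by (simp add: mult_ac)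
  then show ?thesis using B C by (intro exI[of _ "B * C"]) auto
qed

lemma init_taylor:
  fixes u :: "complex \<Rightarrow> real \<Rightarrow> complex^2"
  assumes hol: "\<And>i. (\<lambda>l. u l 0 $ i) holomorphic_on UNIV"
  shows "\<exists>C\<ge>0. \<forall>l. norm (l - m) \<le> 1 \<longrightarrow>
    norm (u l 0 - (\<Sum>k<n. (l - m) ^ k *s (\<chi> i. (deriv ^^ k) (\<lambda>l. u l 0 $ i) m / fact k))) \<le> C * norm (l - m) ^ n"
proof -
  let ?d = "\<lambda>l. u l 0 - (\<Sum>k<n. (l - m) ^ k *s (\<chi> i. (deriv ^^ k) (\<lambda>l. u l 0 $ i) m / fact k))"
  obtain C1 C2 where C: "0 \<le> C1" "0 \<le> C2"
    "\<And>l. norm (l - m) \<le> 1 \<Longrightarrow> norm (?d l $ 1) \<le> C1 * norm (l - m) ^ n"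
    "\<And>l. norm (l - m) \<le> 1 \<Longrightarrow> norm (?d l $ 2) \<le> C2 * norm (l - m) ^ n"
    using entire_taylor[OF hol[of 1], of m n] entire_taylor[OF hol[of 2], of m n] by auto
  have "norm (?d l) \<le> (C1 + C2) * norm (l - m) ^ n" if "norm (l - m) \<le> 1" for l
    using norm_complex2_le[of "?d l"] C(3,4)[OF that] unfolding distrib_right by linarith
  then show ?thesis using C by (intro exI[of _ "C1 + C2"]) auto
qed

text \<open>The second-order Taylor estimate of the solution, passed through the functional, is all
  that differentiability needs; the initial values may move holomorphically with
  \<open>l\<close>.\<close>

lemma functional_holomorphic:
  fixes u :: "complex \<Rightarrow> real \<Rightarrow> complex^2"
  assumes \<Lambda>: "cfunctional \<Lambda>" and u: "\<And>l. dsys P R l g (u l)"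
    and hol: "\<And>i. (\<lambda>l. u l 0 $ i) holomorphic_on UNIV"
  shows "(\<lambda>l. \<Lambda> (u l)) holomorphic_on UNIV"
proof (rule entire_of_quadratic_remainder)
  fix m
  from taylor_functional[OF \<Lambda> u init_taylor[where u = u, OF hol], of m 2]
  show "\<exists>a b C. \<forall>l. norm (l - m) \<le> 1 \<longrightarrow> norm (\<Lambda> (u l) - (a + (l - m) * b)) \<le> C * norm (l - m) ^ 2"
    by (simp add: numeral_2_eq_2) blast
qed

lemma functional_exp_type:
  fixes u :: "complex \<Rightarrow> real \<Rightarrow> complex^2"
  assumes \<Lambda>: "cfunctional \<Lambda>" and u: "\<And>l. dsys P R l g (u l)"
    and et: "\<And>i. exp_type (\<lambda>l. u l 0 $ i)"
  shows "exp_type (\<lambda>l. \<Lambda> (u l))"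
proof -
  have g: "g absolutely_integrable_on {0..1}" using u dsysD(2) by blast
  define G where "G = integral {0..1} (\<lambda>t. norm (g t))"
  have G: "0 \<le> G" unfolding G_def using absint_D(2)[OF g, of 1] by (auto intro: integral_nonneg)
  obtain B where B: "0 \<le> B" "\<And>y M. continuous_on {0..1} y \<Longrightarrow> (\<And>x. x \<in> {0..1} \<Longrightarrow> norm (y x) \<le> M) \<Longrightarrow> norm (\<Lambda> y) \<le> B * M"
    using cfunctional_bound[OF \<Lambda>] by blast
  obtain k1 k2 where k: "\<And>l. norm (u l 0 $ 1) \<le> exp (k1 * (1 + norm l))" "\<And>l. norm (u l 0 $ 2) \<le> exp (k2 * (1 + norm l))"
    using et[of 1] et[of 2] unfolding exp_type_def by blast
  define k where "k = max 0 (max k1 k2)"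
  have "norm (\<Lambda> (u l)) \<le> (B * (2 * (2 * exp k + G)) * exp (4 * K0)) * exp ((k + 4) * norm l)" for l
  proof -
    have kk: "exp (k1 * (1 + norm l)) \<le> exp (k * (1 + norm l))" "exp (k2 * (1 + norm l)) \<le> exp (k * (1 + norm l))"
      by (auto simp: k_def intro!: mult_right_mono)
    have "norm (u l 0) \<le> 2 * exp (k * (1 + norm l))"
      using norm_complex2_le[of "u l 0"] k[of l] kk by linarith
    moreover have "G \<le> G * exp (k * norm l)"
      using G by (simp add: mult_le_cancel_left1 k_def)
    ultimately have "norm (u l 0) + G \<le> (2 * exp k + G) * exp (k * norm l)"
      by (simp add: algebra_simps exp_add)
    then have "2 * (norm (u l 0) + G) * exp (4 * (norm l + K0)) \<le> 2 * ((2 * exp k + G) * exp (k * norm l)) * exp (4 * (norm l + K0))"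
      by (intro mult_right_mono mult_left_mono) auto
    also have "\<dots> = 2 * (2 * exp k + G) * exp (4 * K0) * exp ((k + 4) * norm l)"
      by (simp add: algebra_simps exp_add)
    finally have "norm (\<Lambda> (u l)) \<le> B * (2 * (2 * exp k + G) * exp (4 * K0) * exp ((k + 4) * norm l))"
      using dsys_bound[OF u] by (intro B dsysD(1)[OF u]) (auto simp: G_def intro: order_trans)
    then show ?thesis by (simp add: mult_ac)
  qed
  then show ?thesis by (rule exp_typeI)
qed

end

section \<open>Asymptotics in sectors\<close>

lemma continuous_mult_integrable:
  fixes e g :: "real \<Rightarrow> complex"
  assumes "continuous_on {a..b} e" "g absolutely_integrable_on {a..b}"
  shows "(\<lambda>t. e t * g t) integrable_on {a..b}"
  using absolutely_integrable_continuous_mult[OF assms] by (simp add: absolutely_integrable_on_def)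

lemma cexp_has_vector_derivative:
  fixes k :: complex
  shows "((\<lambda>t. exp (k * of_real t)) has_vector_derivative k * exp (k * of_real x)) (at x within S)"
  by (rule has_vector_derivative_real_field[where f = "\<lambda>z. exp (k * z)"]) (auto intro!: derivative_eq_intros)

lemma variation_of_constants:
  fixes p f :: "real \<Rightarrow> complex"
  assumes f: "f absolutely_integrable_on {0..1}" and cp: "continuous_on {0..1} p"
    and p: "\<And>x. x \<in> {0..1} \<Longrightarrow> p x = p 0 + integral {0..x} (\<lambda>t. k * p t + f t)"
    and x: "x \<in> {0..1}"
  shows "exp (- k * of_real x) * p x = p 0 + integral {0..x} (\<lambda>t. exp (- k * of_real t) * f t)"
proof -
  have "(\<lambda>t. k * p t + f t) absolutely_integrable_on {0..1}"
    by (rule set_integral_add(1)[OF absolutely_integrable_continuous_real f]) (intro continuous_intros cp)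
  then have "exp (- k * of_real x) * p x = exp (- k * of_real 0) * p 0 +
      integral {0..x} (\<lambda>t. exp (- k * of_real t) * (k * p t + f t) + (- k * exp (- k * of_real t)) * p t)"
    by (rule integral_product_rule[OF _ p cexp_has_vector_derivative _ x]) (auto intro!: continuous_intros)
  also have "(\<lambda>t. exp (- k * of_real t) * (k * p t + f t) + (- k * exp (- k * of_real t)) * p t) = (\<lambda>t. exp (- k * of_real t) * f t)"
    by (simp add: fun_eq_iff algebra_simps)
  finally show ?thesis by simp
qed

lemma exp_integral_le:
  fixes \<tau> :: real
  assumes "0 < \<tau>" "a \<le> b"
  shows "integral {a..b} (\<lambda>t. exp (- \<tau> * (b - t))) \<le> 1 / \<tau>" "integral {a..b} (\<lambda>t. exp (- \<tau> * (t - a))) \<le> 1 / \<tau>"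
proof -
  have "((\<lambda>t. exp (- \<tau> * (b - t))) has_integral exp (- \<tau> * (b - b)) / \<tau> - exp (- \<tau> * (b - a)) / \<tau>) {a..b}"
    using assms by (intro fundamental_theorem_of_calculus)
      (auto intro!: derivative_eq_intros simp: has_real_derivative_iff_has_vector_derivative[symmetric])
  from integral_unique[OF this] show "integral {a..b} (\<lambda>t. exp (- \<tau> * (b - t))) \<le> 1 / \<tau>"
    using assms by simp
  have "((\<lambda>t. exp (- \<tau> * (t - a))) has_integral - exp (- \<tau> * (b - a)) / \<tau> - - exp (- \<tau> * (a - a)) / \<tau>) {a..b}"
    using assms by (intro fundamental_theorem_of_calculus)
      (auto intro!: derivative_eq_intros simp: has_real_derivative_iff_has_vector_derivative[symmetric])
  from integral_unique[OF this] show "integral {a..b} (\<lambda>t. exp (- \<tau> * (t - a))) \<le> 1 / \<tau>"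
    using assms by simp
qed

text \<open>The bounded part \<open>A\<close> is paid for by the integral of the weight, the merely
  integrable part \<open>G\<close> by the supremum 1 of the weight. Only the first improves as the
  parameter grows.\<close>

lemma weighted_integral_le:
  fixes f e :: "real \<Rightarrow> complex" and \<tau> :: real
  assumes ab: "0 \<le> a" "a \<le> b" "b \<le> 1" and ef: "(\<lambda>t. e t * f t) integrable_on {a..b}"
    and G: "G integrable_on {0..1}" "\<And>t. t \<in> {0..1} \<Longrightarrow> 0 \<le> G t"
    and w: "w integrable_on {a..b}" "integral {a..b} w \<le> W" "\<And>t. t \<in> {a..b} \<Longrightarrow> 0 \<le> w t \<and> w t \<le> 1"
    and e: "\<And>t. t \<in> {a..b} \<Longrightarrow> norm (e t) \<le> w t"
    and f: "\<And>t. t \<in> {a..b} \<Longrightarrow> norm (f t) \<le> A + G t" and A: "0 \<le> A"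
  shows "norm (integral {a..b} (\<lambda>t. e t * f t)) \<le> A * W + integral {0..1} G"
proof -
  have sub: "{a..b} \<subseteq> {0..1}" using ab by auto
  have Gab: "G integrable_on {a..b}" by (rule integrable_on_subinterval[OF G(1) sub])
  have "norm (integral {a..b} (\<lambda>t. e t * f t)) \<le> integral {a..b} (\<lambda>t. A * w t + G t)"
  proof (rule HK_norm_bound[OF ef])
    show "(\<lambda>t. A * w t + G t) integrable_on {a..b}"
      by (rule integrable_add[OF integrable_on_mult_right[OF w(1)] Gab])
    fix t assume t: "t \<in> {a..b}"
    have "norm (e t * f t) \<le> w t * (A + G t)"
      unfolding norm_mult using e[OF t] f[OF t] w(3)[OF t] by (intro mult_mono) auto
    also have "w t * G t \<le> 1 * G t" using w(3)[OF t] G(2)[of t] t sub by (intro mult_right_mono) auto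
    then have "w t * (A + G t) \<le> A * w t + G t" by (simp add: algebra_simps)
    finally show "norm (e t * f t) \<le> A * w t + G t" .
  qed
  also have "\<dots> = A * integral {a..b} w + integral {a..b} G"
    unfolding integral_add[OF integrable_on_mult_right[OF w(1)] Gab] by simp
  also have "\<dots> \<le> A * W + integral {0..1} G"
    using A w(2) integral_subset_le[OF sub Gab G(1)] G(2) by (intro add_mono mult_left_mono) auto
  finally show ?thesis .
qed

text \<open>With Re k < 0 the kernel decays when the formula is integrated from the left end, which
  yields the factor 1 / |Re k|. For Re k > 0 the right end takes over this role.\<close>

lemma forward_bound:
  fixes p f :: "real \<Rightarrow> complex"
  assumes f: "f absolutely_integrable_on {0..1}" and cp: "continuous_on {0..1} p"
    and p: "\<And>x. x \<in> {0..1} \<Longrightarrow> p x = p 0 + integral {0..x} (\<lambda>t. k * p t + f t)"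
    and k: "Re k < 0" and G: "G integrable_on {0..1}" "\<And>t. t \<in> {0..1} \<Longrightarrow> 0 \<le> G t"
    and fb: "\<And>t. t \<in> {0..1} \<Longrightarrow> norm (f t) \<le> A + G t" and A: "0 \<le> A" and x: "x \<in> {0..1}"
  shows "norm (p x - exp (k * of_real x) * p 0) \<le> A / - Re k + integral {0..1} G"
proof -
  have fx: "f absolutely_integrable_on {0..x}"
    by (rule absolutely_integrable_on_subinterval[OF f]) (use x in auto)
  have "p x = exp (k * of_real x) * (exp (- k * of_real x) * p x)"
    by (simp add: exp_minus)
  also have "\<dots> = exp (k * of_real x) * (p 0 + integral {0..x} (\<lambda>t. exp (- k * of_real t) * f t))"
    by (rule arg_cong[OF variation_of_constants[OF f cp p x]])
  also have "\<dots> = exp (k * of_real x) * p 0 + integral {0..x} (\<lambda>t. exp (k * of_real x) * (exp (- k * of_real t) * f t))"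
    by (simp add: distrib_left)
  also have "(\<lambda>t. exp (k * of_real x) * (exp (- k * of_real t) * f t)) = (\<lambda>t. exp (k * of_real (x - t)) * f t)"
    by (simp add: fun_eq_iff right_diff_distrib exp_diff exp_minus field_simps)
  finally have "p x - exp (k * of_real x) * p 0 = integral {0..x} (\<lambda>t. exp (k * of_real (x - t)) * f t)" by simp
  also have "norm \<dots> \<le> A * (1 / - Re k) + integral {0..1} G"
  proof (rule weighted_integral_le[where w = "\<lambda>t. exp (- (- Re k) * (x - t))"])
    show "(\<lambda>t. exp (k * of_real (x - t)) * f t) integrable_on {0..x}"
      by (rule continuous_mult_integrable[OF _ fx]) (intro continuous_intros)
    show "(\<lambda>t. exp (- (- Re k) * (x - t))) integrable_on {0..x}"
      by (intro integrable_continuous_real continuous_intros)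
    show "integral {0..x} (\<lambda>t. exp (- (- Re k) * (x - t))) \<le> 1 / - Re k"
      by (rule exp_integral_le) (use k x in auto)
    show "0 \<le> exp (- (- Re k) * (x - t)) \<and> exp (- (- Re k) * (x - t)) \<le> 1" if "t \<in> {0..x}" for t
      using k that by (auto simp: mult_nonpos_nonneg)
  qed (use x G fb A in auto)
  finally show ?thesis by simp
qed

lemma backward_bound:
  fixes p f :: "real \<Rightarrow> complex"
  assumes f: "f absolutely_integrable_on {0..1}" and cp: "continuous_on {0..1} p"
    and p: "\<And>x. x \<in> {0..1} \<Longrightarrow> p x = p 0 + integral {0..x} (\<lambda>t. k * p t + f t)"
    and k: "0 < Re k" and G: "G integrable_on {0..1}" "\<And>t. t \<in> {0..1} \<Longrightarrow> 0 \<le> G t"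
    and fb: "\<And>t. t \<in> {0..1} \<Longrightarrow> norm (f t) \<le> A + G t" and A: "0 \<le> A" and x: "x \<in> {0..1}"
  shows "norm (p x - exp (- k * of_real (1 - x)) * p 1) \<le> A / Re k + integral {0..1} G"
proof -
  have fx: "f absolutely_integrable_on {x..1}"
    by (rule absolutely_integrable_on_subinterval[OF f]) (use x in auto)
  have i: "(\<lambda>t. exp (- k * of_real t) * f t) integrable_on {0..1}"
    by (rule continuous_mult_integrable[OF _ f]) (intro continuous_intros)
  have "exp (- k * of_real 1) * p 1 - exp (- k * of_real x) * p x = integral {x..1} (\<lambda>t. exp (- k * of_real t) * f t)"
    using variation_of_constants[OF f cp p x] variation_of_constants[OF f cp p, of 1] integral_diff_Icc[OF i, of x 1] x
    by simp
  then have "exp (k * of_real x) * (exp (- k * of_real 1) * p 1 - exp (- k * of_real x) * p x)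
      = integral {x..1} (\<lambda>t. exp (k * of_real x) * (exp (- k * of_real t) * f t))" by simp
  also have "(\<lambda>t. exp (k * of_real x) * (exp (- k * of_real t) * f t)) = (\<lambda>t. exp (- k * of_real (t - x)) * f t)"
    by (simp add: fun_eq_iff right_diff_distrib exp_diff exp_minus field_simps)
  also have "exp (k * of_real x) * (exp (- k * of_real 1) * p 1 - exp (- k * of_real x) * p x)
      = exp (- k * of_real (1 - x)) * p 1 - p x"
    by (simp add: right_diff_distrib exp_diff exp_minus field_simps)
  finally have "norm (p x - exp (- k * of_real (1 - x)) * p 1) = norm (integral {x..1} (\<lambda>t. exp (- k * of_real (t - x)) * f t))"
    by (metis norm_minus_commute)
  also have "\<dots> \<le> A * (1 / Re k) + integral {0..1} G"
  proof (rule weighted_integral_le[where w = "\<lambda>t. exp (- Re k * (t - x))"])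
    show "(\<lambda>t. exp (- k * of_real (t - x)) * f t) integrable_on {x..1}"
      by (rule continuous_mult_integrable[OF _ fx]) (intro continuous_intros)
    show "(\<lambda>t. exp (- Re k * (t - x))) integrable_on {x..1}"
      by (intro integrable_continuous_real continuous_intros)
    show "integral {x..1} (\<lambda>t. exp (- Re k * (t - x))) \<le> 1 / Re k"
      by (rule exp_integral_le) (use k x in auto)
    show "0 \<le> exp (- Re k * (t - x)) \<and> exp (- Re k * (t - x)) \<le> 1" if "t \<in> {x..1}" for t
      using k that by auto
  qed (use x G fb A in auto)
  finally show ?thesis by simp
qed

context potential
begin

lemma dsys_nth:
  assumes y: "dsys P R l g y" and x: "x \<in> {0..1}"
  shows "y x $ i = y 0 $ i + integral {0..x} (\<lambda>t. dirac P R l t (y t) $ i + g t $ i)"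
proof -
  have "integral {0..x} (\<lambda>t. (dirac P R l t (y t) + g t) $ i) = integral {0..x} (\<lambda>t. dirac P R l t (y t) + g t) $ i"
    using integral_linear[OF absint_D(1)[OF dsys_integrable[OF y] x] bounded_linear_vec_nth[of i]] by (simp add: comp_def)
  then show ?thesis using dsysD(3)[OF y x] by simp
qed

lemma component_bounds:
  assumes y: "dsys P R l g y" and l: "0 < Im l" and x: "x \<in> {0..1}"
  shows "(\<And>t. t \<in> {0..1} \<Longrightarrow> norm (y t $ 1) \<le> N) \<Longrightarrow>
      norm (y x $ 2 - exp (\<i> * l * of_real x) * y 0 $ 2) \<le> K0 * N / Im l + integral {0..1} (\<lambda>t. norm (g t))"
    and "(\<And>t. t \<in> {0..1} \<Longrightarrow> norm (y t $ 2) \<le> N) \<Longrightarrow>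
      norm (y x $ 1 - exp (\<i> * l * of_real (1 - x)) * y 1 $ 1) \<le> K0 * N / Im l + integral {0..1} (\<lambda>t. norm (g t))"
proof -
  note D = dsysD[OF y]
  have G: "(\<lambda>t. norm (g t)) integrable_on {0..1}" using D(2) by (simp add: absolutely_integrable_on_def)
  {
    assume N: "\<And>t. t \<in> {0..1} \<Longrightarrow> norm (y t $ 1) \<le> N"
    have N0: "0 \<le> N" using N[of 0] norm_ge_zero[of "y 0 $ 1"] by (auto simp del: norm_ge_zero)
    have "norm (y x $ 2 - exp (\<i> * l * of_real x) * y 0 $ 2) \<le> (K0 * N) / - Re (\<i> * l) + integral {0..1} (\<lambda>t. norm (g t))"
    proof (rule forward_bound[where f = "\<lambda>t. - \<i> * R t * y t $ 1 + g t $ 2"])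
      show "(\<lambda>t. - \<i> * R t * y t $ 1 + g t $ 2) absolutely_integrable_on {0..1}"
        by (rule set_integral_add(1)[OF absolutely_integrable_continuous_real absint_nth[OF D(2)]])
          (intro continuous_intros contR D(1))
      show "y s $ 2 = y 0 $ 2 + integral {0..s} (\<lambda>t. \<i> * l * y t $ 2 + (- \<i> * R t * y t $ 1 + g t $ 2))" if "s \<in> {0..1}" for s
        using dsys_nth[OF y that, of 2] by (simp add: algebra_simps)
      show "norm (- \<i> * R t * y t $ 1 + g t $ 2) \<le> K0 * N + norm (g t)" if "t \<in> {0..1}" for t
      proof -
        have "norm (- \<i> * R t * y t $ 1) \<le> K0 * N"
          unfolding norm_mult using N[OF that] K0(3)[OF that] K0(1) by (auto intro: mult_mono)
        then show ?thesis
          using norm_triangle_ineq[of "- \<i> * R t * y t $ 1" "g t $ 2"] Finite_Cartesian_Product.norm_nth_le[of "g t" 2] by linarith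
      qed
    qed (use l x G N0 K0(1) D(1) in \<open>auto intro!: continuous_intros\<close>)
    then show "norm (y x $ 2 - exp (\<i> * l * of_real x) * y 0 $ 2) \<le> K0 * N / Im l + integral {0..1} (\<lambda>t. norm (g t))" by simp
  next
    assume N: "\<And>t. t \<in> {0..1} \<Longrightarrow> norm (y t $ 2) \<le> N"
    have N0: "0 \<le> N" using N[of 0] norm_ge_zero[of "y 0 $ 2"] by (auto simp del: norm_ge_zero)
    have "norm (y x $ 1 - exp (- (- \<i> * l) * of_real (1 - x)) * y 1 $ 1) \<le> (K0 * N) / Re (- \<i> * l) + integral {0..1} (\<lambda>t. norm (g t))"
    proof (rule backward_bound[where f = "\<lambda>t. \<i> * P t * y t $ 2 + g t $ 1"])
      show "(\<lambda>t. \<i> * P t * y t $ 2 + g t $ 1) absolutely_integrable_on {0..1}"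
        by (rule set_integral_add(1)[OF absolutely_integrable_continuous_real absint_nth[OF D(2)]])
          (intro continuous_intros contP D(1))
      show "y s $ 1 = y 0 $ 1 + integral {0..s} (\<lambda>t. - \<i> * l * y t $ 1 + (\<i> * P t * y t $ 2 + g t $ 1))" if "s \<in> {0..1}" for s
        using dsys_nth[OF y that, of 1] by (simp add: algebra_simps)
      show "norm (\<i> * P t * y t $ 2 + g t $ 1) \<le> K0 * N + norm (g t)" if "t \<in> {0..1}" for t
      proof -
        have "norm (\<i> * P t * y t $ 2) \<le> K0 * N"
          unfolding norm_mult using N[OF that] K0(2)[OF that] K0(1) by (auto intro: mult_mono)
        then show ?thesis
          using norm_triangle_ineq[of "\<i> * P t * y t $ 2" "g t $ 1"] Finite_Cartesian_Product.norm_nth_le[of "g t" 1] by linarith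
      qed
    qed (use l x G N0 K0(1) D(1) in \<open>auto intro!: continuous_intros\<close>)
    then show "norm (y x $ 1 - exp (\<i> * l * of_real (1 - x)) * y 1 $ 1) \<le> K0 * N / Im l + integral {0..1} (\<lambda>t. norm (g t))" by simp
  }
qed

lemma norm_exp_le_1: "0 \<le> Im l \<Longrightarrow> 0 \<le> x \<Longrightarrow> norm (exp (\<i> * l * of_real x)) \<le> 1"
  by simp

text \<open>For large \<open>Im l\<close> the component \<open>y\<^sub>1\<close> decays backwards from \<open>1\<close> and
  \<open>y\<^sub>2\<close> forwards from \<open>0\<close>, so that solutions are controlled by \<open>y\<^sub>1(1)\<close> and \<open>y\<^sub>2(0)\<close>.\<close>

lemma dichotomy:
  assumes y: "dsys P R l g y" and l: "2 * K0 \<le> Im l" and x: "x \<in> {0..1}"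
  shows "norm (y x $ i) \<le> 2 * (norm (y 1 $ 1) + norm (y 0 $ 2) + 2 * integral {0..1} (\<lambda>t. norm (g t)))"
proof -
  have l0: "0 < Im l" using l K0(1) by linarith
  have "\<exists>N. (\<exists>s\<in>{0..1}. N = norm (y s $ j)) \<and> (\<forall>t\<in>{0..1}. norm (y t $ j) \<le> N)" for j
  proof -
    have "continuous_on {0..1} (\<lambda>t. norm (y t $ j))" by (intro continuous_intros dsysD(1)[OF y])
    from continuous_attains_sup[OF _ _ this] show ?thesis by auto
  qed
  then obtain N where N: "\<And>j. \<exists>s\<in>{0..1}. N j = norm (y s $ j)" "\<And>j t. t \<in> {0..1} \<Longrightarrow> norm (y t $ j) \<le> N j"
    by metis
  have N0: "0 \<le> N j" for j using N(1)[of j] by auto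
  \<comment> \<open>The threshold \<open>2 * K0\<close> makes the coupling of the two components at
    most one half, so the two inequalities for the maxima can be solved for their sum.\<close>
  have half: "K0 * N j / Im l \<le> N j / 2" for j
  proof -
    have "(2 * K0) * N j \<le> Im l * N j" using l N0 by (rule mult_right_mono)
    then show ?thesis using l0 by (simp add: field_simps)
  qed
  define g1 where "g1 = integral {0..1} (\<lambda>t. norm (g t))"
  obtain s where s: "s \<in> {0..1}" "N 2 = norm (y s $ 2)" using N(1) by blast
  have "norm (y s $ 2) \<le> norm (y s $ 2 - exp (\<i> * l * of_real s) * y 0 $ 2) + norm (exp (\<i> * l * of_real s) * y 0 $ 2)"
    by (metis norm_triangle_sub add.commute)
  also have "norm (exp (\<i> * l * of_real s) * y 0 $ 2) \<le> 1 * norm (y 0 $ 2)"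
    unfolding norm_mult using l0 s by (intro mult_right_mono norm_exp_le_1) auto
  finally have e2: "N 2 \<le> N 1 / 2 + g1 + norm (y 0 $ 2)"
    using component_bounds(1)[OF y l0 s(1) N(2)] half[of 1] s(2) unfolding g1_def by linarith
  obtain r where r: "r \<in> {0..1}" "N 1 = norm (y r $ 1)" using N(1) by blast
  have "norm (y r $ 1) \<le> norm (y r $ 1 - exp (\<i> * l * of_real (1 - r)) * y 1 $ 1) + norm (exp (\<i> * l * of_real (1 - r)) * y 1 $ 1)"
    by (metis norm_triangle_sub add.commute)
  also have "norm (exp (\<i> * l * of_real (1 - r)) * y 1 $ 1) \<le> 1 * norm (y 1 $ 1)"
    unfolding norm_mult using l0 r by (intro mult_right_mono norm_exp_le_1) auto
  finally have e1: "N 1 \<le> N 2 / 2 + g1 + norm (y 1 $ 1)"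
    using component_bounds(2)[OF y l0 r(1) N(2)] half[of 2] r(2) unfolding g1_def by linarith
  have "N 1 + N 2 \<le> 2 * (norm (y 1 $ 1) + norm (y 0 $ 2) + 2 * g1)" using e1 e2 by simp
  moreover have "norm (y x $ i) \<le> N 1 + N 2"
    using N(2)[OF x, of i] N0[of 1] N0[of 2] exhaust_2[of i] by auto
  ultimately show ?thesis unfolding g1_def by linarith
qed

end

text \<open>Here Im l and |l| are comparable, and asymptotic statements become ordinary limits along
  a filter.\<close>

definition upper_sector :: "complex filter" where
  "upper_sector = inf at_infinity (principal {l. norm l \<le> 3 * Im l})"

lemma eventually_upper_sector:
  "eventually P upper_sector \<longleftrightarrow> (\<exists>r. \<forall>l. r \<le> norm l \<longrightarrow> norm l \<le> 3 * Im l \<longrightarrow> P l)"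
  by (simp add: upper_sector_def eventually_inf_principal eventually_at_infinity)

lemma eventually_in_upper_sector: "\<forall>\<^sub>F l in upper_sector. norm l \<le> 3 * Im l \<and> l \<noteq> 0"
  unfolding eventually_upper_sector by (rule exI[of _ 1]) auto

lemma Im_upper_sector: "filterlim Im at_top upper_sector"
proof (rule filterlim_at_top_mono)
  have "filterlim (\<lambda>l::complex. norm l) at_top at_infinity"
    by (rule filterlim_at_infinity_imp_norm_at_top[OF filterlim_ident])
  then have "filterlim (\<lambda>l::complex. norm l) at_top upper_sector"
    by (rule filterlim_mono) (auto simp: upper_sector_def)
  then show "filterlim (\<lambda>l::complex. 1/3 * norm l) at_top upper_sector"
    by (intro filterlim_tendsto_pos_mult_at_top[OF tendsto_const]) auto
  show "\<forall>\<^sub>F l in upper_sector. 1/3 * norm l \<le> Im l"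
    using eventually_in_upper_sector by eventually_elim auto
qed

lemma tendsto_exp_Im:
  assumes "0 < d" shows "((\<lambda>l. exp (- (d * Im l))) \<longlongrightarrow> 0) upper_sector"
proof -
  have "filterlim (\<lambda>l. d * Im l) at_top upper_sector"
    by (rule filterlim_tendsto_pos_mult_at_top[OF tendsto_const assms Im_upper_sector])
  then have "filterlim (\<lambda>l. - (d * Im l)) at_bot upper_sector"
    by (simp add: filterlim_uminus_at_bot)
  then show ?thesis by (rule filterlim_compose[OF exp_at_bot])
qed

text \<open>Errors of order (Im l)^(-2) are invisible at the scale 1/l of the leading terms.\<close>

lemma tendsto_mult_upper_sector:
  assumes "\<forall>\<^sub>F l in upper_sector. norm (f l) \<le> C / (Im l)\<^sup>2"
  shows "((\<lambda>l. l * f l) \<longlongrightarrow> 0) upper_sector"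
proof (rule Lim_null_comparison)
  show "((\<lambda>l. 3 * C / Im l) \<longlongrightarrow> 0) upper_sector"
    by (rule tendsto_divide_0[OF tendsto_const]) (rule filterlim_at_top_imp_at_infinity[OF Im_upper_sector])
  show "\<forall>\<^sub>F l in upper_sector. norm (l * f l) \<le> 3 * C / Im l"
    using assms eventually_in_upper_sector filterlim_at_top_dense[THEN iffD1, OF Im_upper_sector, rule_format, of 0]
  proof eventually_elim
    case (elim l)
    have "norm (l * f l) \<le> (3 * Im l) * (C / (Im l)\<^sup>2)"
      unfolding norm_mult using elim by (intro mult_mono) auto
    then show ?case using elim by (simp add: power2_eq_square)
  qed
qed

text \<open>The kernel has total mass i/(2 l) up to an exponentially small term and concentrates at
  0. Continuity of \<open>f\<close> is enough for the leading coefficient.\<close>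

lemma laplace_asymptotics:
  fixes f :: "real \<Rightarrow> complex"
  assumes f: "continuous_on {0..1} f"
  shows "((\<lambda>l. l * integral {0..1} (\<lambda>t. exp (2 * \<i> * l * of_real t) * f t)) \<longlongrightarrow> \<i> / 2 * f 0) upper_sector"
proof (rule tendstoI)
  fix \<epsilon> :: real assume \<epsilon>: "0 < \<epsilon>"
  have "bounded ((\<lambda>t. f t - f 0) ` {0..1})"
    by (intro compact_imp_bounded compact_continuous_image continuous_intros f) auto
  then obtain M where M: "\<And>t. t \<in> {0..1} \<Longrightarrow> norm (f t - f 0) \<le> M" unfolding bounded_iff by blast
  have M0: "0 \<le> M" using M[of 0] by simp
  obtain \<delta> where \<delta>: "0 < \<delta>" "\<And>t. t \<in> {0..1} \<Longrightarrow> t < \<delta> \<Longrightarrow> norm (f t - f 0) < \<epsilon> / 6"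
    using f[unfolded continuous_on_iff, rule_format, of 0 "\<epsilon> / 6"] \<epsilon> by (auto simp: dist_norm)
  have "((\<lambda>l. norm (f 0) / 2 * exp (- (2 * Im l)) + 3 * M * exp (- (\<delta> * Im l))) \<longlongrightarrow> norm (f 0) / 2 * 0 + 3 * M * 0) upper_sector"
    by (intro tendsto_intros tendsto_exp_Im \<delta>) simp
  then have "\<forall>\<^sub>F l in upper_sector. norm (f 0) / 2 * exp (- (2 * Im l)) + 3 * M * exp (- (\<delta> * Im l)) < \<epsilon> / 2"
    by (rule order_tendstoD) (use \<epsilon> in simp)
  then show "\<forall>\<^sub>F l in upper_sector. dist (l * integral {0..1} (\<lambda>t. exp (2 * \<i> * l * of_real t) * f t)) (\<i> / 2 * f 0) < \<epsilon>"
    using eventually_in_upper_sector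
  proof eventually_elim
    case (elim l)
    define \<tau> where "\<tau> = Im l"
    have \<tau>: "0 < \<tau>" using elim by (cases "Im l \<le> 0") (auto simp: \<tau>_def, smt (verit) norm_ge_zero zero_less_norm_iff)
    let ?e = "\<lambda>t. exp (2 * \<i> * l * of_real t)"
    have i1: "(\<lambda>t. ?e t * f 0) integrable_on {0..1}" and i2: "(\<lambda>t. ?e t * (f t - f 0)) integrable_on {0..1}"
      by (intro integrable_continuous_real continuous_intros f)+
    have "((\<lambda>t. ?e t * f 0) has_integral ?e 1 * f 0 / (2 * \<i> * l) - ?e 0 * f 0 / (2 * \<i> * l)) {0..1}"
      using elim by (intro fundamental_theorem_of_calculus)
        (auto intro!: derivative_eq_intros has_vector_derivative_real_field)
    then have I0: "integral {0..1} (\<lambda>t. ?e t * f 0) = ?e 1 * f 0 / (2 * \<i> * l) - ?e 0 * f 0 / (2 * \<i> * l)"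
      by (rule integral_unique)
    have l0: "l \<noteq> 0" using elim by simp
    have I1: "l * integral {0..1} (\<lambda>t. ?e t * f 0) = \<i> / 2 * f 0 - \<i> / 2 * (?e 1 * f 0)"
      unfolding I0 using l0 by (simp add: field_simps)
    \<comment> \<open>The modulus exp (-2 \<tau> t) of the kernel is split in halves: one stays as
      an integrable weight, the other is at most exp (-\<delta> \<tau>) beyond \<delta>. Since |l|
      is at most 3 \<tau>, the margin \<epsilon>/6 becomes \<epsilon>/2.\<close>
    have "norm (integral {0..1} (\<lambda>t. ?e t * (f t - f 0))) \<le> integral {0..1} (\<lambda>t. (\<epsilon> / 6 + M * exp (- (\<delta> * \<tau>))) * exp (- \<tau> * (t - 0)))"
    proof (rule HK_norm_bound[OF i2])
      show "(\<lambda>t. (\<epsilon> / 6 + M * exp (- (\<delta> * \<tau>))) * exp (- \<tau> * (t - 0))) integrable_on {0..1}"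
        by (intro integrable_continuous_real continuous_intros)
      fix t :: real assume t: "t \<in> {0..1}"
      have ne: "norm (?e t * (f t - f 0)) = exp (- (2 * \<tau> * t)) * norm (f t - f 0)"
        by (simp add: norm_mult \<tau>_def)
      show "norm (?e t * (f t - f 0)) \<le> (\<epsilon> / 6 + M * exp (- (\<delta> * \<tau>))) * exp (- \<tau> * (t - 0))"
      proof (cases "t < \<delta>")
        case True
        have "exp (- (2 * \<tau> * t)) * norm (f t - f 0) \<le> exp (- (\<tau> * t)) * (\<epsilon> / 6 + M * exp (- (\<delta> * \<tau>)))"
        proof (rule mult_mono)
          have "0 \<le> M * exp (- (\<delta> * \<tau>))" using M0 by simp
          then show "norm (f t - f 0) \<le> \<epsilon> / 6 + M * exp (- (\<delta> * \<tau>))" using \<delta>(2)[OF t True] by linarith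
        qed (use \<tau> t in auto)
        then show ?thesis unfolding ne by (simp add: mult.commute)
      next
        case False
        have "exp (- (2 * \<tau> * t)) * norm (f t - f 0) \<le> (exp (- (\<tau> * t)) * exp (- (\<delta> * \<tau>))) * M"
        proof (rule mult_mono[OF _ M[OF t]])
          have "\<delta> * \<tau> \<le> \<tau> * t" using False \<tau> by simp
          then show "exp (- (2 * \<tau> * t)) \<le> exp (- (\<tau> * t)) * exp (- (\<delta> * \<tau>))"
            by (simp add: exp_add[symmetric])
        qed auto
        moreover have "0 \<le> \<epsilon> / 6 * exp (- \<tau> * t)" using \<epsilon> by simp
        ultimately show ?thesis unfolding ne by (simp add: algebra_simps)
      qed
    qed
    also have "\<dots> = (\<epsilon> / 6 + M * exp (- (\<delta> * \<tau>))) * integral {0..1} (\<lambda>t. exp (- \<tau> * (t - 0)))" by simp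
    also have "\<dots> \<le> (\<epsilon> / 6 + M * exp (- (\<delta> * \<tau>))) * (1 / \<tau>)"
      using exp_integral_le(2)[OF \<tau>, of 0 1] \<epsilon> M0 by (intro mult_left_mono) auto
    finally have "norm l * norm (integral {0..1} (\<lambda>t. ?e t * (f t - f 0))) \<le> (3 * \<tau>) * ((\<epsilon> / 6 + M * exp (- (\<delta> * \<tau>))) * (1 / \<tau>))"
      using elim \<tau> by (intro mult_mono) (auto simp: \<tau>_def)
    also have "\<dots> = \<epsilon> / 2 + 3 * M * exp (- (\<delta> * \<tau>))" using \<tau> by (simp add: field_simps)
    finally have I2: "norm (l * integral {0..1} (\<lambda>t. ?e t * (f t - f 0))) \<le> \<epsilon> / 2 + 3 * M * exp (- (\<delta> * \<tau>))"
      by (simp add: norm_mult)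
    have "integral {0..1} (\<lambda>t. ?e t * f t) = integral {0..1} (\<lambda>t. ?e t * f 0 + ?e t * (f t - f 0))"
      by (simp add: algebra_simps)
    also have "\<dots> = integral {0..1} (\<lambda>t. ?e t * f 0) + integral {0..1} (\<lambda>t. ?e t * (f t - f 0))"
      by (rule integral_add[OF i1 i2])
    finally have "l * integral {0..1} (\<lambda>t. ?e t * f t) - \<i> / 2 * f 0
        = l * integral {0..1} (\<lambda>t. ?e t * (f t - f 0)) - \<i> / 2 * (?e 1 * f 0)"
      using I1 by (simp add: distrib_left)
    also have "norm \<dots> \<le> norm (l * integral {0..1} (\<lambda>t. ?e t * (f t - f 0))) + norm (\<i> / 2 * (?e 1 * f 0))"
      by (rule norm_triangle_ineq4)
    also have "norm (\<i> / 2 * (?e 1 * f 0)) = norm (f 0) / 2 * exp (- (2 * Im l))"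
      by (simp add: norm_mult norm_divide)
    finally show ?case
      using I2 elim(1) by (simp add: dist_norm \<tau>_def)
  qed
qed

lemma integral_reflect_01:
  fixes f :: "real \<Rightarrow> 'a::banach"
  assumes "continuous_on {0..1} f"
  shows "integral {0..1} (\<lambda>t. f (1 - t)) = integral {0..1} f"
proof -
  have "((\<lambda>t. f (1 - t)) has_integral (- integral {0..1 - 1} f) - (- integral {0..1 - 0} f)) {0..1}"
  proof (rule fundamental_theorem_of_calculus)
    fix t :: real assume t: "t \<in> {0..1}"
    have im: "(\<lambda>t. 1 - t) ` {0..1} = {0..1::real}"
      by (auto simp: image_iff intro: bexI[of _ "1 - x" for x])
    have "((\<lambda>u. integral {0..u} f) has_vector_derivative f (1 - t)) (at (1 - t) within (\<lambda>t. 1 - t) ` {0..1})"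
      unfolding im by (rule integral_has_vector_derivative[OF assms]) (use t in auto)
    moreover have "((\<lambda>t. 1 - t) has_vector_derivative - 1) (at t within {0..1})"
      by (auto intro!: derivative_eq_intros)
    ultimately have "((\<lambda>u. integral {0..u} f) \<circ> (\<lambda>t. 1 - t) has_vector_derivative (- 1) *\<^sub>R f (1 - t)) (at t within {0..1})"
      by (rule vector_diff_chain_within[rotated])
    then show "((\<lambda>t. - integral {0..1 - t} f) has_vector_derivative f (1 - t)) (at t within {0..1})"
      using has_vector_derivative_minus by (fastforce simp: comp_def)
  qed simp
  from integral_unique[OF this] show ?thesis by simp
qed

section \<open>Solutions normalized by one value at each end\<close>

context potential
begin

text \<open>Data at both ends select the decaying solutions: \<open>a\<close> has its weight at 0,
  \<open>b\<close> at 1. They exist because, by the dichotomy, a nonzero solution cannot have both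
  data zero.\<close>

lemma boundary_solutions:
  assumes l: "2 * K0 \<le> Im l"
  obtains a b where "dsys P R l (\<lambda>_. 0) a" "dsys P R l (\<lambda>_. 0) b"
    "a 1 $ 1 = 0" "a 0 $ 2 = 1" "b 1 $ 1 = 1" "b 0 $ 2 = 0"
proof -
  have z: "(\<lambda>_. 0 :: complex^2) absolutely_integrable_on {0..1}" by simp
  define u v where "u = sol l (\<lambda>_. 0) (vector [1, 0])" and "v = sol l (\<lambda>_. 0) (vector [0, 1])"
  have u: "dsys P R l (\<lambda>_. 0) u" "u 0 = vector [1, 0]" and v: "dsys P R l (\<lambda>_. 0) v" "v 0 = vector [0, 1]"
    using sol[OF z] by (auto simp: u_def v_def)
  have ne: "u 1 $ 1 \<noteq> 0"
  proof
    assume "u 1 $ 1 = 0"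
    with dichotomy[OF u(1) l, of 0 1] u(2) show False by simp
  qed
  show ?thesis
  proof (rule that)
    show "dsys P R l (\<lambda>_. 0) (\<lambda>t. v t + (- v 1 $ 1 / u 1 $ 1) *s u t)"
      using dsys_lincomb[OF v(1) u(1), of "- v 1 $ 1 / u 1 $ 1"] by simp
    show "dsys P R l (\<lambda>_. 0) (\<lambda>t. u t + (1 / u 1 $ 1 - 1) *s u t)"
      using dsys_lincomb[OF u(1) u(1), of "1 / u 1 $ 1 - 1"] by simp
  qed (use ne u(2) v(2) in \<open>auto simp: field_simps\<close>)
qed

text \<open>The dichotomy is bootstrapped: boundedness makes one component of order 1/Im l, and
  feeding this back determines the other one up to order 1/(Im l)^2.\<close>

lemma boundary_solution_bounds:
  assumes l: "2 * K0 \<le> Im l" and y: "dsys P R l (\<lambda>_. 0) y"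
    and y01: "norm (y 1 $ 1) + norm (y 0 $ 2) \<le> 1" and x: "x \<in> {0..1}"
  shows "norm (y x $ i) \<le> 2"
    and "y 1 $ 1 = 0 \<Longrightarrow> norm (y x $ 2 - exp (\<i> * l * of_real x) * y 0 $ 2) \<le> 2 * K0\<^sup>2 / (Im l)\<^sup>2"
    and "y 0 $ 2 = 0 \<Longrightarrow> norm (y x $ 1 - exp (\<i> * l * of_real (1 - x)) * y 1 $ 1) \<le> 2 * K0\<^sup>2 / (Im l)\<^sup>2"
proof -
  have l0: "0 < Im l" using l K0(1) by linarith
  have b: "norm (y t $ j) \<le> 2" if "t \<in> {0..1}" for t j
    using dichotomy[OF y l that, of j] y01 by simp
  then show "norm (y x $ i) \<le> 2" using x by blast
  {
    assume 0: "y 1 $ 1 = 0"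
    have "norm (y t $ 1) \<le> K0 * 2 / Im l" if "t \<in> {0..1}" for t
      using component_bounds(2)[OF y l0 that b] 0 by simp
    from component_bounds(1)[OF y l0 x this]
    show "norm (y x $ 2 - exp (\<i> * l * of_real x) * y 0 $ 2) \<le> 2 * K0\<^sup>2 / (Im l)\<^sup>2"
      by (simp add: power2_eq_square mult_ac)
  next
    assume 0: "y 0 $ 2 = 0"
    have "norm (y t $ 2) \<le> K0 * 2 / Im l" if "t \<in> {0..1}" for t
      using component_bounds(1)[OF y l0 that b] 0 by simp
    from component_bounds(2)[OF y l0 x this]
    show "norm (y x $ 1 - exp (\<i> * l * of_real (1 - x)) * y 1 $ 1) \<le> 2 * K0\<^sup>2 / (Im l)\<^sup>2"
      by (simp add: power2_eq_square mult_ac)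
  }
qed

lemma kernel_error:
  fixes q V e :: "real \<Rightarrow> complex"
  assumes l: "0 < Im l" and x: "continuous_on {0..1} q" and V: "continuous_on {0..1} V"
    and VK: "\<And>t. t \<in> {0..1} \<Longrightarrow> norm (V t) \<le> K0"
    and e: "continuous_on {0..1} e" "\<And>t. t \<in> {0..1} \<Longrightarrow> norm (e t :: complex) \<le> 1"
    and q: "\<And>t. t \<in> {0..1} \<Longrightarrow> norm (q t - e t) \<le> \<eta>"
  shows "norm (integral {0..1} (\<lambda>t. e t * (V t * q t)) - integral {0..1} (\<lambda>t. e t * e t * V t)) \<le> K0 * \<eta>"
proof -
  have i: "(\<lambda>t. e t * (V t * q t)) integrable_on {0..1}" "(\<lambda>t. e t * e t * V t) integrable_on {0..1}"
    by (auto intro!: integrable_continuous_real continuous_intros x V e(1))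
  have "norm (integral {0..1} (\<lambda>t. e t * (V t * q t) - e t * e t * V t)) \<le> integral {0..1} (\<lambda>t::real. K0 * \<eta>)"
  proof (rule HK_norm_bound[OF integrable_diff[OF i] integrable_const_ivl])
    fix t :: real assume t: "t \<in> {0..1}"
    have "norm (e t * (V t * q t) - e t * e t * V t) = norm (e t) * (norm (V t) * norm (q t - e t))"
      by (simp add: norm_mult[symmetric] algebra_simps)
    also have "\<dots> \<le> 1 * (K0 * \<eta>)"
      using e(2)[OF t] VK[OF t] q[OF t] K0(1) by (intro mult_mono) auto
    finally show "norm (e t * (V t * q t) - e t * e t * V t) \<le> K0 * \<eta>" by simp
  qed
  then show ?thesis using integral_diff[OF i] by simp
qed

text \<open>Replacing the dominant component by the pure exponential in the variation-of-constants
  formula leaves a Laplace integral of the potential, concentrated at 0 for \<open>a\<close> and at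
  1 for \<open>b\<close>. This is how \<open>P 0\<close> and \<open>R 1\<close> enter; the values at
  the far ends are negligible.\<close>

lemma boundary_asymptotics:
  assumes a: "\<And>l. 2 * K0 \<le> Im l \<Longrightarrow> dsys P R l (\<lambda>_. 0) (a l) \<and> a l 1 $ 1 = 0 \<and> a l 0 $ 2 = 1"
    and b: "\<And>l. 2 * K0 \<le> Im l \<Longrightarrow> dsys P R l (\<lambda>_. 0) (b l) \<and> b l 1 $ 1 = 1 \<and> b l 0 $ 2 = 0"
  shows "((\<lambda>l. l * a l 0 $ 1) \<longlongrightarrow> P 0 / 2) upper_sector" "((\<lambda>l. l * a l 1 $ 2) \<longlongrightarrow> 0) upper_sector"
    "((\<lambda>l. l * b l 0 $ 1) \<longlongrightarrow> 0) upper_sector" "((\<lambda>l. l * b l 1 $ 2) \<longlongrightarrow> R 1 / 2) upper_sector"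
proof -
  have ev: "\<forall>\<^sub>F l in upper_sector. 2 * K0 \<le> Im l"
    using Im_upper_sector by (simp add: filterlim_at_top)
  have expsmall: "((\<lambda>l. l * exp (\<i> * l)) \<longlongrightarrow> 0) upper_sector"
  proof (rule tendsto_mult_upper_sector)
    show "\<forall>\<^sub>F l in upper_sector. norm (exp (\<i> * l)) \<le> 2 / (Im l)\<^sup>2"
      using ev
    proof eventually_elim
      case (elim l)
      have l0: "0 < Im l" using elim K0(1) by linarith
      have "(Im l)\<^sup>2 / 2 \<le> exp (Im l)" using exp_lower_Taylor_quadratic[of "Im l"] l0 by simp
      then have "exp (- Im l) * ((Im l)\<^sup>2 / 2) \<le> exp (- Im l) * exp (Im l)" by (intro mult_left_mono) auto
      then show ?case using l0 by (simp add: exp_minus field_simps)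
    qed
  qed
  have ends: "((\<lambda>l. l * (y l - exp (\<i> * l))) \<longlongrightarrow> 0) upper_sector \<Longrightarrow> ((\<lambda>l. l * y l) \<longlongrightarrow> 0) upper_sector" for y :: "complex \<Rightarrow> complex"
    using tendsto_add[OF _ expsmall, of "\<lambda>l. l * (y l - exp (\<i> * l))" 0] by (simp add: algebra_simps)
  show "((\<lambda>l. l * a l 1 $ 2) \<longlongrightarrow> 0) upper_sector"
  proof (rule ends, rule tendsto_mult_upper_sector)
    show "\<forall>\<^sub>F l in upper_sector. norm (a l 1 $ 2 - exp (\<i> * l)) \<le> 2 * K0\<^sup>2 / (Im l)\<^sup>2"
      using ev
    proof eventually_elim
      case (elim l)
      show ?case using boundary_solution_bounds(2)[OF elim, of "a l" 1] a[OF elim] by simp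
    qed
  qed
  show "((\<lambda>l. l * b l 0 $ 1) \<longlongrightarrow> 0) upper_sector"
  proof (rule ends, rule tendsto_mult_upper_sector)
    show "\<forall>\<^sub>F l in upper_sector. norm (b l 0 $ 1 - exp (\<i> * l)) \<le> 2 * K0\<^sup>2 / (Im l)\<^sup>2"
      using ev
    proof eventually_elim
      case (elim l)
      show ?case using boundary_solution_bounds(3)[OF elim, of "b l" 0] b[OF elim] by simp
    qed
  qed
  have z: "(\<lambda>_. 0 :: complex^2) absolutely_integrable_on {0..1}" by simp
  have exn: "norm (exp (\<i> * l * of_real t)) \<le> 1" if "0 < Im l" "0 \<le> t" for l t
    using that by simp
  show "((\<lambda>l. l * a l 0 $ 1) \<longlongrightarrow> P 0 / 2) upper_sector"
  proof -
    have "((\<lambda>l. l * (a l 0 $ 1 - - \<i> * integral {0..1} (\<lambda>t. exp (2 * \<i> * l * of_real t) * P t))) \<longlongrightarrow> 0) upper_sector"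
    proof (rule tendsto_mult_upper_sector)
      show "\<forall>\<^sub>F l in upper_sector. norm (a l 0 $ 1 - - \<i> * integral {0..1} (\<lambda>t. exp (2 * \<i> * l * of_real t) * P t)) \<le> (K0 * (2 * K0\<^sup>2)) / (Im l)\<^sup>2"
        using ev
      proof eventually_elim
        case (elim l)
        have l0: "0 < Im l" using elim K0(1) by linarith
        note A = a[OF elim, THEN conjunct1]
        note cA = dsysD(1)[OF A]
        have "exp (- (- \<i> * l) * of_real 1) * a l 1 $ 1 = a l 0 $ 1 + integral {0..1} (\<lambda>t. exp (- (- \<i> * l) * of_real t) * (\<i> * P t * a l t $ 2))"
        proof (rule variation_of_constants[where p = "\<lambda>t. a l t $ 1"])
          show "a l x $ 1 = a l 0 $ 1 + integral {0..x} (\<lambda>t. - \<i> * l * a l t $ 1 + \<i> * P t * a l t $ 2)" if "x \<in> {0..1}" for x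
            using dsys_nth[OF A that, of 1] by simp
        qed (auto intro!: absolutely_integrable_continuous_real continuous_intros contP cA)
        then have "a l 0 $ 1 = - integral {0..1} (\<lambda>t. exp (\<i> * l * of_real t) * (\<i> * P t * a l t $ 2))"
          using a[OF elim] by (simp add: eq_neg_iff_add_eq_0)
        also have "(\<lambda>t. exp (\<i> * l * of_real t) * (\<i> * P t * a l t $ 2)) = (\<lambda>t. \<i> * (exp (\<i> * l * of_real t) * (P t * a l t $ 2)))"
          by (simp add: fun_eq_iff)
        finally have a0: "a l 0 $ 1 = - \<i> * integral {0..1} (\<lambda>t. exp (\<i> * l * of_real t) * (P t * a l t $ 2))" by simp
        have "norm (integral {0..1} (\<lambda>t. exp (\<i> * l * of_real t) * (P t * a l t $ 2))
            - integral {0..1} (\<lambda>t. exp (\<i> * l * of_real t) * exp (\<i> * l * of_real t) * P t)) \<le> K0 * (2 * K0\<^sup>2 / (Im l)\<^sup>2)"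
        proof (rule kernel_error[OF l0 _ contP K0(2)])
          show "norm (a l t $ 2 - exp (\<i> * l * of_real t)) \<le> 2 * K0\<^sup>2 / (Im l)\<^sup>2" if "t \<in> {0..1}" for t
            using boundary_solution_bounds(2)[OF elim A _ that] a[OF elim] by simp
        qed (use cA l0 in \<open>auto intro!: continuous_intros\<close>)
        moreover have "(\<lambda>t. exp (\<i> * l * of_real t) * exp (\<i> * l * of_real t) * P t) = (\<lambda>t. exp (2 * \<i> * l * of_real t) * P t)"
          by (simp add: fun_eq_iff exp_add[symmetric] algebra_simps)
        ultimately have "norm (\<i> * (integral {0..1} (\<lambda>t. exp (\<i> * l * of_real t) * (P t * a l t $ 2))
            - integral {0..1} (\<lambda>t. exp (2 * \<i> * l * of_real t) * P t))) \<le> K0 * (2 * K0\<^sup>2 / (Im l)\<^sup>2)"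
          by (simp add: norm_mult)
        then have "norm (- (\<i> * (integral {0..1} (\<lambda>t. exp (\<i> * l * of_real t) * (P t * a l t $ 2))
            - integral {0..1} (\<lambda>t. exp (2 * \<i> * l * of_real t) * P t)))) \<le> K0 * (2 * K0\<^sup>2 / (Im l)\<^sup>2)"
          by (simp only: norm_minus_cancel)
        then show ?case unfolding a0 by (simp add: algebra_simps)
      qed
    qed
    from tendsto_add[OF this tendsto_mult[OF tendsto_const[of "- \<i>"] laplace_asymptotics[OF contP]]]
    show ?thesis by (simp add: algebra_simps)
  qed
  show "((\<lambda>l. l * b l 1 $ 2) \<longlongrightarrow> R 1 / 2) upper_sector"
  proof -
    have refl_cont: "continuous_on {0..1} (\<lambda>t. R (1 - t))"
      by (rule continuous_on_compose2[OF contR]) (auto intro!: continuous_intros)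
    have "((\<lambda>l. l * (b l 1 $ 2 - - \<i> * integral {0..1} (\<lambda>t. exp (2 * \<i> * l * of_real t) * R (1 - t)))) \<longlongrightarrow> 0) upper_sector"
    proof (rule tendsto_mult_upper_sector)
      show "\<forall>\<^sub>F l in upper_sector. norm (b l 1 $ 2 - - \<i> * integral {0..1} (\<lambda>t. exp (2 * \<i> * l * of_real t) * R (1 - t))) \<le> (K0 * (2 * K0\<^sup>2)) / (Im l)\<^sup>2"
        using ev
      proof eventually_elim
        case (elim l)
        have l0: "0 < Im l" using elim K0(1) by linarith
        note A = b[OF elim, THEN conjunct1]
        note cA = dsysD(1)[OF A]
        have "exp (- (\<i> * l) * of_real 1) * b l 1 $ 2 = b l 0 $ 2 + integral {0..1} (\<lambda>t. exp (- (\<i> * l) * of_real t) * (- \<i> * R t * b l t $ 1))"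
        proof (rule variation_of_constants[where p = "\<lambda>t. b l t $ 2"])
          show "b l x $ 2 = b l 0 $ 2 + integral {0..x} (\<lambda>t. \<i> * l * b l t $ 2 + - \<i> * R t * b l t $ 1)" if "x \<in> {0..1}" for x
            using dsys_nth[OF A that, of 2] by simp
        qed (auto intro!: absolutely_integrable_continuous_real continuous_intros contR cA)
        then have "exp (\<i> * l) * (exp (- (\<i> * l)) * b l 1 $ 2) = integral {0..1} (\<lambda>t. exp (\<i> * l) * (exp (- (\<i> * l) * of_real t) * (- \<i> * R t * b l t $ 1)))"
          using b[OF elim] by simp
        also have "exp (\<i> * l) * (exp (- (\<i> * l)) * b l 1 $ 2) = b l 1 $ 2" by (simp add: exp_minus)
        also have "(\<lambda>t. exp (\<i> * l) * (exp (- (\<i> * l) * of_real t) * (- \<i> * R t * b l t $ 1))) = (\<lambda>t. - \<i> * (exp (\<i> * l * of_real (1 - t)) * (R t * b l t $ 1)))"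
          by (simp add: fun_eq_iff right_diff_distrib exp_diff exp_minus field_simps)
        finally have b0: "b l 1 $ 2 = - \<i> * integral {0..1} (\<lambda>t. exp (\<i> * l * of_real (1 - t)) * (R t * b l t $ 1))" by simp
        have "norm (integral {0..1} (\<lambda>t. exp (\<i> * l * of_real (1 - t)) * (R t * b l t $ 1))
            - integral {0..1} (\<lambda>t. exp (\<i> * l * of_real (1 - t)) * exp (\<i> * l * of_real (1 - t)) * R t)) \<le> K0 * (2 * K0\<^sup>2 / (Im l)\<^sup>2)"
        proof (rule kernel_error[OF l0 _ contR K0(3)])
          show "norm (b l t $ 1 - exp (\<i> * l * of_real (1 - t))) \<le> 2 * K0\<^sup>2 / (Im l)\<^sup>2" if "t \<in> {0..1}" for t
            using boundary_solution_bounds(3)[OF elim A _ that] b[OF elim] by simp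
        qed (use cA l0 in \<open>auto intro!: continuous_intros\<close>)
        moreover have "integral {0..1} (\<lambda>t. exp (\<i> * l * of_real (1 - t)) * exp (\<i> * l * of_real (1 - t)) * R t)
            = integral {0..1} (\<lambda>t. exp (2 * \<i> * l * of_real t) * R (1 - t))"
        proof -
          have "continuous_on {0..1} (\<lambda>t. exp (2 * \<i> * l * of_real t) * R (1 - t))"
            by (intro continuous_intros refl_cont)
          from integral_reflect_01[OF this]
          show ?thesis by (simp add: exp_add[symmetric] algebra_simps)
        qed
        ultimately have "norm (\<i> * (integral {0..1} (\<lambda>t. exp (\<i> * l * of_real (1 - t)) * (R t * b l t $ 1))
            - integral {0..1} (\<lambda>t. exp (2 * \<i> * l * of_real t) * R (1 - t)))) \<le> K0 * (2 * K0\<^sup>2 / (Im l)\<^sup>2)"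
          by (simp add: norm_mult)
        then have "norm (- (\<i> * (integral {0..1} (\<lambda>t. exp (\<i> * l * of_real (1 - t)) * (R t * b l t $ 1))
            - integral {0..1} (\<lambda>t. exp (2 * \<i> * l * of_real t) * R (1 - t))))) \<le> K0 * (2 * K0\<^sup>2 / (Im l)\<^sup>2)"
          by (simp only: norm_minus_cancel)
        then show ?case unfolding b0 by (simp add: algebra_simps)
      qed
    qed
    from tendsto_add[OF this tendsto_mult[OF tendsto_const[of "- \<i>"] laplace_asymptotics[OF refl_cont]]]
    show ?thesis by (simp add: algebra_simps)
  qed
qed

end

lemma tendsto_0_of_mult_upper_sector:
  assumes "((\<lambda>l. l * f l) \<longlongrightarrow> c) upper_sector"
  shows "(f \<longlongrightarrow> 0) upper_sector"
proof -
  have "((\<lambda>l::complex. inverse l) \<longlongrightarrow> 0) upper_sector"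
    by (rule tendsto_mono[OF _ tendsto_inverse_0]) (simp add: upper_sector_def)
  from tendsto_mult[OF this assms] have "((\<lambda>l. inverse l * (l * f l)) \<longlongrightarrow> 0) upper_sector" by simp
  moreover have "\<forall>\<^sub>F l in upper_sector. inverse l * (l * f l) = f l"
    using eventually_in_upper_sector by eventually_elim simp
  ultimately show ?thesis by (rule Lim_transform_eventually)
qed

section \<open>The determinant of the boundary forms in both half planes\<close>

definition swapv :: "complex^2 \<Rightarrow> complex^2" where
  "swapv z = vector [z $ 2, z $ 1]"

lemma swapv_nth [simp]: "swapv z $ 1 = z $ 2" "swapv z $ 2 = z $ 1"
  by (simp_all add: swapv_def)

lemma norm_swapv [simp]: "norm (swapv z) = norm z"
  by (simp add: norm_vec_def L2_set_def sum_2 add.commute)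

lemma swapv_swapv [simp]: "swapv (swapv z) = z"
  by (rule complex2_eqI) simp_all

lemma bounded_linear_swapv: "bounded_linear swapv"
  by (rule bounded_linear_intro[where K = 1]) (auto intro!: complex2_eqI)

lemma bc_swapv: "bc (swapv c) (swapv d) (\<lambda>t. swapv (y t)) = bc c d y"
  by (simp add: bc_def)

lemma norm_complex2_bound:
  assumes "norm (z $ 1) \<le> B" "norm (z $ 2) \<le> B" shows "norm (z :: complex^2) \<le> 2 * B"
  using norm_complex2_le[of z] assms by linarith

context potential
begin

lemma swapped: "potential (\<lambda>x. - R x) (\<lambda>x. - P x)"
  by unfold_locales (intro continuous_intros contP contR)+

lemma transposed: "potential R P"
  by unfold_locales (intro contP contR)+

lemma dsys_swapv:
  assumes "dsys P R l g y"
  shows "dsys (\<lambda>x. - R x) (\<lambda>x. - P x) (- l) (\<lambda>t. swapv (g t)) (\<lambda>t. swapv (y t))"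
  unfolding dsys_def
proof (intro conjI ballI)
  note D = dsysD[OF assms]
  show "continuous_on {0..1} (\<lambda>t. swapv (y t))"
    by (rule bounded_linear.continuous_on[OF bounded_linear_swapv D(1)])
  show "(\<lambda>t. swapv (g t)) absolutely_integrable_on {0..1}"
    using absolutely_integrable_linear[OF D(2) bounded_linear_swapv] by (simp add: comp_def)
  fix x :: real assume x: "x \<in> {0..1}"
  have "(\<lambda>t. dirac (\<lambda>x. - R x) (\<lambda>x. - P x) (- l) t (swapv (y t)) + swapv (g t)) = swapv \<circ> (\<lambda>t. dirac P R l t (y t) + g t)"
    by (rule ext, rule complex2_eqI) simp_all
  then have "integral {0..x} (\<lambda>t. dirac (\<lambda>x. - R x) (\<lambda>x. - P x) (- l) t (swapv (y t)) + swapv (g t))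
      = swapv (integral {0..x} (\<lambda>t. dirac P R l t (y t) + g t))"
    using integral_linear[OF absint_D(1)[OF dsys_integrable[OF assms] x] bounded_linear_swapv] by simp
  moreover have "swapv (y x) = swapv (y 0) + swapv (integral {0..x} (\<lambda>t. dirac P R l t (y t) + g t))"
    using arg_cong[OF D(3)[OF x], of swapv] by (simp add: linear_simps(1)[OF bounded_linear_swapv])
  ultimately show "swapv (y x) = swapv (y 0) + integral {0..x} (\<lambda>t. dirac (\<lambda>x. - R x) (\<lambda>x. - P x) (- l) t (swapv (y t)) + swapv (g t))"
    by simp
qed

text \<open>The determinant tends to the minor of the case distinction below. If that minor is zero,
  the determinant times \<open>l\<close> tends to minus one half of the expression assumed nonzero.
  Either way the order is at least 1/|l|.\<close>

lemma upper_sector_solutions: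
  fixes c1 d1 c2 d2 :: "complex^2"
  assumes nd: "(c1 $ 1 * d2 $ 1 - d1 $ 1 * c2 $ 1) * P 0 - (d1 $ 2 * c2 $ 2 - c1 $ 2 * d2 $ 2) * R 1 \<noteq> 0"
  shows "\<exists>k>0. \<forall>\<^sub>F l in upper_sector. \<exists>a b. dsys P R l (\<lambda>_. 0) a \<and> dsys P R l (\<lambda>_. 0) b \<and>
    (\<forall>x\<in>{0..1}. norm (a x) \<le> 4 \<and> norm (b x) \<le> 4) \<and>
    k \<le> norm (l * (bc c1 d1 b * bc c2 d2 a - bc c2 d2 b * bc c1 d1 a))"
proof -
  have "\<exists>a b. 2 * K0 \<le> Im l \<longrightarrow> (dsys P R l (\<lambda>_. 0) a \<and> a 1 $ 1 = 0 \<and> a 0 $ 2 = 1) \<and> (dsys P R l (\<lambda>_. 0) b \<and> b 1 $ 1 = 1 \<and> b 0 $ 2 = 0)" for l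
  proof (cases "2 * K0 \<le> Im l")
    case True
    from boundary_solutions[OF this] show ?thesis by metis
  qed simp
  then obtain a b where ab: "\<And>l. 2 * K0 \<le> Im l \<Longrightarrow> dsys P R l (\<lambda>_. 0) (a l) \<and> a l 1 $ 1 = 0 \<and> a l 0 $ 2 = 1"
    "\<And>l. 2 * K0 \<le> Im l \<Longrightarrow> dsys P R l (\<lambda>_. 0) (b l) \<and> b l 1 $ 1 = 1 \<and> b l 0 $ 2 = 0"
    by metis
  note asy = boundary_asymptotics[OF ab]
  define \<alpha> \<gamma> \<beta>' \<beta> where "\<alpha> l = a l 0 $ 1" and "\<gamma> l = a l 1 $ 2" and "\<beta>' l = b l 0 $ 1" and "\<beta> l = b l 1 $ 2" for l
  have lim: "((\<lambda>l. l * \<alpha> l) \<longlongrightarrow> P 0 / 2) upper_sector" "((\<lambda>l. l * \<gamma> l) \<longlongrightarrow> 0) upper_sector"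
    "((\<lambda>l. l * \<beta>' l) \<longlongrightarrow> 0) upper_sector" "((\<lambda>l. l * \<beta> l) \<longlongrightarrow> R 1 / 2) upper_sector"
    using asy by (simp_all add: \<alpha>_def \<gamma>_def \<beta>'_def \<beta>_def)
  note lim0 = lim[THEN tendsto_0_of_mult_upper_sector]
  have ev: "\<forall>\<^sub>F l in upper_sector. 2 * K0 \<le> Im l"
    using Im_upper_sector by (simp add: filterlim_at_top)
  define D where "D l = (c1 $ 1 * \<beta>' l + d1 $ 1 + d1 $ 2 * \<beta> l) * (c2 $ 1 * \<alpha> l + c2 $ 2 + d2 $ 2 * \<gamma> l)
     - (c2 $ 1 * \<beta>' l + d2 $ 1 + d2 $ 2 * \<beta> l) * (c1 $ 1 * \<alpha> l + c1 $ 2 + d1 $ 2 * \<gamma> l)" for l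
  have D: "bc c1 d1 (b l) * bc c2 d2 (a l) - bc c2 d2 (b l) * bc c1 d1 (a l) = D l" if "2 * K0 \<le> Im l" for l
    using ab(1)[OF that] ab(2)[OF that] by (simp add: bc_def D_def \<alpha>_def \<gamma>_def \<beta>'_def \<beta>_def)
  have "\<exists>k>0. \<forall>\<^sub>F l in upper_sector. k \<le> norm (l * D l)"
  proof (cases "d1 $ 1 * c2 $ 2 - d2 $ 1 * c1 $ 2 = 0")
    case False
    have "(D \<longlongrightarrow> (c1 $ 1 * 0 + d1 $ 1 + d1 $ 2 * 0) * (c2 $ 1 * 0 + c2 $ 2 + d2 $ 2 * 0)
      - (c2 $ 1 * 0 + d2 $ 1 + d2 $ 2 * 0) * (c1 $ 1 * 0 + c1 $ 2 + d1 $ 2 * 0)) upper_sector"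
      unfolding D_def by (intro tendsto_intros lim0)
    then have "((\<lambda>l. norm (D l)) \<longlongrightarrow> norm (d1 $ 1 * c2 $ 2 - d2 $ 1 * c1 $ 2)) upper_sector"
      by (intro tendsto_norm) simp
    then have "\<forall>\<^sub>F l in upper_sector. norm (d1 $ 1 * c2 $ 2 - d2 $ 1 * c1 $ 2) / 2 < norm (D l)"
      by (rule order_tendstoD) (use False in simp)
    moreover have "\<forall>\<^sub>F l in upper_sector. 1 \<le> norm l"
      unfolding eventually_upper_sector by blast
    ultimately have "\<forall>\<^sub>F l in upper_sector. norm (d1 $ 1 * c2 $ 2 - d2 $ 1 * c1 $ 2) / 2 \<le> norm (l * D l)"
    proof eventually_elim
      case (elim l)
      have "1 * norm (D l) \<le> norm l * norm (D l)" using elim by (intro mult_right_mono) auto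
      then show ?case using elim by (simp add: norm_mult)
    qed
    then show ?thesis using False by (intro exI[of _ "norm (d1 $ 1 * c2 $ 2 - d2 $ 1 * c1 $ 2) / 2"]) auto
  next
    case True
    \<comment> \<open>The factor \<open>l\<close> is distributed to the small boundary values so
      that each product has a limit; the only term without such a value is the vanishing
      minor.\<close>
    have eq: "l * D l = (c1 $ 1 * (l * \<beta>' l) + d1 $ 2 * (l * \<beta> l)) * (c2 $ 1 * \<alpha> l + c2 $ 2 + d2 $ 2 * \<gamma> l)
        + d1 $ 1 * (c2 $ 1 * (l * \<alpha> l) + d2 $ 2 * (l * \<gamma> l))
        - (c2 $ 1 * (l * \<beta>' l) + d2 $ 2 * (l * \<beta> l)) * (c1 $ 1 * \<alpha> l + c1 $ 2 + d1 $ 2 * \<gamma> l)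
        - d2 $ 1 * (c1 $ 1 * (l * \<alpha> l) + d1 $ 2 * (l * \<gamma> l))" for l
    proof -
      have "l * D l = l * (d1 $ 1 * c2 $ 2 - d2 $ 1 * c1 $ 2) + ((c1 $ 1 * (l * \<beta>' l) + d1 $ 2 * (l * \<beta> l)) * (c2 $ 1 * \<alpha> l + c2 $ 2 + d2 $ 2 * \<gamma> l)
        + d1 $ 1 * (c2 $ 1 * (l * \<alpha> l) + d2 $ 2 * (l * \<gamma> l))
        - (c2 $ 1 * (l * \<beta>' l) + d2 $ 2 * (l * \<beta> l)) * (c1 $ 1 * \<alpha> l + c1 $ 2 + d1 $ 2 * \<gamma> l)
        - d2 $ 1 * (c1 $ 1 * (l * \<alpha> l) + d1 $ 2 * (l * \<gamma> l)))"
        by (simp add: D_def algebra_simps)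
      then show ?thesis by (simp add: True)
    qed
    have "((\<lambda>l. l * D l) \<longlongrightarrow> (c1 $ 1 * 0 + d1 $ 2 * (R 1 / 2)) * (c2 $ 1 * 0 + c2 $ 2 + d2 $ 2 * 0)
        + d1 $ 1 * (c2 $ 1 * (P 0 / 2) + d2 $ 2 * 0)
        - (c2 $ 1 * 0 + d2 $ 2 * (R 1 / 2)) * (c1 $ 1 * 0 + c1 $ 2 + d1 $ 2 * 0)
        - d2 $ 1 * (c1 $ 1 * (P 0 / 2) + d1 $ 2 * 0)) upper_sector" (is "(_ \<longlongrightarrow> ?L) _")
      unfolding eq by (intro tendsto_intros lim lim0)
    moreover have Leq: "?L = - ((c1 $ 1 * d2 $ 1 - d1 $ 1 * c2 $ 1) * P 0 - (d1 $ 2 * c2 $ 2 - c1 $ 2 * d2 $ 2) * R 1) / 2"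
      by (simp add: field_simps)
    moreover have "?L \<noteq> 0"
      unfolding Leq using nd by (metis divide_eq_0_iff neg_equal_0_iff_equal zero_neq_numeral)
    ultimately have L: "((\<lambda>l. l * D l) \<longlongrightarrow> ?L) upper_sector" "?L \<noteq> 0" by blast+
    have "\<forall>\<^sub>F l in upper_sector. norm ?L / 2 < norm (l * D l)"
      by (rule order_tendstoD(1)[OF tendsto_norm[OF L(1)]]) (use L(2) in simp)
    then have "\<forall>\<^sub>F l in upper_sector. norm ?L / 2 \<le> norm (l * D l)" by eventually_elim simp
    then show ?thesis using L(2) by (intro exI[of _ "norm ?L / 2"] conjI) simp_all
  qed
  then obtain k where k: "0 < k" "\<forall>\<^sub>F l in upper_sector. k \<le> norm (l * D l)" by blast
  have "\<forall>\<^sub>F l in upper_sector. \<exists>a b. dsys P R l (\<lambda>_. 0) a \<and> dsys P R l (\<lambda>_. 0) b \<and>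
    (\<forall>x\<in>{0..1}. norm (a x) \<le> 4 \<and> norm (b x) \<le> 4) \<and>
    k \<le> norm (l * (bc c1 d1 b * bc c2 d2 a - bc c2 d2 b * bc c1 d1 a))"
    using ev k(2)
  proof eventually_elim
    case (elim l)
    have "norm (a l x) \<le> 2 * 2" "norm (b l x) \<le> 2 * 2" if "x \<in> {0..1}" for x
      using boundary_solution_bounds(1)[OF elim(1) _ _ that, of "a l"] boundary_solution_bounds(1)[OF elim(1) _ _ that, of "b l"]
        norm_complex2_bound[of "a l x" 2] norm_complex2_bound[of "b l x" 2] ab[OF elim(1)] by auto
    then show ?case using ab[OF elim(1)] elim(2) D[OF elim(1)] by (intro exI[of _ "a l"] exI[of _ "b l"]) auto
  qed
  then show ?thesis using k(1) by blast
qed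

text \<open>The lower half plane is reduced to the upper one by exchanging the two components.\<close>

lemma sector_solutions:
  fixes c1 d1 c2 d2 :: "complex^2"
  assumes nd: "(c1 $ 1 * d2 $ 1 - d1 $ 1 * c2 $ 1) * P 0 - (d1 $ 2 * c2 $ 2 - c1 $ 2 * d2 $ 2) * R 1 \<noteq> 0"
    "(c1 $ 1 * d2 $ 1 - d1 $ 1 * c2 $ 1) * P 1 - (d1 $ 2 * c2 $ 2 - c1 $ 2 * d2 $ 2) * R 0 \<noteq> 0"
  shows "\<exists>k>0. \<exists>r. \<forall>l. r \<le> norm l \<longrightarrow> norm l \<le> 3 * \<bar>Im l\<bar> \<longrightarrow>
    (\<exists>a b. dsys P R l (\<lambda>_. 0) a \<and> dsys P R l (\<lambda>_. 0) b \<and>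
      (\<forall>x\<in>{0..1}. norm (a x) \<le> 4 \<and> norm (b x) \<le> 4) \<and>
      k \<le> norm (l * (bc c1 d1 b * bc c2 d2 a - bc c2 d2 b * bc c1 d1 a)))"
proof -
  interpret sw: potential "\<lambda>x. - R x" "\<lambda>x. - P x" by (rule swapped)
  obtain k r where k: "0 < k" and r: "\<And>l. r \<le> norm l \<Longrightarrow> norm l \<le> 3 * Im l \<Longrightarrow> \<exists>a b. dsys P R l (\<lambda>_. 0) a \<and> dsys P R l (\<lambda>_. 0) b \<and>
    (\<forall>x\<in>{0..1}. norm (a x) \<le> 4 \<and> norm (b x) \<le> 4) \<and>
    k \<le> norm (l * (bc c1 d1 b * bc c2 d2 a - bc c2 d2 b * bc c1 d1 a))"
    using upper_sector_solutions[OF nd(1)] unfolding eventually_upper_sector by blast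
  \<comment> \<open>Exchanging components turns the potential into (-R, -P) and swaps the columns.
    The upper half plane condition of the swapped problem is then the second nondegeneracy
    condition.\<close>
  have nd': "(swapv c1 $ 1 * swapv d2 $ 1 - swapv d1 $ 1 * swapv c2 $ 1) * - R 0 - (swapv d1 $ 2 * swapv c2 $ 2 - swapv c1 $ 2 * swapv d2 $ 2) * - P 1 \<noteq> 0"
    using nd(2) by (simp add: algebra_simps)
  obtain k' r' where k': "0 < k'" and r': "\<And>l. r' \<le> norm l \<Longrightarrow> norm l \<le> 3 * Im l \<Longrightarrow> \<exists>a b. dsys (\<lambda>x. - R x) (\<lambda>x. - P x) l (\<lambda>_. 0) a \<and> dsys (\<lambda>x. - R x) (\<lambda>x. - P x) l (\<lambda>_. 0) b \<and>
    (\<forall>x\<in>{0..1}. norm (a x) \<le> 4 \<and> norm (b x) \<le> 4) \<and>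
    k' \<le> norm (l * (bc (swapv c1) (swapv d1) b * bc (swapv c2) (swapv d2) a - bc (swapv c2) (swapv d2) b * bc (swapv c1) (swapv d1) a))"
    using sw.upper_sector_solutions[OF nd'] unfolding eventually_upper_sector by blast
  have "\<exists>a b. dsys P R l (\<lambda>_. 0) a \<and> dsys P R l (\<lambda>_. 0) b \<and>
      (\<forall>x\<in>{0..1}. norm (a x) \<le> 4 \<and> norm (b x) \<le> 4) \<and>
      min k k' \<le> norm (l * (bc c1 d1 b * bc c2 d2 a - bc c2 d2 b * bc c1 d1 a))"
    if l: "max r r' \<le> norm l" "norm l \<le> 3 * \<bar>Im l\<bar>" for l
  proof (cases "0 \<le> Im l")
    case True
    then have "r \<le> norm l" "norm l \<le> 3 * Im l" using l by auto
    from r[OF this] show ?thesis by (fastforce intro: order_trans[OF min.cobounded1])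
  next
    case False
    then have "r' \<le> norm (- l)" "norm (- l) \<le> 3 * Im (- l)" using l by auto
    from r'[OF this] obtain a b where ab: "dsys (\<lambda>x. - R x) (\<lambda>x. - P x) (- l) (\<lambda>_. 0) a" "dsys (\<lambda>x. - R x) (\<lambda>x. - P x) (- l) (\<lambda>_. 0) b"
      "\<forall>x\<in>{0..1}. norm (a x) \<le> 4 \<and> norm (b x) \<le> 4"
      "k' \<le> norm (- l * (bc (swapv c1) (swapv d1) b * bc (swapv c2) (swapv d2) a - bc (swapv c2) (swapv d2) b * bc (swapv c1) (swapv d1) a))"
      by blast
    have bcs: "bc (swapv c) (swapv d) y = bc c d (\<lambda>t. swapv (y t))" for c d y
      using bc_swapv[of c d "\<lambda>t. swapv (y t)"] by simp
    have sw0: "swapv 0 = 0" by (rule complex2_eqI) simp_all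
    have "dsys P R l (\<lambda>_. 0) (\<lambda>t. swapv (a t))" "dsys P R l (\<lambda>_. 0) (\<lambda>t. swapv (b t))"
      using sw.dsys_swapv[OF ab(1)] sw.dsys_swapv[OF ab(2)] by (simp_all add: sw0)
    moreover have "min k k' \<le> norm (l * (bc c1 d1 (\<lambda>t. swapv (b t)) * bc c2 d2 (\<lambda>t. swapv (a t)) - bc c2 d2 (\<lambda>t. swapv (b t)) * bc c1 d1 (\<lambda>t. swapv (a t))))"
      using ab(4) unfolding bcs by (simp add: norm_mult min.coboundedI2)
    ultimately show ?thesis using ab(3)
      by (intro exI[of _ "\<lambda>t. swapv (a t)"] exI[of _ "\<lambda>t. swapv (b t)"]) auto
  qed
  then show ?thesis using k k' by (intro exI[of _ "min k k'"] conjI exI[of _ "max r r'"]) auto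
qed

lemma dichotomy_both:
  "\<exists>K. \<forall>l g y x i. dsys P R l g y \<longrightarrow> K \<le> \<bar>Im l\<bar> \<longrightarrow> x \<in> {0..1} \<longrightarrow>
    norm (y x $ i) \<le> 2 * (norm (y 0) + norm (y 1) + 2 * integral {0..1} (\<lambda>t. norm (g t)))"
proof -
  interpret sw: potential "\<lambda>x. - R x" "\<lambda>x. - P x" by (rule swapped)
  have "norm (y x $ i) \<le> 2 * (norm (y 0) + norm (y 1) + 2 * integral {0..1} (\<lambda>t. norm (g t)))"
    if y: "dsys P R l g y" and l: "2 * max K0 sw.K0 \<le> \<bar>Im l\<bar>" and x: "x \<in> {0..1}" for l g y x i
  proof (cases "0 \<le> Im l")
    case True
    then have "2 * K0 \<le> Im l" using l by auto
    from dichotomy[OF y this x, of i] have "norm (y x $ i) \<le> 2 * (norm (y 1 $ 1) + norm (y 0 $ 2) + 2 * integral {0..1} (\<lambda>t. norm (g t)))" .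
    also have "\<dots> \<le> 2 * (norm (y 1) + norm (y 0) + 2 * integral {0..1} (\<lambda>t. norm (g t)))"
      by (intro mult_left_mono add_mono Finite_Cartesian_Product.norm_nth_le order_refl) simp
    finally show ?thesis by (simp only: add.commute)
  next
    case False
    then have l': "2 * sw.K0 \<le> Im (- l)" using l by auto
    obtain j where j: "swapv (y x) $ j = y x $ i"
      using swapv_nth[of "y x"] exhaust_2[of i] by metis
    from sw.dichotomy[OF dsys_swapv[OF y] l' x, of j]
    have "norm (y x $ i) \<le> 2 * (norm (y 1 $ 2) + norm (y 0 $ 1) + 2 * integral {0..1} (\<lambda>t. norm (g t)))"
      unfolding j by simp
    also have "\<dots> \<le> 2 * (norm (y 1) + norm (y 0) + 2 * integral {0..1} (\<lambda>t. norm (g t)))"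
      by (intro mult_left_mono add_mono Finite_Cartesian_Product.norm_nth_le order_refl) simp
    finally show ?thesis by (simp only: add.commute)
  qed
  then show ?thesis by blast
qed

end

section \<open>The characteristic determinant and orthogonality to root chains\<close>

text \<open>Letting z tend to 0 removes the constant coefficient; division by z lowers
  \<open>m\<close>.\<close>

lemma small_polynomial_zero:
  fixes c :: "nat \<Rightarrow> complex"
  assumes "0 < r" "\<And>z. z \<noteq> 0 \<Longrightarrow> norm z \<le> r \<Longrightarrow> norm (\<Sum>k<m. z ^ k * c k) \<le> C * norm z ^ m" "k < m"
  shows "c k = 0"
  using assms(2,3)
proof (induction m arbitrary: c k)
  case (Suc m)
  have split: "(\<Sum>k<Suc m. z ^ k * c k) = c 0 + z * (\<Sum>k<m. z ^ k * c (Suc k))" for z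
    by (simp add: sum.lessThan_Suc_shift sum_distrib_left mult.assoc del: sum.lessThan_Suc)
  have c0: "c 0 = 0"
  proof -
    have ev: "\<forall>\<^sub>F z in at 0. norm (\<Sum>k<Suc m. z ^ k * c k) \<le> C * norm z ^ Suc m"
      unfolding eventually_at using assms(1) Suc.prems(1) by (intro exI[of _ r]) auto
    have "((\<lambda>z. norm (c 0 + z * (\<Sum>k<m. z ^ k * c (Suc k)))) \<longlongrightarrow> norm (c 0 + 0 * (\<Sum>k<m. 0 ^ k * c (Suc k)))) (at 0)"
      by (intro tendsto_intros)
    moreover have "((\<lambda>z::complex. C * norm z ^ Suc m) \<longlongrightarrow> C * norm (0::complex) ^ Suc m) (at 0)"
      by (intro tendsto_intros)
    ultimately have "norm (c 0 + 0 * (\<Sum>k<m. 0 ^ k * c (Suc k))) \<le> C * norm (0::complex) ^ Suc m"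
      using ev unfolding split by (intro tendsto_le[of "at (0::complex)"]) auto
    then show ?thesis by simp
  qed
  show ?case
  proof (cases k)
    case 0
    then show ?thesis using c0 by simp
  next
    case (Suc j)
    have "c (Suc j) = 0"
    proof (rule Suc.IH[of "\<lambda>k. c (Suc k)" j])
      show "norm (\<Sum>k<m. z ^ k * c (Suc k)) \<le> C * norm z ^ m" if "z \<noteq> 0" "norm z \<le> r" for z
      proof -
        have "norm z * norm (\<Sum>k<m. z ^ k * c (Suc k)) \<le> norm z * (C * norm z ^ m)"
          using Suc.prems(1)[OF that] unfolding split c0 by (simp add: norm_mult mult_ac)
        then show ?thesis using that by (simp add: mult_le_cancel_left)
      qed
      show "j < m" using Suc.prems Suc by simp
    qed
    then show ?thesis using Suc by simp
  qed
qed simp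

lemma cfunctional_zero:
  assumes "cfunctional \<Lambda>" shows "\<Lambda> (\<lambda>_. 0) = 0"
proof -
  obtain B where B: "\<And>y M. continuous_on {0..1} y \<Longrightarrow> (\<And>x. x \<in> {0..1} \<Longrightarrow> norm (y x) \<le> M) \<Longrightarrow> norm (\<Lambda> y) \<le> B * M"
    using cfunctional_bound[OF assms] by blast
  have "norm (\<Lambda> (\<lambda>_. 0)) \<le> B * 0" by (rule B) auto
  then show ?thesis by simp
qed

text \<open>Linearity together with the bound for \<open>M = 0\<close> shows that only values on
  [0,1] count.\<close>

lemma cfunctional_cong:
  assumes \<Lambda>: "cfunctional \<Lambda>" and y: "continuous_on {0..1} y" "continuous_on {0..1} y'"
    and eq: "\<And>x. x \<in> {0..1} \<Longrightarrow> y x = y' x"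
  shows "\<Lambda> y = \<Lambda> y'"
proof -
  obtain B where B: "\<And>y M. continuous_on {0..1} y \<Longrightarrow> (\<And>x. x \<in> {0..1} \<Longrightarrow> norm (y x) \<le> M) \<Longrightarrow> norm (\<Lambda> y) \<le> B * M"
    using cfunctional_bound[OF \<Lambda>] by blast
  have d: "y x + (- 1) *s y' x = 0" if "x \<in> {0..1}" for x
    using eq[OF that] by (auto intro!: complex2_eqI)
  have "norm (\<Lambda> (\<lambda>t. y t + (- 1) *s y' t)) \<le> B * 0"
  proof (rule B)
    show "continuous_on {0..1} (\<lambda>t. y t + (- 1) *s y' t)"
      by (rule continuous_on_eq[OF continuous_on_const[of _ 0]]) (use d in simp)
  qed (use d in simp)
  then show ?thesis using cfunctional_lincomb[OF \<Lambda> y, of "- 1"] by simp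
qed

context potential
begin

lemma dsys_zero: "dsys P R l (\<lambda>_. 0) (\<lambda>_. 0)"
proof -
  have "dirac P R l t 0 = 0" for t by (rule complex2_eqI) simp_all
  then show ?thesis by (simp add: dsys_def)
qed

lemma zero_absint: "(\<lambda>_. 0 :: complex^2) absolutely_integrable_on {0..1}"
  by simp

section \<open>Fundamental solutions and Lagrange's identity\<close>

definition \<phi> :: "complex \<Rightarrow> real \<Rightarrow> complex^2" where "\<phi> l = sol l (\<lambda>_. 0) (vector [1, 0])"
definition \<psi> :: "complex \<Rightarrow> real \<Rightarrow> complex^2" where "\<psi> l = sol l (\<lambda>_. 0) (vector [0, 1])"

lemma \<phi>: "dsys P R l (\<lambda>_. 0) (\<phi> l)" "\<phi> l 0 = vector [1, 0]"
  and \<psi>: "dsys P R l (\<lambda>_. 0) (\<psi> l)" "\<psi> l 0 = vector [0, 1]"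
  using sol[OF zero_absint] by (auto simp: \<phi>_def \<psi>_def)

lemma functional_expand:
  assumes \<Lambda>: "cfunctional \<Lambda>" and y: "dsys P R l (\<lambda>_. 0) y"
  shows "\<Lambda> y = y 0 $ 1 * \<Lambda> (\<phi> l) + y 0 $ 2 * \<Lambda> (\<psi> l)"
proof -
  define u where "u t = 0 + y 0 $ 1 *s \<phi> l t" for t
  define v where "v t = u t + y 0 $ 2 *s \<psi> l t" for t
  have u: "dsys P R l (\<lambda>_. 0) u" unfolding u_def using dsys_lincomb[OF dsys_zero \<phi>(1)] by simp
  have v: "dsys P R l (\<lambda>_. 0) v" unfolding v_def using dsys_lincomb[OF u \<psi>(1)] by simp
  have v0: "y 0 = v 0" by (rule complex2_eqI) (simp_all add: v_def u_def \<phi>(2) \<psi>(2))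
  have "\<Lambda> y = \<Lambda> v"
    by (rule cfunctional_cong[OF \<Lambda> dsysD(1)[OF y] dsysD(1)[OF v]]) (rule dsys_unique[OF y v v0])
  also have "\<dots> = \<Lambda> u + y 0 $ 2 * \<Lambda> (\<psi> l)"
    unfolding v_def by (rule cfunctional_lincomb[OF \<Lambda> dsysD(1)[OF u] dsysD(1)[OF \<psi>(1)]])
  also have "\<Lambda> u = y 0 $ 1 * \<Lambda> (\<phi> l)"
    unfolding u_def using cfunctional_lincomb[OF \<Lambda> _ dsysD(1)[OF \<phi>(1)], of "\<lambda>_. 0" "y 0 $ 1" l]
    by (simp add: cfunctional_zero[OF \<Lambda>])
  finally show ?thesis .
qed

lemma entire_\<phi>_\<psi>:
  assumes "cfunctional \<Lambda>"
  shows "(\<lambda>l. \<Lambda> (\<phi> l)) holomorphic_on UNIV" "exp_type (\<lambda>l. \<Lambda> (\<phi> l))"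
    "(\<lambda>l. \<Lambda> (\<psi> l)) holomorphic_on UNIV" "exp_type (\<lambda>l. \<Lambda> (\<psi> l))"
  using functional_holomorphic[OF assms \<phi>(1)] functional_exp_type[OF assms \<phi>(1)]
    functional_holomorphic[OF assms \<psi>(1)] functional_exp_type[OF assms \<psi>(1)]
  by (simp_all add: \<phi>(2) \<psi>(2) exp_type_const)

lemma dsys_component_derivative:
  assumes y: "dsys P R l (\<lambda>_. 0) y" and x: "x \<in> {0..1}"
  shows "((\<lambda>t. y t $ i) has_vector_derivative dirac P R l x (y x) $ i) (at x within {0..1})"
proof -
  have c: "continuous_on {0..1} (\<lambda>t. dirac P R l t (y t) $ i)"
    by (intro continuous_intros continuous_on_dirac dsysD(1)[OF y])
  have "((\<lambda>u. y 0 $ i + integral {0..u} (\<lambda>t. dirac P R l t (y t) $ i)) has_vector_derivative 0 + dirac P R l x (y x) $ i) (at x within {0..1})"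
    by (intro has_vector_derivative_add has_vector_derivative_const integral_has_vector_derivative[OF c x])
  then have "((\<lambda>u. y 0 $ i + integral {0..u} (\<lambda>t. dirac P R l t (y t) $ i)) has_vector_derivative dirac P R l x (y x) $ i) (at x within {0..1})" by simp
  moreover have eq: "y s $ i = y 0 $ i + integral {0..s} (\<lambda>t. dirac P R l t (y t) $ i)" if "s \<in> {0..1}" for s
    using dsys_nth[OF y that, of i] by simp
  ultimately show ?thesis
    by (intro has_vector_derivative_transform[OF x eq])
qed

text \<open>In the derivative of the bilinear product of \<open>w\<close> and \<open>y\<close> the
  parameter and potential terms cancel, leaving the product of \<open>h\<close> and
  \<open>y\<close>. As \<open>h\<close> is only integrable, the product rule in integral form is
  used.\<close>

lemma lagrange_identity:
  assumes y: "dsys P R l (\<lambda>_. 0) y" and w: "dsys R P (- l) h w"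
  shows "w 1 $ 1 * y 1 $ 1 + w 1 $ 2 * y 1 $ 2 = w 0 $ 1 * y 0 $ 1 + w 0 $ 2 * y 0 $ 2 + pairing h y"
proof -
  interpret tr: potential R P by (rule transposed)
  let ?g = "\<lambda>i t. dirac R P (- l) t (w t) $ i + h t $ i"
  note cy = dsysD(1)[OF y] and cw = dsysD(1)[OF w]
  have g: "?g i absolutely_integrable_on {0..1}" for i
    using absint_nth[OF tr.dsys_integrable[OF w], of i] by simp
  have c: "continuous_on {0..1} (\<lambda>t. dirac P R l t (y t) $ i)" for i
    by (intro continuous_intros continuous_on_dirac cy)
  have one: "(1::real) \<in> {0..1}" by simp
  have pr: "y 1 $ i * w 1 $ i = y 0 $ i * w 0 $ i + integral {0..1} (\<lambda>t. y t $ i * ?g i t + dirac P R l t (y t) $ i * w t $ i)" for i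
    by (rule integral_product_rule[OF g tr.dsys_nth[OF w] dsys_component_derivative[OF y] c one])
  have int: "(\<lambda>t. y t $ i * ?g i t + dirac P R l t (y t) $ i * w t $ i) integrable_on {0..1}" for i
    by (intro integrable_add continuous_mult_integrable g integrable_continuous_real continuous_intros c cy cw)
  have "integral {0..1} (\<lambda>t. y t $ 1 * ?g 1 t + dirac P R l t (y t) $ 1 * w t $ 1)
      + integral {0..1} (\<lambda>t. y t $ 2 * ?g 2 t + dirac P R l t (y t) $ 2 * w t $ 2) = pairing h y"
    unfolding integral_add[OF int int, symmetric] pairing_def
    by (rule integral_cong) (simp add: algebra_simps)
  then show ?thesis using pr[of 1] pr[of 2] by (simp add: algebra_simps)
qed

text \<open>Rotating \<psi> by a right angle gives a solution of the transposed homogeneous system;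
  Lagrange's identity then says that the determinant is the same at both ends.\<close>

lemma wronskian: "\<phi> l 1 $ 1 * \<psi> l 1 $ 2 - \<phi> l 1 $ 2 * \<psi> l 1 $ 1 = 1"
proof -
  define w :: "real \<Rightarrow> complex^2" where "w t = vector [\<psi> l t $ 2, - \<psi> l t $ 1]" for t
  have w12: "w t $ 1 = \<psi> l t $ 2" "w t $ 2 = - \<psi> l t $ 1" for t by (simp_all add: w_def)
  note c\<psi> = dsysD(1)[OF \<psi>(1)[of l]]
  have rot: "bounded_linear (\<lambda>z :: complex^2. vector [z $ 2, - z $ 1] :: complex^2)"
    by (rule bounded_linear_intro[where K = 1])
      (auto intro!: complex2_eqI simp: norm_vec_def L2_set_def sum_2 add.commute)
  have "dsys R P (- l) (\<lambda>_. 0) w"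
    unfolding dsys_def
  proof (intro conjI ballI)
    show "continuous_on {0..1} w"
      unfolding w_def by (rule bounded_linear.continuous_on[OF rot c\<psi>])
    show "w x = w 0 + integral {0..x} (\<lambda>t. dirac R P (- l) t (w t) + 0)" if x: "x \<in> {0..1}" for x
    proof -
      have "(\<lambda>t. dirac R P (- l) t (w t) + 0) = (\<lambda>z. vector [z $ 2, - z $ 1]) \<circ> (\<lambda>t. dirac P R l t (\<psi> l t) + 0)"
        by (rule ext, rule complex2_eqI) (simp_all add: w12)
      then have "integral {0..x} (\<lambda>t. dirac R P (- l) t (w t) + 0) = vector [integral {0..x} (\<lambda>t. dirac P R l t (\<psi> l t) + 0) $ 2, - integral {0..x} (\<lambda>t. dirac P R l t (\<psi> l t) + 0) $ 1]"
        using integral_linear[OF absint_D(1)[OF dsys_integrable[OF \<psi>(1)[of l]] x] rot] by simp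
      then show ?thesis
        using dsysD(3)[OF \<psi>(1)[of l] x] by (intro complex2_eqI) (simp_all add: w12)
    qed
  qed simp
  from lagrange_identity[OF \<phi>(1) this] show ?thesis
    by (simp add: w12 \<phi>(2) \<psi>(2) pairing_def algebra_simps)
qed

lemma dsys_zero_solution:
  assumes "dsys P R l g (\<lambda>_. 0)" "x \<in> {0..1}"
  shows "integral {0..x} g = 0"
proof -
  have "dirac P R l t 0 = 0" for t by (rule complex2_eqI) simp_all
  then show ?thesis using dsysD(3)[OF assms] by simp
qed

end

lemma integral_zero_imp_zero:
  fixes f :: "real \<Rightarrow> complex^2"
  assumes f: "continuous_on {0..1} f" and 0: "\<And>x. x \<in> {0..1} \<Longrightarrow> integral {0..x} f = 0" and x: "x \<in> {0..1}"
  shows "f x = 0"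
proof -
  have "((\<lambda>u. integral {0..u} f) has_vector_derivative f x) (at x within {0..1})"
    by (rule integral_has_vector_derivative[OF f x])
  moreover have "((\<lambda>u. integral {0..u} f) has_vector_derivative 0) (at x within {0..1})"
    by (rule has_vector_derivative_transform[OF x _ has_vector_derivative_const[of 0]]) (use 0 in simp)
  ultimately show ?thesis
    using vector_derivative_unique_within[of x "{0..1}"] x
    by (metis at_within_Icc_at_left at_within_cbox_finite box_real(2) cbox_interval islimpt_Icc trivial_limit_within zero_less_one)
qed

text \<open>\<open>c1\<close>, \<open>d1\<close> and \<open>c2\<close>, \<open>d2\<close> stand for
  the rows of C and D; the two minors are \<open>J13\<close> and \<open>J42\<close> written
  out.\<close>

locale bvp = potential +
  fixes c1 d1 c2 d2 :: "complex^2"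
  assumes nd1: "(c1 $ 1 * d2 $ 1 - d1 $ 1 * c2 $ 1) * P 0 - (d1 $ 2 * c2 $ 2 - c1 $ 2 * d2 $ 2) * R 1 \<noteq> 0"
    and nd2: "(c1 $ 1 * d2 $ 1 - d1 $ 1 * c2 $ 1) * P 1 - (d1 $ 2 * c2 $ 2 - c1 $ 2 * d2 $ 2) * R 0 \<noteq> 0"
begin

abbreviation "U1 \<equiv> bc c1 d1"
abbreviation "U2 \<equiv> bc c2 d2"

definition \<Delta> :: "complex \<Rightarrow> complex" where
  "\<Delta> l = U1 (\<phi> l) * U2 (\<psi> l) - U1 (\<psi> l) * U2 (\<phi> l)"

lemma entire_U:
  "(\<lambda>l. bc c d (\<phi> l)) holomorphic_on UNIV" "exp_type (\<lambda>l. bc c d (\<phi> l))"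
  "(\<lambda>l. bc c d (\<psi> l)) holomorphic_on UNIV" "exp_type (\<lambda>l. bc c d (\<psi> l))"
  using entire_\<phi>_\<psi>[OF cfunctional_bc] by blast+

lemma \<Delta>_entire: "\<Delta> holomorphic_on UNIV" "exp_type \<Delta>"
proof -
  have "(\<lambda>l. U1 (\<phi> l) * U2 (\<psi> l) - U1 (\<psi> l) * U2 (\<phi> l)) holomorphic_on UNIV"
    by (intro holomorphic_intros entire_U)
  moreover have "exp_type (\<lambda>l. U1 (\<phi> l) * U2 (\<psi> l) - U1 (\<psi> l) * U2 (\<phi> l))"
    by (intro exp_type_diff exp_type_mult entire_U)
  ultimately show "\<Delta> holomorphic_on UNIV" "exp_type \<Delta>" by (simp_all add: \<Delta>_def[abs_def])
qed

text \<open>Passing from the fundamental pair to another pair multiplies the determinant by that of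
  the initial values. A lower bound on a decaying pair therefore excludes zeros of \<Delta>.\<close>

lemma \<Delta>_det:
  assumes "dsys P R l (\<lambda>_. 0) a" "dsys P R l (\<lambda>_. 0) b"
  shows "U1 b * U2 a - U2 b * U1 a = \<Delta> l * (b 0 $ 1 * a 0 $ 2 - b 0 $ 2 * a 0 $ 1)"
  unfolding \<Delta>_def functional_expand[OF cfunctional_bc assms(1)] functional_expand[OF cfunctional_bc assms(2)]
  by (simp add: algebra_simps)

lemma sector:
  obtains k r where "0 < k" "\<And>l. r \<le> norm l \<Longrightarrow> norm l \<le> 3 * \<bar>Im l\<bar> \<Longrightarrow> \<Delta> l \<noteq> 0 \<and>
    (\<exists>a b. dsys P R l (\<lambda>_. 0) a \<and> dsys P R l (\<lambda>_. 0) b \<and>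
      (\<forall>x\<in>{0..1}. norm (a x) \<le> 4 \<and> norm (b x) \<le> 4) \<and> k \<le> norm (l * (U1 b * U2 a - U2 b * U1 a)))"
proof -
  obtain k r where k: "0 < k" and r: "\<And>l. r \<le> norm l \<Longrightarrow> norm l \<le> 3 * \<bar>Im l\<bar> \<Longrightarrow>
    (\<exists>a b. dsys P R l (\<lambda>_. 0) a \<and> dsys P R l (\<lambda>_. 0) b \<and>
      (\<forall>x\<in>{0..1}. norm (a x) \<le> 4 \<and> norm (b x) \<le> 4) \<and> k \<le> norm (l * (U1 b * U2 a - U2 b * U1 a)))"
    using sector_solutions[OF nd1 nd2] by blast
  have "\<Delta> l \<noteq> 0" if l: "r \<le> norm l" "norm l \<le> 3 * \<bar>Im l\<bar>" for l
  proof
    assume "\<Delta> l = 0"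
    obtain a b where "dsys P R l (\<lambda>_. 0) a" "dsys P R l (\<lambda>_. 0) b" "k \<le> norm (l * (U1 b * U2 a - U2 b * U1 a))"
      using r[OF l] by blast
    with \<Delta>_det[of l a b] \<open>\<Delta> l = 0\<close> k show False by simp
  qed
  then show ?thesis using that[OF k] r by blast
qed

lemma \<Delta>_nonzero: "\<exists>l. \<Delta> l \<noteq> 0"
proof -
  obtain k r where "\<And>l. r \<le> norm l \<Longrightarrow> norm l \<le> 3 * \<bar>Im l\<bar> \<Longrightarrow> \<Delta> l \<noteq> 0"
    using sector by metis
  from this[of "\<i> * of_real \<bar>r\<bar>"] abs_ge_self[of r] show ?thesis by (auto simp: norm_mult)
qed

text \<open>Jordan chains \<open>(L - \<mu>) p\<^sub>0 = 0\<close>, \<open>(L - \<mu>) p\<^sub>k\<^sub>+\<^sub>1 = p\<^sub>k\<close> of the boundary value problem.\<close>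

definition root_chain :: "complex \<Rightarrow> (nat \<Rightarrow> real \<Rightarrow> complex^2) \<Rightarrow> nat \<Rightarrow> bool" where
  "root_chain \<mu> p n \<longleftrightarrow> (\<forall>k\<le>n. dsys P R \<mu> (case k of 0 \<Rightarrow> (\<lambda>_. 0) | Suc j \<Rightarrow> (\<lambda>t. iB (p j t))) (p k) \<and>
     U1 (p k) = 0 \<and> U2 (p k) = 0 \<and> (\<forall>x. x \<notin> {0..1} \<longrightarrow> p k x = 0))"

text \<open>The boundary forms of \<open>u l\<close> are of order \<open>m\<close> at
  \<open>z\<close>, so the Taylor coefficients of \<open>u\<close> below order \<open>m\<close>
  satisfy the boundary conditions. They form a Jordan chain, which \<Lambda> kills, and only the
  remainder of order \<open>m\<close> survives.\<close>

lemma root_chain_vanishing: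
  assumes u: "\<And>l. dsys P R l (\<lambda>_. 0) (u l)"
    and hol: "\<And>i. (\<lambda>l. u l 0 $ i) holomorphic_on UNIV"
    and U: "\<And>l. U1 (u l) = s1 * \<Delta> l" "\<And>l. U2 (u l) = s2 * \<Delta> l"
    and g: "g holomorphic_on UNIV" "\<And>w. \<Delta> w = (w - z) ^ m * g w"
    and \<Lambda>: "cfunctional \<Lambda>" and \<Lambda>0: "\<And>p n. root_chain z p n \<Longrightarrow> \<Lambda> (p n) = 0"
  shows "\<exists>K. \<forall>\<^sub>F w in at z. norm (\<Lambda> (u w)) \<le> K * norm (w - z) ^ m"
proof -
  define a where "a k = (\<chi> i. (deriv ^^ k) (\<lambda>l. u l 0 $ i) z / fact k)" for k
  define p where "p = tay z (\<lambda>_. 0) a"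
  note T = taylor_functional[OF _ u init_taylor[where u = u, OF hol], of _ z m, folded a_def p_def]
  have "compact (g ` cball z 1)"
    by (intro compact_continuous_image holomorphic_on_imp_continuous_on holomorphic_on_subset[OF g(1)]) auto
  from compact_imp_bounded[OF this] obtain G where G: "\<forall>x\<in>g ` cball z 1. norm x \<le> G"
    unfolding bounded_iff by blast
  \<comment> \<open>Both \<open>s * \<Delta>\<close> and the Taylor remainder are of order
    \<open>m\<close>, so the Taylor polynomial of degree below \<open>m\<close> is too small to have
    a nonzero coefficient.\<close>
  have U0: "bc c d (p k) = 0" if bc: "\<And>l. bc c d (u l) = s * \<Delta> l" and "k < m" for c d s k
  proof -
    obtain C where C: "\<And>l. norm (l - z) \<le> 1 \<Longrightarrow> norm (bc c d (u l) - (\<Sum>k<m. (l - z) ^ k * bc c d (p k))) \<le> C * norm (l - z) ^ m"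
      using T[OF cfunctional_bc] by blast
    show ?thesis
    proof (rule small_polynomial_zero[where c = "\<lambda>k. bc c d (p k)" and r = 1 and C = "C + norm s * G"])
      fix \<zeta> :: complex assume \<zeta>: "norm \<zeta> \<le> 1"
      have "norm (g (z + \<zeta>)) \<le> G" using G \<zeta> by (simp add: dist_norm)
      then have "norm (s * (\<zeta> ^ m * g (z + \<zeta>))) \<le> norm s * (norm \<zeta> ^ m * G)"
        unfolding norm_mult norm_power by (intro mult_left_mono) auto
      moreover have "norm (s * (\<zeta> ^ m * g (z + \<zeta>)) - (\<Sum>k<m. \<zeta> ^ k * bc c d (p k))) \<le> C * norm \<zeta> ^ m"
        using C[of "z + \<zeta>"] \<zeta> by (simp add: bc g(2))
      ultimately have "norm (\<Sum>k<m. \<zeta> ^ k * bc c d (p k)) \<le> C * norm \<zeta> ^ m + norm s * (norm \<zeta> ^ m * G)"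
        using norm_triangle_sub[of "\<Sum>k<m. \<zeta> ^ k * bc c d (p k)" "s * (\<zeta> ^ m * g (z + \<zeta>))"]
        by (simp add: norm_minus_commute)
      then show "norm (\<Sum>k<m. \<zeta> ^ k * bc c d (p k)) \<le> (C + norm s * G) * norm \<zeta> ^ m"
        by (simp add: algebra_simps)
    qed (use that in auto)
  qed
  have chain: "root_chain z p n" if "n < m" for n
    unfolding root_chain_def
  proof (intro allI impI)
    fix k assume "k \<le> n"
    then have "k < m" using that by simp
    then show "dsys P R z (case k of 0 \<Rightarrow> (\<lambda>_. 0) | Suc j \<Rightarrow> (\<lambda>t. iB (p j t))) (p k) \<and>
     U1 (p k) = 0 \<and> U2 (p k) = 0 \<and> (\<forall>x. x \<notin> {0..1} \<longrightarrow> p k x = 0)"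
      using U0[OF U(1)] U0[OF U(2)] tay[OF zero_absint, where m = z and k = k and a = a] unfolding p_def by blast
  qed
  obtain C where C: "\<And>l. norm (l - z) \<le> 1 \<Longrightarrow> norm (\<Lambda> (u l) - (\<Sum>k<m. (l - z) ^ k * \<Lambda> (p k))) \<le> C * norm (l - z) ^ m"
    using T[OF \<Lambda>] by blast
  have "norm (\<Lambda> (u l)) \<le> C * norm (l - z) ^ m" if "norm (l - z) \<le> 1" for l
  proof -
    have "(\<Sum>k<m. (l - z) ^ k * \<Lambda> (p k)) = 0"
      by (intro sum.neutral ballI) (use \<Lambda>0[OF chain] in simp)
    then show ?thesis using C[OF that] by simp
  qed
  then have "\<forall>\<^sub>F w in at z. norm (\<Lambda> (u w)) \<le> C * norm (w - z) ^ m"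
    unfolding eventually_at by (intro exI[of _ 1]) (auto simp: dist_norm)
  then show ?thesis by blast
qed

end

context bvp
begin

text \<open>This is where the root chains enter: \<open>annihilates \<Lambda>\<close> makes \<open>\<Lambda> (u l)\<close> vanish at each
  zero of \<open>\<Delta>\<close> to at least the order of that zero, whenever \<open>U1 (u l)\<close> and \<open>U2 (u l)\<close> are
  multiples of \<open>\<Delta> l\<close>.\<close>

definition annihilates :: "((real \<Rightarrow> complex^2) \<Rightarrow> complex) \<Rightarrow> bool" where
  "annihilates \<Lambda> \<longleftrightarrow> (\<forall>z p n. root_chain z p n \<longrightarrow> \<Lambda> (p n) = 0)"

lemma quotient_functional:
  assumes \<Lambda>: "cfunctional \<Lambda>" and \<Lambda>0: "annihilates \<Lambda>"
    and \<alpha>: "\<alpha> holomorphic_on UNIV" "exp_type \<alpha>" and \<beta>: "\<beta> holomorphic_on UNIV" "exp_type \<beta>"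
    and U: "\<And>l. \<alpha> l * U1 (\<phi> l) + \<beta> l * U1 (\<psi> l) = s1 * \<Delta> l" "\<And>l. \<alpha> l * U2 (\<phi> l) + \<beta> l * U2 (\<psi> l) = s2 * \<Delta> l"
  obtains q where "q holomorphic_on UNIV" "exp_type q" "\<And>l. \<alpha> l * \<Lambda> (\<phi> l) + \<beta> l * \<Lambda> (\<psi> l) = q l * \<Delta> l"
proof -
  define u where "u l = sol l (\<lambda>_. 0) (vector [\<alpha> l, \<beta> l])" for l
  have u: "dsys P R l (\<lambda>_. 0) (u l)" "u l 0 = vector [\<alpha> l, \<beta> l]" for l
    using sol[OF zero_absint] by (auto simp: u_def)
  have ex: "\<Lambda>' (u l) = \<alpha> l * \<Lambda>' (\<phi> l) + \<beta> l * \<Lambda>' (\<psi> l)" if "cfunctional \<Lambda>'" for \<Lambda>' l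
    using functional_expand[OF that u(1)] by (simp add: u(2))
  have hol: "(\<lambda>l. u l 0 $ i) holomorphic_on UNIV" for i
    using exhaust_2[of i] \<alpha> \<beta> by (auto simp: u(2))
  have et: "exp_type (\<lambda>l. u l 0 $ i)" for i
    using exhaust_2[of i] \<alpha> \<beta> by (auto simp: u(2))
  obtain l0 where l0: "\<Delta> l0 \<noteq> 0" using \<Delta>_nonzero by blast
  obtain q where q: "q holomorphic_on UNIV" "\<And>l. \<Lambda> (u l) = q l * \<Delta> l"
  proof (rule entire_quotient[OF functional_holomorphic[OF \<Lambda> u(1) hol] \<Delta>_entire(1) l0])
    fix z m assume "\<exists>g. g holomorphic_on UNIV \<and> g z \<noteq> 0 \<and> (\<forall>w. \<Delta> w = (w - z) ^ m * g w)"
    then obtain g where g: "g holomorphic_on UNIV" "\<And>w. \<Delta> w = (w - z) ^ m * g w" by blast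
    show "\<exists>K. \<forall>\<^sub>F w in at z. norm (\<Lambda> (u w)) \<le> K * norm (w - z) ^ m"
    proof (rule root_chain_vanishing[where u = u and \<Lambda> = \<Lambda> and ?s1.0 = s1 and ?s2.0 = s2 and g = g, OF u(1) hol _ _ g])
      show "\<Lambda> (p n) = 0" if "root_chain z p n" for p n
        using \<Lambda>0 that unfolding annihilates_def by blast
    qed (simp_all add: ex[OF cfunctional_bc] U \<Lambda>)
  qed (use that in blast)
  have "exp_type (\<lambda>l. \<Lambda> (u l))" by (rule functional_exp_type[OF \<Lambda> u(1) et])
  then have "exp_type q"
    by (intro exp_type_quotient[OF q(1) \<Delta>_entire(1) l0 _ \<Delta>_entire(2)]) (simp add: q(2))
  with q(1) show ?thesis by (rule that) (use q(2) ex[OF \<Lambda>] in simp)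
qed

lemma orthogonal_multipliers:
  assumes h: "h absolutely_integrable_on {0..1}"
    and orth: "annihilates (pairing h)"
  obtains a1 b1 a2 b2 where "\<And>l y. \<Delta> l \<noteq> 0 \<Longrightarrow> dsys P R l (\<lambda>_. 0) y \<Longrightarrow>
    (a1 + b1 * l) * U1 y + (a2 + b2 * l) * U2 y = pairing h y"
proof -
  note ph = cfunctional_pairing[OF h]
  \<comment> \<open>Cramer's rule: with coefficients from the adjugate boundary matrix, the
    combination has \<open>U1\<close> equal to \<Delta> and \<open>U2\<close> equal to 0, and
    conversely for \<open>q2\<close>.\<close>
  obtain q1 where q1: "q1 holomorphic_on UNIV" "exp_type q1" "\<And>l. U2 (\<psi> l) * pairing h (\<phi> l) + - U2 (\<phi> l) * pairing h (\<psi> l) = q1 l * \<Delta> l"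
    by (rule quotient_functional[where \<Lambda> = "pairing h" and \<alpha> = "\<lambda>l. U2 (\<psi> l)" and \<beta> = "\<lambda>l. - U2 (\<phi> l)" and ?s1.0 = 1 and ?s2.0 = 0, OF ph orth])
      (auto intro!: holomorphic_intros exp_type_minus entire_U simp: \<Delta>_def)
  obtain q2 where q2: "q2 holomorphic_on UNIV" "exp_type q2" "\<And>l. - U1 (\<psi> l) * pairing h (\<phi> l) + U1 (\<phi> l) * pairing h (\<psi> l) = q2 l * \<Delta> l"
    by (rule quotient_functional[where \<Lambda> = "pairing h" and \<alpha> = "\<lambda>l. - U1 (\<psi> l)" and \<beta> = "\<lambda>l. U1 (\<phi> l)" and ?s1.0 = 0 and ?s2.0 = 1, OF ph orth])
      (auto intro!: holomorphic_intros exp_type_minus entire_U simp: \<Delta>_def)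
  have id: "q1 l * U1 y + q2 l * U2 y = pairing h y" if nz: "\<Delta> l \<noteq> 0" and y: "dsys P R l (\<lambda>_. 0) y" for l y
  proof -
    have "(q1 l * U1 y + q2 l * U2 y) * \<Delta> l = (q1 l * \<Delta> l) * U1 y + (q2 l * \<Delta> l) * U2 y"
      by (simp add: algebra_simps)
    also have "\<dots> = pairing h y * \<Delta> l"
      unfolding q1(3)[symmetric] q2(3)[symmetric] functional_expand[OF cfunctional_bc y] functional_expand[OF ph y]
      by (simp add: \<Delta>_def algebra_simps)
    finally show ?thesis using nz by simp
  qed
  obtain Bh where Bh: "0 \<le> Bh" "\<And>y M. continuous_on {0..1} y \<Longrightarrow> (\<And>x. x \<in> {0..1} \<Longrightarrow> norm (y x) \<le> M) \<Longrightarrow> norm (pairing h y) \<le> Bh * M"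
    using cfunctional_bound[OF ph] by blast
  obtain Bu where Bu: "0 \<le> Bu" "\<And>y. continuous_on {0..1} y \<Longrightarrow> (\<And>x. x \<in> {0..1} \<Longrightarrow> norm (y x) \<le> 4) \<Longrightarrow> norm (U1 y) \<le> Bu \<and> norm (U2 y) \<le> Bu"
  proof -
    obtain B1 where B1: "0 \<le> B1" "\<And>y M. continuous_on {0..1} y \<Longrightarrow> (\<And>x. x \<in> {0..1} \<Longrightarrow> norm (y x) \<le> M) \<Longrightarrow> norm (U1 y) \<le> B1 * M"
      using cfunctional_bound[OF cfunctional_bc] by metis
    obtain B2 where B2: "0 \<le> B2" "\<And>y M. continuous_on {0..1} y \<Longrightarrow> (\<And>x. x \<in> {0..1} \<Longrightarrow> norm (y x) \<le> M) \<Longrightarrow> norm (U2 y) \<le> B2 * M"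
      using cfunctional_bound[OF cfunctional_bc] by metis
    show ?thesis
    proof (rule that)
      show "0 \<le> max B1 B2 * 4" using B1 by simp
      show "norm (U1 y) \<le> max B1 B2 * 4 \<and> norm (U2 y) \<le> max B1 B2 * 4"
        if "continuous_on {0..1} y" "\<And>x. x \<in> {0..1} \<Longrightarrow> norm (y x) \<le> 4" for y
        using B1(2)[OF that] B2(2)[OF that] by (auto simp: mult_right_mono intro: order_trans)
    qed
  qed
  obtain k r where k: "0 < k" and r: "\<And>l. r \<le> norm l \<Longrightarrow> norm l \<le> 3 * \<bar>Im l\<bar> \<Longrightarrow> \<Delta> l \<noteq> 0 \<and>
    (\<exists>a b. dsys P R l (\<lambda>_. 0) a \<and> dsys P R l (\<lambda>_. 0) b \<and>
      (\<forall>x\<in>{0..1}. norm (a x) \<le> 4 \<and> norm (b x) \<le> 4) \<and> k \<le> norm (l * (U1 b * U2 a - U2 b * U1 a)))"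
    using sector by blast
  \<comment> \<open>Solving for the multipliers on the decaying pair: each numerator is at most
    twice \<open>Bh * 4 * Bu\<close>, and the determinant is at least k / |l|.\<close>
  define C where "C = 2 * (Bh * 4 * Bu) / k"
  have C0: "0 \<le> C" using Bh Bu k by (simp add: C_def)
  have growth: "norm (q1 l) \<le> C * (1 + norm l) \<and> norm (q2 l) \<le> C * (1 + norm l)" if l: "r \<le> norm l" "norm l \<le> 3 * \<bar>Im l\<bar>" for l
  proof -
    obtain a b where ab: "dsys P R l (\<lambda>_. 0) a" "dsys P R l (\<lambda>_. 0) b" "\<And>x. x \<in> {0..1} \<Longrightarrow> norm (a x) \<le> 4" "\<And>x. x \<in> {0..1} \<Longrightarrow> norm (b x) \<le> 4"
      "k \<le> norm (l * (U1 b * U2 a - U2 b * U1 a))" and nz: "\<Delta> l \<noteq> 0"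
      using r[OF l] by blast
    note ca = dsysD(1)[OF ab(1)] and cb = dsysD(1)[OF ab(2)]
    define D where "D = U1 b * U2 a - U2 b * U1 a"
    have Ha: "norm (pairing h a) \<le> Bh * 4" and Hb: "norm (pairing h b) \<le> Bh * 4"
      using Bh(2)[OF ca ab(3)] Bh(2)[OF cb ab(4)] by auto
    have Ua: "norm (U1 a) \<le> Bu" "norm (U2 a) \<le> Bu" and Ub: "norm (U1 b) \<le> Bu" "norm (U2 b) \<le> Bu"
      using Bu(2)[OF ca ab(3)] Bu(2)[OF cb ab(4)] by auto
    have e1: "q1 l * D = pairing h b * U2 a - pairing h a * U2 b"
      unfolding id[OF nz ab(1), symmetric] id[OF nz ab(2), symmetric] D_def by (simp add: algebra_simps)
    have e2: "q2 l * D = pairing h a * U1 b - pairing h b * U1 a"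
      unfolding id[OF nz ab(1), symmetric] id[OF nz ab(2), symmetric] D_def by (simp add: algebra_simps)
    have *: "norm q \<le> C * (1 + norm l)" if e: "q * D = s * u - t * v"
      and st: "norm s \<le> Bh * 4" "norm t \<le> Bh * 4" "norm u \<le> Bu" "norm v \<le> Bu" for q s t u v
    proof -
      have "norm (q * D) \<le> norm s * norm u + norm t * norm v"
        unfolding e by (metis norm_triangle_ineq4 norm_mult)
      also have "\<dots> \<le> Bh * 4 * Bu + Bh * 4 * Bu"
        using st Bh(1) Bu(1) by (intro add_mono mult_mono) auto
      finally have qD: "norm (q * D) \<le> 2 * (Bh * 4 * Bu)" by simp
      have "norm q * k \<le> norm q * norm (l * D)" using ab(5) by (intro mult_left_mono) (auto simp: D_def)
      also have "\<dots> = norm l * norm (q * D)" by (simp add: norm_mult)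
      also have "\<dots> \<le> norm l * (2 * (Bh * 4 * Bu))" using qD by (intro mult_left_mono) auto
      also have "\<dots> = C * norm l * k" using k by (simp add: C_def)
      finally have "norm q \<le> C * norm l" using k by (simp add: mult_le_cancel_right)
      also have "\<dots> \<le> C * (1 + norm l)" using C0 by (intro mult_left_mono) auto
      finally show ?thesis .
    qed
    show ?thesis using *[OF e1 Hb Ha Ua(2) Ub(2)] *[OF e2 Ha Hb Ub(1) Ua(1)] by blast
  qed
  obtain a1 b1 where "\<And>l. q1 l = a1 + b1 * l"
    using exp_type_affine[OF q1(1,2), of r C] growth by blast
  moreover obtain a2 b2 where "\<And>l. q2 l = a2 + b2 * l"
    using exp_type_affine[OF q2(1,2), of r C] growth by blast
  ultimately show ?thesis using id by (intro that) simp
qed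

text \<open>The solution \<open>W l\<close> of the transposed inhomogeneous system whose boundary values are
  prescribed by the multipliers is affine in \<open>l\<close>. Comparing the coefficients of the powers of \<open>l\<close>
  in the system yields first \<open>W = 0\<close> and then \<open>h = 0\<close>.\<close>

proposition orthogonal_to_root_chains:
  assumes h: "h absolutely_integrable_on {0..1}"
    and orth: "annihilates (pairing h)"
    and x: "x \<in> {0..1}"
  shows "integral {0..x} h = 0"
proof -
  interpret tr: potential R P by (rule transposed)
  obtain a1 b1 a2 b2 where id: "\<And>l y. \<Delta> l \<noteq> 0 \<Longrightarrow> dsys P R l (\<lambda>_. 0) y \<Longrightarrow>
    (a1 + b1 * l) * U1 y + (a2 + b2 * l) * U2 y = pairing h y"
    using orthogonal_multipliers[where h = h, OF h orth] by metis
  \<comment> \<open>The multipliers are taken at -l because the transposed system at parameter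
    \<open>l\<close> is paired with solutions of the original one at -l.\<close>
  define q1 q2 where "q1 l = a1 - b1 * l" and "q2 l = a2 - b2 * l" for l
  \<comment> \<open>This initial value cancels the boundary terms at 0 in Lagrange's identity; what
    is left identifies the value at 1.\<close>
  define W where "W l = tr.sol l h (- (q1 l *s c1 + q2 l *s c2))" for l
  have W: "dsys R P l h (W l)" "W l 0 = - (q1 l *s c1 + q2 l *s c2)" for l
    using tr.sol[OF h] by (auto simp: W_def)
  have W1: "W l 1 = q1 l *s d1 + q2 l *s d2" if nz: "\<Delta> (- l) \<noteq> 0" for l
  proof -
    define v where "v = W l 1 - (q1 l *s d1 + q2 l *s d2)"
    have v: "v $ 1 * y 1 $ 1 + v $ 2 * y 1 $ 2 = 0" if y: "dsys P R (- l) (\<lambda>_. 0) y" for y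
    proof -
      have w: "dsys R P (- (- l)) h (W l)" using W(1)[of l] by simp
      have "q1 l * U1 y + q2 l * U2 y = pairing h y"
        using id[OF nz y] by (simp add: q1_def q2_def)
      moreover define c where "c = q1 l * (c1 $ 1 * y 0 $ 1 + c1 $ 2 * y 0 $ 2) + q2 l * (c2 $ 1 * y 0 $ 1 + c2 $ 2 * y 0 $ 2)"
      have "v $ 1 * y 1 $ 1 + v $ 2 * y 1 $ 2 = (W l 1 $ 1 * y 1 $ 1 + W l 1 $ 2 * y 1 $ 2) - (q1 l * U1 y + q2 l * U2 y) + c"
        by (simp add: v_def bc_def c_def algebra_simps)
      moreover have "W l 0 $ 1 * y 0 $ 1 + W l 0 $ 2 * y 0 $ 2 = - c"
        by (simp add: W(2) c_def algebra_simps)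
      ultimately show ?thesis using lagrange_identity[OF y w] by simp
    qed
    \<comment> \<open>Testing against both fundamental solutions leaves a homogeneous linear system
      whose determinant is the Wronskian 1.\<close>
    note e1 = v[OF \<phi>(1)] and e2 = v[OF \<psi>(1)]
    let ?p = "\<phi> (- l) 1" and ?s = "\<psi> (- l) 1"
    have "v $ 1 * (?p $ 1 * ?s $ 2 - ?p $ 2 * ?s $ 1) = (v $ 1 * ?p $ 1 + v $ 2 * ?p $ 2) * ?s $ 2 - (v $ 1 * ?s $ 1 + v $ 2 * ?s $ 2) * ?p $ 2"
      by (simp add: algebra_simps)
    then have v1: "v $ 1 = 0" using e1 e2 wronskian[of "- l"] by simp
    have "v $ 2 * (?p $ 1 * ?s $ 2 - ?p $ 2 * ?s $ 1) = (v $ 1 * ?s $ 1 + v $ 2 * ?s $ 2) * ?p $ 1 - (v $ 1 * ?p $ 1 + v $ 2 * ?p $ 2) * ?s $ 1"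
      by (simp add: algebra_simps)
    then have v2: "v $ 2 = 0" using e1 e2 wronskian[of "- l"] by simp
    have "v = 0" by (rule complex2_eqI) (simp_all add: v1 v2)
    then show ?thesis by (simp add: v_def)
  qed
  obtain k r where r: "\<And>l. r \<le> norm l \<Longrightarrow> norm l \<le> 3 * \<bar>Im l\<bar> \<Longrightarrow> \<Delta> l \<noteq> 0"
    using sector by metis
  obtain K where K: "\<And>l g y x i. dsys R P l g y \<Longrightarrow> K \<le> \<bar>Im l\<bar> \<Longrightarrow> x \<in> {0..1} \<Longrightarrow>
    norm (y x $ i) \<le> 2 * (norm (y 0) + norm (y 1) + 2 * integral {0..1} (\<lambda>t. norm (g t)))"
    using tr.dichotomy_both by blast
  define B where "B = norm a1 + norm b1 + norm a2 + norm b2"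
  have B0: "0 \<le> B" by (simp add: B_def)
  have qB: "norm (q1 l) \<le> B * (1 + norm l)" "norm (q2 l) \<le> B * (1 + norm l)" for l
  proof -
    have "norm (q1 l) \<le> norm a1 + norm b1 * norm l" "norm (q2 l) \<le> norm a2 + norm b2 * norm l"
      unfolding q1_def q2_def by (metis norm_triangle_ineq4 norm_mult)+
    moreover have "norm a1 + norm b1 * norm l \<le> B * (1 + norm l)" "norm a2 + norm b2 * norm l \<le> B * (1 + norm l)"
      by (simp_all add: B_def algebra_simps add_nonneg_nonneg)
    ultimately show "norm (q1 l) \<le> B * (1 + norm l)" "norm (q2 l) \<le> B * (1 + norm l)" by linarith+
  qed
  have comb: "norm (q1 l *s c + q2 l *s d) \<le> (B * (norm c + norm d)) * (1 + norm l)" for l and c d :: "complex^2"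
  proof -
    have "norm (q1 l *s c + q2 l *s d) \<le> norm (q1 l) * norm c + norm (q2 l) * norm d"
      using norm_triangle_ineq[of "q1 l *s c" "q2 l *s d"] by (simp only: norm_vector_smult)
    also have "\<dots> \<le> (B * (1 + norm l)) * norm c + (B * (1 + norm l)) * norm d"
      by (intro add_mono mult_right_mono qB) auto
    finally show ?thesis by (simp add: algebra_simps)
  qed
  define G where "G = integral {0..1} (\<lambda>t. norm (h t))"
  have G0: "0 \<le> G" unfolding G_def using h by (intro integral_nonneg) (auto simp: absolutely_integrable_on_def)
  define C where "C = 2 * (B * (norm c1 + norm c2) + B * (norm d1 + norm d2) + 2 * G)"
  \<comment> \<open>In the two sectors the dichotomy bounds the solution by its end values, which
    grow linearly in \<open>l\<close>; elsewhere the growth principle takes over.\<close>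
  have aff: "\<exists>a b. \<forall>l. W l s $ i = a + b * l" if s: "s \<in> {0..1}" for s i
  proof (rule exp_type_affine[where r = "max r (3 * K)" and C = C])
    have lin: "W l 0 $ j = - (q1 l * c1 $ j + q2 l * c2 $ j)" for l j by (simp add: W(2))
    show "(\<lambda>l. W l s $ i) holomorphic_on UNIV"
      by (rule tr.functional_holomorphic[OF cfunctional_eval[OF s] W(1)])
        (auto simp: lin q1_def q2_def intro!: holomorphic_intros)
    show "exp_type (\<lambda>l. W l s $ i)"
      by (rule tr.functional_exp_type[OF cfunctional_eval[OF s] W(1)])
        (auto simp: lin q1_def q2_def intro!: exp_type_minus exp_type_add exp_type_diff exp_type_mult exp_type_const exp_type_ident)
    fix l :: complex assume l: "max r (3 * K) \<le> norm l" "norm l \<le> 3 * \<bar>Im l\<bar>"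
    have "norm (W l s $ i) \<le> 2 * (norm (W l 0) + norm (W l 1) + 2 * G)"
      unfolding G_def by (rule K[OF W(1) _ s]) (use l in auto)
    also have "norm (W l 0) = norm (q1 l *s c1 + q2 l *s c2)"
      unfolding W(2) by (rule norm_minus_cancel)
    also have "W l 1 = q1 l *s d1 + q2 l *s d2" by (rule W1[OF r]) (use l in auto)
    also have "2 * (norm (q1 l *s c1 + q2 l *s c2) + norm (q1 l *s d1 + q2 l *s d2) + 2 * G) \<le> C * (1 + norm l)"
    proof -
      have "2 * G \<le> 2 * G * (1 + norm l)" using G0 by (simp add: mult_le_cancel_left1)
      then show ?thesis
        using comb[of l c1 c2] comb[of l d1 d2] unfolding C_def by (simp add: algebra_simps)
    qed
    finally show "norm (W l s $ i) \<le> C * (1 + norm l)" .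
  qed
  have mid: "W 1 s + W (- 1) s = 2 *s W 0 s" if "s \<in> {0..1}" for s
  proof -
    have "W 1 s $ i + W (- 1) s $ i = 2 * W 0 s $ i" for i
      using aff[OF that, of i] by auto
    then show ?thesis by (intro complex2_eqI) simp_all
  qed
  have W': "dsys R P 0 (\<lambda>t. h t + l *s iB (W l t)) (W l)" for l
    using tr.dsys_shift[OF W(1)[of l], of 0] by simp
  note cW = dsysD(1)[OF W(1)]
  have contiB: "continuous_on {0..1} (\<lambda>t. iB (y t))" if "continuous_on {0..1} y" for y
    by (rule bounded_linear.continuous_on[OF linear_iB that])
  \<comment> \<open>Second difference of the systems at 1, 0 and -1, all rewritten at parameter 0.
    The solutions cancel because they are affine in \<open>l\<close>, the copies of \<open>h\<close>
    cancel, and only the terms in which \<open>l\<close> multiplies \<open>iB\<close>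
    remain.\<close>
  have "dsys R P 0 (\<lambda>t. iB (W 1 t) - iB (W (- 1) t)) (\<lambda>_. 0)"
    by (rule tr.dsys_cong[OF tr.dsys_lincomb[OF tr.dsys_lincomb[OF W'[of 1] W'[of "- 1"], of 1] W'[of 0], of "- 2"]])
      (use mid in \<open>auto intro!: complex2_eqI\<close>)
  note z1 = tr.dsys_zero_solution[OF this]
  have d0: "iB (W 1 t) - iB (W (- 1) t) = 0" if "t \<in> {0..1}" for t
    by (rule integral_zero_imp_zero[where f = "\<lambda>t. iB (W 1 t) - iB (W (- 1) t)", OF _ z1 that])
      (intro continuous_intros contiB cW)
  have sym: "W 1 t = W 0 t" if "t \<in> {0..1}" for t
  proof -
    have "iB (W 1 t - W (- 1) t) = 0"
      using d0[OF that] by (simp add: linear_simps(2)[OF linear_iB])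
    then have "W (- 1) t = W 1 t" using norm_iB[of "W 1 t - W (- 1) t"] by simp
    then have "W 1 t $ i = W 0 t $ i" for i
      using arg_cong[OF mid[OF that], of "\<lambda>z. z $ i"] by simp
    then show ?thesis by (simp add: vec_eq_iff)
  qed
  \<comment> \<open>The first difference between 1 and 0 now has solution zero, and its
    inhomogeneity is \<open>iB\<close> of \<open>W 1\<close> alone.\<close>
  have "dsys R P 0 (\<lambda>t. iB (W 1 t)) (\<lambda>_. 0)"
    by (rule tr.dsys_cong[OF tr.dsys_lincomb[OF W'[of 1] W'[of 0], of "- 1"]])
      (use sym in \<open>auto intro!: complex2_eqI\<close>)
  note z2 = tr.dsys_zero_solution[OF this]
  have "iB (W 1 t) = 0" if "t \<in> {0..1}" for t
    by (rule integral_zero_imp_zero[where f = "\<lambda>t. iB (W 1 t)", OF contiB[OF cW] z2 that])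
  then have "W 0 t = 0" if "t \<in> {0..1}" for t
    using that sym[OF that] norm_iB[of "W 1 t"] by (metis norm_eq_zero)
  then have "dsys R P 0 h (\<lambda>_. 0)"
    by (intro tr.dsys_cong[OF W(1)[of 0]]) auto
  from tr.dsys_zero_solution[OF this x] show ?thesis .
qed

end

section \<open>Functionals dual to the root functions\<close>

text \<open>An estimate is a form of the vanishing order that survives multiplication and division
  by factors bounded away from zero.\<close>

lemma vanishing_derivatives_iff:
  assumes f: "f holomorphic_on UNIV"
  shows "(\<forall>k<m. (deriv ^^ k) f z = 0) \<longleftrightarrow> (\<exists>C. \<forall>\<^sub>F w in at z. norm (f w) \<le> C * norm (w - z) ^ m)"
proof -
  obtain C where C: "\<And>w. norm (w - z) \<le> 1 \<Longrightarrow>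
    norm (f w - (\<Sum>k<m. (w - z) ^ k * ((deriv ^^ k) f z / fact k))) \<le> C * norm (w - z) ^ m"
    using entire_taylor[OF f, of z m] by blast
  show ?thesis
  proof
    assume "\<forall>k<m. (deriv ^^ k) f z = 0"
    then have 0: "(\<Sum>k<m. (w - z) ^ k * ((deriv ^^ k) f z / fact k)) = 0" for w
      by (intro sum.neutral) auto
    have "\<forall>\<^sub>F w in at z. norm (f w) \<le> C * norm (w - z) ^ m"
      unfolding eventually_at using C unfolding 0 by (intro exI[of _ 1]) (auto simp: dist_norm)
    then show "\<exists>C. \<forall>\<^sub>F w in at z. norm (f w) \<le> C * norm (w - z) ^ m" by blast
  next
    assume "\<exists>C. \<forall>\<^sub>F w in at z. norm (f w) \<le> C * norm (w - z) ^ m"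
    then obtain C' d where d: "0 < d" "\<And>w. w \<noteq> z \<Longrightarrow> dist w z < d \<Longrightarrow> norm (f w) \<le> C' * norm (w - z) ^ m"
      unfolding eventually_at by blast
    show "\<forall>k<m. (deriv ^^ k) f z = 0"
    proof (intro allI impI)
      fix k assume k: "k < m"
      have "(deriv ^^ k) f z / fact k = 0"
      proof (rule small_polynomial_zero[where c = "\<lambda>k. (deriv ^^ k) f z / fact k" and r = "min 1 (d / 2)" and C = "C + C'"])
        fix \<zeta> :: complex assume \<zeta>: "\<zeta> \<noteq> 0" "norm \<zeta> \<le> min 1 (d / 2)"
        have "norm (f (z + \<zeta>) - (\<Sum>k<m. \<zeta> ^ k * ((deriv ^^ k) f z / fact k))) \<le> C * norm \<zeta> ^ m"
          using C[of "z + \<zeta>"] \<zeta> by simp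
        moreover have "norm (f (z + \<zeta>)) \<le> C' * norm \<zeta> ^ m"
          using d(2)[of "z + \<zeta>"] \<zeta> d(1) by (simp add: dist_norm)
        moreover have "norm (\<Sum>k<m. \<zeta> ^ k * ((deriv ^^ k) f z / fact k)) \<le> norm (f (z + \<zeta>)) +
            norm (f (z + \<zeta>) - (\<Sum>k<m. \<zeta> ^ k * ((deriv ^^ k) f z / fact k)))"
          using norm_triangle_sub[of "\<Sum>k<m. \<zeta> ^ k * ((deriv ^^ k) f z / fact k)" "f (z + \<zeta>)"]
          by (simp add: norm_minus_commute)
        ultimately show "norm (\<Sum>k<m. \<zeta> ^ k * ((deriv ^^ k) f z / fact k)) \<le> (C + C') * norm \<zeta> ^ m"
          by (simp add: algebra_simps)
      qed (use k d in auto)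
      then show "(deriv ^^ k) f z = 0" by simp
    qed
  qed
qed

text \<open>The vector of values at \<open>p\<close> lies outside the subspace of value vectors on
  \<open>U\<close>, and a linear form separates the two in finite dimensions. The proof eliminates
  one coordinate at a time.\<close>

lemma separating_combination:
  fixes N :: "'i \<Rightarrow> (real \<Rightarrow> complex^2) \<Rightarrow> complex"
  assumes "finite I"
    and lin: "\<And>i u v c. i \<in> I \<Longrightarrow> u \<in> L2 \<Longrightarrow> v \<in> L2 \<Longrightarrow> N i (u + cscale c v) = N i u + c * N i v"
    and U: "cfun.subspace U" "U \<subseteq> L2" and p: "p \<in> L2"
    and sep: "\<not> (\<exists>u\<in>U. \<forall>i\<in>I. N i u = N i p)"
  shows "\<exists>c. (\<forall>u\<in>U. (\<Sum>i\<in>I. c i * N i u) = 0) \<and> (\<Sum>i\<in>I. c i * N i p) = 1"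
  using assms
proof (induction I arbitrary: U p rule: finite_induct)
  case empty
  then show ?case using cfun.subspace_0[OF empty(2)] by blast
next
  case (insert j I)
  note lin = insert.prems(1) and U = insert.prems(2,3) and p = insert.prems(4) and sep = insert.prems(5)
  have lin': "\<And>i u v c. i \<in> I \<Longrightarrow> u \<in> L2 \<Longrightarrow> v \<in> L2 \<Longrightarrow> N i (u + cscale c v) = N i u + c * N i v"
    using lin by blast
  have sum_upd: "(\<Sum>i\<in>insert j I. (c(j := d)) i * N i u) = d * N j u + (\<Sum>i\<in>I. c i * N i u)" for c d u
  proof -
    have "(\<Sum>i\<in>I. (c(j := d)) i * N i u) = (\<Sum>i\<in>I. c i * N i u)"
      using insert.hyps(2) by (intro sum.cong) auto
    then show ?thesis using insert.hyps by simp
  qed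
  show ?case
  proof (cases "\<forall>u\<in>U. N j u = 0")
    case True
    show ?thesis
    proof (cases "N j p = 0")
      case False
      show ?thesis
        by (rule exI[of _ "(\<lambda>_. 0)(j := 1 / N j p)"], unfold sum_upd) (use True False in auto)
    next
      case 0: True
      have "\<not> (\<exists>u\<in>U. \<forall>i\<in>I. N i u = N i p)" using sep True 0 by (metis insert_iff)
      from insert.IH[OF lin' U p this] obtain c where
        "\<forall>u\<in>U. (\<Sum>i\<in>I. c i * N i u) = 0" "(\<Sum>i\<in>I. c i * N i p) = 1" by blast
      then show ?thesis by (intro exI[of _ "c(j := 0)"], unfold sum_upd) auto
    qed
  next
    case False
    then obtain u1 where u1: "u1 \<in> U" "N j u1 \<noteq> 0" by blast
    have zL: "(0 :: real \<Rightarrow> complex^2) \<in> L2" by (rule zero_L2)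
    have N0: "N i 0 = 0" if "i \<in> insert j I" for i
    proof -
      have "N i (0 + cscale 1 0) = N i 0 + 1 * N i 0" by (rule lin[OF that zL zL])
      moreover have "(0 :: real \<Rightarrow> complex^2) + cscale 1 0 = 0" by (simp add: cscale_def fun_eq_iff)
      ultimately show ?thesis by simp
    qed
    have scl: "N i (cscale c v) = c * N i v" if "i \<in> insert j I" "v \<in> L2" for i c v
      using lin[OF that(1) zL that(2), of c] N0[OF that(1)] by (simp only: add_0_left)
    define u0 where "u0 = cscale (1 / N j u1) u1"
    have u0: "u0 \<in> U" using U(1) u1(1) by (simp add: u0_def cfun.subspace_scale)
    have u0L: "u0 \<in> L2" using u0 U(2) by blast
    have Nj0: "N j u0 = 1" unfolding u0_def using scl[of j u1] u1 U(2) by auto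
    define V where "V = {u\<in>U. N j u = 0}"
    have V: "cfun.subspace V"
      unfolding cfun.subspace_def
    proof (intro conjI ballI allI)
      show "0 \<in> V" using cfun.subspace_0[OF U(1)] N0 by (simp add: V_def)
      show "x + y \<in> V" if "x \<in> V" "y \<in> V" for x y
      proof -
        have "N j (x + cscale 1 y) = N j x + 1 * N j y" by (rule lin) (use that U(2) in \<open>auto simp: V_def\<close>)
        moreover have "cscale 1 y = y" by (simp add: cscale_def)
        ultimately show ?thesis using that cfun.subspace_add[OF U(1)] by (simp add: V_def)
      qed
      show "cscale c x \<in> V" if "x \<in> V" for c x
        using that scl[of j x c] cfun.subspace_scale[OF U(1)] U(2) by (auto simp: V_def)
    qed
    \<comment> \<open>Coordinate \<open>j\<close> is eliminated: \<open>V\<close> is the part of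
      \<open>U\<close> on which it vanishes, and \<open>p\<close> is corrected along
      \<open>u0\<close>.\<close>
    define p' where "p' = p + cscale (- N j p) u0"
    have p': "p' \<in> L2" unfolding p'_def by (intro add_L2 cscale_L2 p u0L)
    have Np': "N i p' = N i p - N j p * N i u0" if "i \<in> insert j I" for i
      unfolding p'_def lin[OF that p u0L] by simp
    have "\<not> (\<exists>u\<in>V. \<forall>i\<in>I. N i u = N i p')"
    proof
      assume "\<exists>u\<in>V. \<forall>i\<in>I. N i u = N i p'"
      then obtain u where u: "u \<in> V" "\<forall>i\<in>I. N i u = N i p'" by blast
      have uL: "u \<in> L2" using u(1) U(2) by (auto simp: V_def)
      have "N i (u + cscale (N j p) u0) = N i p" if "i \<in> insert j I" for i
      proof -
        have "N i u = N i p'"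
        proof (cases "i = j")
          case True
          then show ?thesis using u(1) Np'[of j] Nj0 by (simp add: V_def)
        next
          case False
          then show ?thesis using u(2) that by blast
        qed
        then show ?thesis unfolding lin[OF that uL u0L] Np'[OF that] by simp
      qed
      moreover have "u + cscale (N j p) u0 \<in> U"
        using u(1) u0 U(1) by (auto simp: V_def intro: cfun.subspace_add cfun.subspace_scale)
      ultimately show False using sep by blast
    qed
    from insert.IH[OF lin' V _ p' this] obtain c where
      c: "\<And>u. u \<in> V \<Longrightarrow> (\<Sum>i\<in>I. c i * N i u) = 0" "(\<Sum>i\<in>I. c i * N i p') = 1"
      using U(2) by (auto simp: V_def)
    \<comment> \<open>The coefficient -e of coordinate \<open>j\<close> will compensate the
      correction along \<open>u0\<close>.\<close>
    define e where "e = (\<Sum>i\<in>I. c i * N i u0)"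
    have lc: "(\<Sum>i\<in>I. c i * N i (u + cscale a u0)) = (\<Sum>i\<in>I. c i * N i u) + a * e" if "u \<in> L2" for u a
    proof -
      have "(\<Sum>i\<in>I. c i * N i (u + cscale a u0)) = (\<Sum>i\<in>I. c i * N i u + a * (c i * N i u0))"
        by (intro sum.cong refl) (simp add: lin'[OF _ that u0L] algebra_simps)
      then show ?thesis by (simp add: sum.distrib sum_distrib_left e_def)
    qed
    have "(\<Sum>i\<in>insert j I. (c(j := - e)) i * N i u) = 0" if u: "u \<in> U" for u
    proof -
      have uL: "u \<in> L2" using u U(2) by blast
      have "N j (u + cscale (- N j u) u0) = 0" unfolding lin[OF insertI1 uL u0L] Nj0 by simp
      moreover have "u + cscale (- N j u) u0 \<in> U"
        using u u0 U(1) by (intro cfun.subspace_add cfun.subspace_scale)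
      ultimately have "u + cscale (- N j u) u0 \<in> V" unfolding V_def by blast
      from c(1)[OF this] lc[OF uL, of "- N j u"] show ?thesis unfolding sum_upd by simp
    qed
    moreover have "(\<Sum>i\<in>insert j I. (c(j := - e)) i * N i p) = 1"
      using c(2) lc[OF p, of "- N j p"] unfolding sum_upd p'_def by (simp add: mult.commute)
    ultimately show ?thesis by blast
  qed
qed

context bvp
begin

section \<open>Inhomogeneous solutions and the numerator of the resolvent\<close>

definition zsol :: "complex \<Rightarrow> (real \<Rightarrow> complex^2) \<Rightarrow> real \<Rightarrow> complex^2" where
  "zsol l g = sol l (\<lambda>t. iB (g t)) 0"

lemma iB_absint: "g absolutely_integrable_on S \<Longrightarrow> (\<lambda>t. iB (g t)) absolutely_integrable_on S"
  using absolutely_integrable_linear[OF _ linear_iB] by (simp add: comp_def)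

lemma zsol:
  assumes "g absolutely_integrable_on {0..1}"
  shows "dsys P R l (\<lambda>t. iB (g t)) (zsol l g)" "zsol l g 0 = 0"
  using sol[OF iB_absint[OF assms]] by (auto simp: zsol_def)

lemma functional_zsol_lincomb:
  assumes g: "g absolutely_integrable_on {0..1}" and g': "g' absolutely_integrable_on {0..1}" and \<Lambda>: "cfunctional \<Lambda>"
  shows "\<Lambda> (zsol l (\<lambda>t. g t + c *s g' t)) = \<Lambda> (zsol l g) + c * \<Lambda> (zsol l g')"
proof -
  have gg: "(\<lambda>t. g t + c *s g' t) absolutely_integrable_on {0..1}"
    by (rule set_integral_add(1)[OF g absint_smult[OF g']])
  have 1: "dsys P R l (\<lambda>t. iB (g t + c *s g' t)) (\<lambda>t. zsol l g t + c *s zsol l g' t)"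
    by (rule dsys_cong[OF dsys_lincomb[OF zsol(1)[OF g] zsol(1)[OF g']]]) (auto intro!: complex2_eqI simp: algebra_simps)
  have "\<Lambda> (zsol l (\<lambda>t. g t + c *s g' t)) = \<Lambda> (\<lambda>t. zsol l g t + c *s zsol l g' t)"
    by (rule cfunctional_cong[OF \<Lambda> dsysD(1)[OF zsol(1)[OF gg]] dsysD(1)[OF 1]], rule dsys_unique[OF zsol(1)[OF gg] 1])
      (simp_all add: zsol(2) g g' gg)
  also have "\<dots> = \<Lambda> (zsol l g) + c * \<Lambda> (zsol l g')"
    by (rule cfunctional_lincomb[OF \<Lambda> dsysD(1)[OF zsol(1)[OF g]] dsysD(1)[OF zsol(1)[OF g']]])
  finally show ?thesis .
qed

lemma functional_dsys_expand:
  assumes \<Lambda>: "cfunctional \<Lambda>" and g: "g absolutely_integrable_on {0..1}" and y: "dsys P R l (\<lambda>t. iB (g t)) y"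
  shows "\<Lambda> y = y 0 $ 1 * \<Lambda> (\<phi> l) + y 0 $ 2 * \<Lambda> (\<psi> l) + \<Lambda> (zsol l g)"
proof -
  define u where "u t = y t + (- 1) *s zsol l g t" for t
  have u: "dsys P R l (\<lambda>_. 0) u"
    unfolding u_def by (rule dsys_cong[OF dsys_lincomb[OF y zsol(1)[OF g], of "- 1"]]) (auto intro!: complex2_eqI)
  have "\<Lambda> u = \<Lambda> y + (- 1) * \<Lambda> (zsol l g)"
    unfolding u_def by (rule cfunctional_lincomb[OF \<Lambda> dsysD(1)[OF y] dsysD(1)[OF zsol(1)[OF g]]])
  moreover have "u 0 = y 0" by (rule complex2_eqI) (simp_all add: u_def zsol(2)[OF g])
  ultimately show ?thesis using functional_expand[OF \<Lambda> u] by simp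
qed

text \<open>With \<open>M l\<close> the boundary matrix of \<open>\<phi>, \<psi>\<close>, the vector \<open>\<eta> l g = adj (M l) (U (zsol l g))\<close>
  determines the resolvent: the initial value of \<open>(L - l)\<^sup>-\<^sup>1 g\<close> is \<open>- \<eta> l g / \<Delta> l\<close>.\<close>

definition \<eta> :: "bool \<Rightarrow> (real \<Rightarrow> complex^2) \<Rightarrow> complex \<Rightarrow> complex" where
  "\<eta> i g l = (if i then U2 (\<psi> l) * U1 (zsol l g) - U1 (\<psi> l) * U2 (zsol l g)
     else U1 (\<phi> l) * U2 (zsol l g) - U2 (\<phi> l) * U1 (zsol l g))"

lemma \<eta>_entire:
  assumes "g absolutely_integrable_on {0..1}" shows "\<eta> i g holomorphic_on UNIV"
proof -
  have *: "(\<lambda>l. bc c d (zsol l g)) holomorphic_on UNIV" for c d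
    by (rule functional_holomorphic[OF cfunctional_bc zsol(1)[OF assms]]) (simp add: zsol(2)[OF assms])
  have "(\<lambda>l. U2 (\<psi> l) * U1 (zsol l g) - U1 (\<psi> l) * U2 (zsol l g)) holomorphic_on UNIV"
    "(\<lambda>l. U1 (\<phi> l) * U2 (zsol l g) - U2 (\<phi> l) * U1 (zsol l g)) holomorphic_on UNIV"
    by (intro holomorphic_intros entire_U *)+
  then show ?thesis by (cases i) (simp_all add: \<eta>_def[abs_def])
qed

lemma \<eta>_lincomb:
  assumes "g absolutely_integrable_on {0..1}" "g' absolutely_integrable_on {0..1}"
  shows "\<eta> i (\<lambda>t. g t + c *s g' t) l = \<eta> i g l + c * \<eta> i g' l"
  unfolding \<eta>_def functional_zsol_lincomb[OF assms cfunctional_bc] by (simp add: algebra_simps)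

text \<open>Uniformity in \<open>g\<close> is the point: on the unit disc around \<open>z\<close>
  the bound involves only the L1 norm, so Cauchy's inequality makes the Taylor coefficients
  continuous functionals of \<open>g\<close>.\<close>

lemma \<eta>_bound:
  "\<exists>C. \<forall>g l. g absolutely_integrable_on {0..1} \<longrightarrow> norm (l - z) \<le> 1 \<longrightarrow>
     norm (\<eta> i g l) \<le> C * integral {0..1} (\<lambda>t. norm (g t))"
proof -
  have "\<exists>B\<ge>0. \<forall>l. norm (l - z) \<le> 1 \<longrightarrow> norm (f l) \<le> B" if "f holomorphic_on UNIV" for f :: "complex \<Rightarrow> complex"
  proof -
    have "compact (f ` cball z 1)"
      by (intro compact_continuous_image holomorphic_on_imp_continuous_on holomorphic_on_subset[OF that]) auto
    from compact_imp_bounded[OF this] obtain B where "\<forall>x\<in>f ` cball z 1. norm x \<le> B"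
      unfolding bounded_iff by blast
    then show ?thesis by (intro exI[of _ "max 0 B"]) (auto simp: dist_norm norm_minus_commute le_max_iff_disj)
  qed
  note bd = this
  obtain B1 where B1: "0 \<le> B1" "\<And>l. norm (l - z) \<le> 1 \<Longrightarrow> norm (U1 (\<phi> l)) \<le> B1" using bd[OF entire_U(1)] by metis
  obtain B2 where B2: "0 \<le> B2" "\<And>l. norm (l - z) \<le> 1 \<Longrightarrow> norm (U2 (\<phi> l)) \<le> B2" using bd[OF entire_U(1)] by metis
  obtain B3 where B3: "0 \<le> B3" "\<And>l. norm (l - z) \<le> 1 \<Longrightarrow> norm (U1 (\<psi> l)) \<le> B3" using bd[OF entire_U(3)] by metis
  obtain B4 where B4: "0 \<le> B4" "\<And>l. norm (l - z) \<le> 1 \<Longrightarrow> norm (U2 (\<psi> l)) \<le> B4" using bd[OF entire_U(3)] by metis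
  define B where "B = B1 + B2 + B3 + B4"
  have B: "norm (U1 (\<phi> l)) \<le> B" "norm (U2 (\<phi> l)) \<le> B" "norm (U1 (\<psi> l)) \<le> B" "norm (U2 (\<psi> l)) \<le> B" if "norm (l - z) \<le> 1" for l
    using B1 B2 B3 B4 that unfolding B_def by (smt (verit))+
  have B0: "0 \<le> B" using B1 B2 B3 B4 by (simp add: B_def)
  obtain E1 where E1: "0 \<le> E1" "\<And>y M. continuous_on {0..1} y \<Longrightarrow> (\<And>x. x \<in> {0..1} \<Longrightarrow> norm (y x) \<le> M) \<Longrightarrow> norm (U1 y) \<le> E1 * M"
    using cfunctional_bound[OF cfunctional_bc] by metis
  obtain E2 where E2: "0 \<le> E2" "\<And>y M. continuous_on {0..1} y \<Longrightarrow> (\<And>x. x \<in> {0..1} \<Longrightarrow> norm (y x) \<le> M) \<Longrightarrow> norm (U2 y) \<le> E2 * M"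
    using cfunctional_bound[OF cfunctional_bc] by metis
  define X where "X = 2 * exp (4 * (norm z + 1 + K0))"
  have "norm (\<eta> i g l) \<le> (B * (E1 + E2) * X) * integral {0..1} (\<lambda>t. norm (g t))"
    if g: "g absolutely_integrable_on {0..1}" and l: "norm (l - z) \<le> 1" for g l
  proof -
    define G where "G = integral {0..1} (\<lambda>t. norm (g t))"
    have G0: "0 \<le> G" unfolding G_def using g by (intro integral_nonneg) (auto simp: absolutely_integrable_on_def)
    have zb: "norm (zsol l g x) \<le> X * G" if "x \<in> {0..1}" for x
    proof -
      have "norm (zsol l g x) \<le> 2 * (norm (zsol l g 0) + integral {0..1} (\<lambda>t. norm (iB (g t)))) * exp (4 * (norm l + K0))"
        by (rule dsys_bound[OF zsol(1)[OF g] that])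
      also have "\<dots> = 2 * G * exp (4 * (norm l + K0))" by (simp add: zsol(2)[OF g] norm_iB G_def)
      also have "\<dots> \<le> 2 * G * exp (4 * (norm z + 1 + K0))"
        using norm_triangle_sub[of l z] l G0 by (intro mult_left_mono) auto
      finally show ?thesis by (simp add: X_def mult_ac)
    qed
    have b1: "norm (U1 (zsol l g)) \<le> E1 * (X * G)" and b2: "norm (U2 (zsol l g)) \<le> E2 * (X * G)"
      using E1(2)[OF dsysD(1)[OF zsol(1)[OF g]] zb] E2(2)[OF dsysD(1)[OF zsol(1)[OF g]] zb] by auto
    have *: "norm (a * s - b * t) \<le> B * (E1 * (X * G)) + B * (E2 * (X * G))"
      if "norm a \<le> B" "norm b \<le> B" "norm s \<le> E1 * (X * G) \<and> norm t \<le> E2 * (X * G) \<or> norm t \<le> E1 * (X * G) \<and> norm s \<le> E2 * (X * G)" for a b s t :: complex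
    proof -
      have "norm (a * s - b * t) \<le> norm a * norm s + norm b * norm t"
        by (metis norm_triangle_ineq4 norm_mult)
      also have "\<dots> \<le> B * norm s + B * norm t"
        using that by (intro add_mono mult_right_mono) auto
      also have "\<dots> = B * (norm s + norm t)" by (simp add: distrib_left)
      also have "\<dots> \<le> B * (E1 * (X * G) + E2 * (X * G))"
        using that B0 by (intro mult_left_mono) auto
      finally show ?thesis by (simp add: distrib_left)
    qed
    have "norm (\<eta> i g l) \<le> B * (E1 * (X * G)) + B * (E2 * (X * G))"
      unfolding \<eta>_def using *[of "U2 (\<psi> l)" "U1 (\<psi> l)" "U1 (zsol l g)" "U2 (zsol l g)"]
        *[of "U1 (\<phi> l)" "U2 (\<phi> l)" "U2 (zsol l g)" "U1 (zsol l g)"] B[OF l] b1 b2 by auto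
    then show ?thesis by (simp add: G_def algebra_simps)
  qed
  then show ?thesis by blast
qed

lemma iB_0 [simp]: "iB 0 = 0"
  by (rule complex2_eqI) simp_all

text \<open>The resolvent of a root vector is rational in \<open>l\<close>, and the leading coefficient at its pole is,
  up to sign, the initial value of the eigenvector \<open>p 0\<close> that ends the Jordan chain.\<close>

lemma \<eta>_root_chain:
  assumes p: "root_chain \<mu> p n"
  shows "\<exists>s. (\<forall>i. s i holomorphic_on UNIV) \<and> (\<forall>i l. (\<mu> - l) ^ Suc n * \<eta> i (p n) l = s i l * \<Delta> l) \<and>
     norm (s True \<mu>) = norm (p 0 0 $ 1) \<and> norm (s False \<mu>) = norm (p 0 0 $ 2)"
proof -
  note D = p[unfolded root_chain_def, rule_format]
  have cp: "continuous_on {0..1} (p k)" if "k \<le> n" for k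
    by (rule dsysD(1)[OF conjunct1[OF D[OF that]]])
  have ap: "p k absolutely_integrable_on {0..1}" if "k \<le> n" for k
    by (rule absolutely_integrable_continuous_real[OF cp[OF that]])
  have a0: "(\<lambda>_. 0 :: complex^2) absolutely_integrable_on {0..1}" by simp
  have z0: "\<Lambda> (zsol l (\<lambda>_. 0)) = 0" if \<Lambda>: "cfunctional \<Lambda>" for \<Lambda> l
    using functional_zsol_lincomb[OF a0 a0 \<Lambda>, of l 1] by simp
  define q where "q k = (case k of 0 \<Rightarrow> (\<lambda>_. 0) | Suc j \<Rightarrow> p j)" for k
  have qa: "q k absolutely_integrable_on {0..1}" if "k \<le> n" for k
    using that ap by (cases k) (auto simp: q_def)
  \<comment> \<open>The chain equation at \<mu>, moved to parameter \<open>l\<close>, has as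
    inhomogeneity \<open>iB\<close> of \<open>q k\<close> plus \<mu> - l times \<open>p k\<close>. A
    boundary form that kills \<open>p k\<close> gives a recursion along the chain.\<close>
  have step: "(\<mu> - l) * bc c d (zsol l (p k)) = - (p k 0 $ 1 * bc c d (\<phi> l) + p k 0 $ 2 * bc c d (\<psi> l)) - bc c d (zsol l (q k))"
    if k: "k \<le> n" and bc0: "bc c d (p k) = 0" for c d k l
  proof -
    have "dsys P R \<mu> (\<lambda>t. iB (q k t)) (p k)"
      using D[OF k] by (cases k) (simp_all add: q_def)
    from dsys_shift[OF this, of l] have "dsys P R l (\<lambda>t. iB (q k t + (\<mu> - l) *s p k t)) (p k)"
      by (rule dsys_cong) (auto intro!: complex2_eqI simp: algebra_simps)
    from functional_dsys_expand[OF cfunctional_bc _ this, of c d]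
    have "bc c d (p k) = p k 0 $ 1 * bc c d (\<phi> l) + p k 0 $ 2 * bc c d (\<psi> l) + bc c d (zsol l (\<lambda>t. q k t + (\<mu> - l) *s p k t))"
      using set_integral_add(1)[OF qa[OF k] absint_smult[OF ap[OF k]]] by blast
    then show ?thesis
      unfolding bc0 functional_zsol_lincomb[OF qa[OF k] ap[OF k] cfunctional_bc] by (simp add: algebra_simps eq_neg_iff_add_eq_0)
  qed
  have "\<exists>s1 s2. s1 holomorphic_on UNIV \<and> s2 holomorphic_on UNIV \<and>
      (\<forall>l. (\<mu> - l) ^ Suc k * U1 (zsol l (p k)) = s1 l * U1 (\<phi> l) + s2 l * U1 (\<psi> l) \<and>
           (\<mu> - l) ^ Suc k * U2 (zsol l (p k)) = s1 l * U2 (\<phi> l) + s2 l * U2 (\<psi> l)) \<and>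
      norm (s1 \<mu>) = norm (p 0 0 $ 1) \<and> norm (s2 \<mu>) = norm (p 0 0 $ 2)" if "k \<le> n" for k
    using that
  proof (induction k)
    case 0
    note S = step[OF 0(1) conjunct1[OF conjunct2[OF D[OF 0(1)]]]] step[OF 0(1) conjunct1[OF conjunct2[OF conjunct2[OF D[OF 0(1)]]]]]
    show ?case
      by (rule exI[of _ "\<lambda>_. - p 0 0 $ 1"], rule exI[of _ "\<lambda>_. - p 0 0 $ 2"])
        (auto simp: S q_def z0[OF cfunctional_bc])
  next
    case (Suc k)
    note S = step[OF Suc.prems conjunct1[OF conjunct2[OF D[OF Suc.prems]]]] step[OF Suc.prems conjunct1[OF conjunct2[OF conjunct2[OF D[OF Suc.prems]]]]]
    obtain s1 s2 where s: "s1 holomorphic_on UNIV" "s2 holomorphic_on UNIV"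
      "\<And>l. (\<mu> - l) ^ Suc k * U1 (zsol l (p k)) = s1 l * U1 (\<phi> l) + s2 l * U1 (\<psi> l)"
      "\<And>l. (\<mu> - l) ^ Suc k * U2 (zsol l (p k)) = s1 l * U2 (\<phi> l) + s2 l * U2 (\<psi> l)"
      "norm (s1 \<mu>) = norm (p 0 0 $ 1)" "norm (s2 \<mu>) = norm (p 0 0 $ 2)"
      using Suc.IH Suc.prems by auto
    \<comment> \<open>One step of the recursion, multiplied by a power of \<mu> - l. At l = \<mu>
      only the previous coefficients survive, with a change of sign; hence norms and not values are
      tracked.\<close>
    have nxt: "(\<mu> - l) ^ Suc (Suc k) * z = (- ((\<mu> - l) ^ Suc k * a) - t1) * x + (- ((\<mu> - l) ^ Suc k * b) - t2) * y"
      if "(\<mu> - l) * z = - (a * x + b * y) - w" "(\<mu> - l) ^ Suc k * w = t1 * x + t2 * y" for l z a b x y w t1 t2 :: complex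
    proof -
      have "(\<mu> - l) ^ Suc (Suc k) * z = (\<mu> - l) ^ Suc k * ((\<mu> - l) * z)" by (simp add: mult_ac)
      also have "\<dots> = - ((\<mu> - l) ^ Suc k * (a * x + b * y)) - (\<mu> - l) ^ Suc k * w"
        unfolding that(1) by (simp only: right_diff_distrib mult_minus_right)
      also have "\<dots> = - ((\<mu> - l) ^ Suc k * (a * x + b * y)) - (t1 * x + t2 * y)" unfolding that(2) ..
      also have "- (A * (a * x + b * y)) - (t1 * x + t2 * y) = (- (A * a) - t1) * x + (- (A * b) - t2) * y" for A
        by (simp add: algebra_simps)
      finally show ?thesis .
    qed
    have qk: "q (Suc k) = p k" by (simp add: q_def)
    show ?case
    proof (intro exI conjI allI)
      show "(\<lambda>l. - ((\<mu> - l) ^ Suc k * p (Suc k) 0 $ 1) - s1 l) holomorphic_on UNIV"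
        "(\<lambda>l. - ((\<mu> - l) ^ Suc k * p (Suc k) 0 $ 2) - s2 l) holomorphic_on UNIV"
        by (intro holomorphic_intros s)+
      show "(\<mu> - l) ^ Suc (Suc k) * U1 (zsol l (p (Suc k))) = (- ((\<mu> - l) ^ Suc k * p (Suc k) 0 $ 1) - s1 l) * U1 (\<phi> l)
          + (- ((\<mu> - l) ^ Suc k * p (Suc k) 0 $ 2) - s2 l) * U1 (\<psi> l)" for l
        by (rule nxt[OF S(1)]) (simp only: qk s)
      show "(\<mu> - l) ^ Suc (Suc k) * U2 (zsol l (p (Suc k))) = (- ((\<mu> - l) ^ Suc k * p (Suc k) 0 $ 1) - s1 l) * U2 (\<phi> l)
          + (- ((\<mu> - l) ^ Suc k * p (Suc k) 0 $ 2) - s2 l) * U2 (\<psi> l)" for l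
        by (rule nxt[OF S(2)]) (simp only: qk s)
    qed (simp_all add: s(5,6))
  qed
  then obtain s1 s2 where s: "s1 holomorphic_on UNIV" "s2 holomorphic_on UNIV"
      "\<And>l. (\<mu> - l) ^ Suc n * U1 (zsol l (p n)) = s1 l * U1 (\<phi> l) + s2 l * U1 (\<psi> l)"
      "\<And>l. (\<mu> - l) ^ Suc n * U2 (zsol l (p n)) = s1 l * U2 (\<phi> l) + s2 l * U2 (\<psi> l)"
      "norm (s1 \<mu>) = norm (p 0 0 $ 1)" "norm (s2 \<mu>) = norm (p 0 0 $ 2)"
    by (metis order_refl)
  have "(\<mu> - l) ^ Suc n * \<eta> i (p n) l = (if i then s1 l else s2 l) * \<Delta> l" for i l
  proof -
    have e: "c * (a * x - b * y) = a * (c * x) - b * (c * y)" for a b c x y :: complex by (simp add: algebra_simps)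
    show ?thesis
      unfolding \<eta>_def \<Delta>_def by (cases i) (simp_all only: if_True if_False e s, simp_all add: algebra_simps)
  qed
  then show ?thesis using s(1,2,5,6) by (intro exI[of _ "\<lambda>i. if i then s1 else s2"]) auto
qed

end

section \<open>The differential operator\<close>

lemma integrable_I01_iff:
  fixes f :: "real \<Rightarrow> 'a::euclidean_space"
  shows "integrable I01 f \<longleftrightarrow> f absolutely_integrable_on {0..1}"
  unfolding set_integrable_def by (rule integrable_restrict_space) simp

lemma L2_absint:
  assumes "f \<in> L2" shows "f absolutely_integrable_on {0..1}"
proof -
  interpret finite_measure I01 by (rule finite_I01)
  have "integrable I01 f"
  proof (rule Bochner_Integration.integrable_bound)
    show "integrable I01 (\<lambda>x. 1 + (norm (f x))\<^sup>2)" using L2D(3)[OF assms] by simp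
    have "norm (f x) \<le> 1 + (norm (f x))\<^sup>2" for x
      using sum_squares_bound[of 1 "norm (f x)"] norm_ge_zero[of "f x"]
      by (simp only: one_power2 mult_1_right)
    then show "AE x in I01. norm (f x) \<le> norm (1 + (norm (f x))\<^sup>2)" by simp
  qed (rule L2D(2)[OF assms])
  then show ?thesis by (simp add: integrable_I01_iff)
qed

text \<open>The variance of the modulus is nonnegative, and the interval has length 1.\<close>

lemma L1_le_L2_norm:
  assumes "f \<in> L2" shows "integral {0..1} (\<lambda>t. norm (f t)) \<le> L2_norm f"
proof -
  interpret finite_measure I01 by (rule finite_I01)
  have i1: "integrable I01 (\<lambda>t. norm (f t))"
    using L2_absint[OF assms] by (intro integrable_norm) (simp add: integrable_I01_iff)
  note i2 = L2D(3)[OF assms]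
  define a where "a = (LINT t|I01. norm (f t))"
  have a: "a = integral {0..1} (\<lambda>t. norm (f t))"
    unfolding a_def by (rule lebesgue_integral_eq_integral[OF i1]) simp
  have measI: "measure I01 (space I01) = 1" by (simp add: measure_restrict_space)
  have "0 \<le> (LINT t|I01. (norm (f t) - a)\<^sup>2)" by simp
  also have "\<dots> = (LINT t|I01. (norm (f t))\<^sup>2 - 2 * a * norm (f t) + a\<^sup>2)"
    by (simp add: power2_eq_square algebra_simps)
  also have "\<dots> = (LINT t|I01. (norm (f t))\<^sup>2) - 2 * a * a + a\<^sup>2"
    using i1 i2 measI by (simp add: a_def[symmetric])
  finally have "a\<^sup>2 \<le> (LINT t|I01. (norm (f t))\<^sup>2)" by (simp add: power2_eq_square)
  then show ?thesis unfolding a[symmetric] L2_norm_def by (rule real_le_rsqrt)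
qed

lemma continuous_L2:
  fixes y :: "real \<Rightarrow> complex^2"
  assumes y: "continuous_on {0..1} y" and 0: "\<And>x. x \<notin> {0..1} \<Longrightarrow> y x = 0"
  shows "y \<in> L2"
proof -
  have "(\<lambda>x. (norm (y x))\<^sup>2) absolutely_integrable_on {0..1}"
    by (intro absolutely_integrable_continuous_real continuous_intros y)
  moreover have "y \<in> borel_measurable I01"
    using y by (intro continuous_imp_measurable_on_sets_lebesgue) auto
  ultimately show ?thesis using 0 by (auto simp: L2_def integrable_I01_iff)
qed

lemma iB_L2:
  assumes "g \<in> L2" shows "(\<lambda>t. iB (g t)) \<in> L2"
proof (rule L2I_bound[OF _ _ L2D(3)[OF assms]])
  show "(\<lambda>t. iB (g t)) \<in> borel_measurable I01"
    using borel_measurable_continuous_onI[OF linear_continuous_on[OF linear_iB]] L2D(2)[OF assms]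
    by (rule measurable_compose[rotated])
  show "iB (g x) = 0" if "x \<notin> {0..1}" for x
    using L2D(1)[OF assms that] by (simp add: linear_simps(3)[OF linear_iB])
qed (simp add: norm_iB)

lemma LINT_initial_interval:
  fixes g :: "real \<Rightarrow> 'a::euclidean_space"
  assumes "g absolutely_integrable_on {0..1}" "x \<in> {0..1}"
  shows "(LINT t|lebesgue_on {0..x}. g t) = integral {0..x} g"
proof -
  have "g absolutely_integrable_on {0..x}"
    by (rule absolutely_integrable_on_subinterval[OF assms(1)]) (use assms(2) in auto)
  then have "integrable (lebesgue_on {0..x}) g"
    unfolding set_integrable_def by (subst integrable_restrict_space) auto
  then show ?thesis by (rule lebesgue_integral_eq_integral) simp
qed

lemma AE_I01_negligible:
  "(AE x in I01. P x) \<longleftrightarrow> (\<exists>N. negligible N \<and> (\<forall>x\<in>{0..1} - N. P x))"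
proof -
  have "(AE x in I01. P x) \<longleftrightarrow> (AE x in lebesgue. x \<in> {0..1} \<longrightarrow> P x)"
    by (rule AE_restrict_space_iff) simp
  also have "\<dots> \<longleftrightarrow> (\<exists>N. negligible N \<and> {x. \<not> (x \<in> {0..1} \<longrightarrow> P x)} \<subseteq> N)"
    by (rule eventually_ae_filter_negligible)
  finally show ?thesis by blast
qed

lemma boundary_condition_iff:
  "C *v y 0 + D *v y 1 = (0 :: complex^2) \<longleftrightarrow> bc (C $ 1) (D $ 1) y = 0 \<and> bc (C $ 2) (D $ 2) y = 0"
  by (simp add: vec_eq_iff forall_2 matrix_vector_mult_def sum_2 bc_def add_ac)

lemma differential_expression_iff:
  "f = (- \<i>) *s (B_mat *v y') + Q_mat P R x *v y \<longleftrightarrow> y' = dirac P R \<mu> x y + iB (f - \<mu> *s y)"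
proof -
  have *: "a = \<i> * b + c \<longleftrightarrow> b = - \<i> * (a - c)" "a = - \<i> * b + c \<longleftrightarrow> b = \<i> * (a - c)" for a b c :: complex
    by (safe, simp_all add: algebra_simps)
  have "f = (- \<i>) *s (B_mat *v y') + Q_mat P R x *v y \<longleftrightarrow>
      f $ 1 = \<i> * y' $ 1 + P x * y $ 2 \<and> f $ 2 = - \<i> * y' $ 2 + R x * y $ 1"
    by (simp add: vec_eq_iff forall_2 matrix_vector_mult_def sum_2 B_mat_def Q_mat_def add.commute)
  also have "\<dots> \<longleftrightarrow> y' $ 1 = - \<i> * (f $ 1 - P x * y $ 2) \<and> y' $ 2 = \<i> * (f $ 2 - R x * y $ 1)"
    unfolding * ..
  also have "\<dots> \<longleftrightarrow> y' = dirac P R \<mu> x y + iB (f - \<mu> *s y)"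
    by (simp add: vec_eq_iff forall_2 algebra_simps)
  finally show ?thesis .
qed

context potential
begin

text \<open>The dictionary between the operator graph and the integral equations. In one direction
  the almost-everywhere equality disappears under the integral; in the other a derivative is
  assembled from the right-hand side, extended by 0.\<close>

lemma op_shift_iff:
  "(y, g) \<in> op_shift (op_L C D (Q_mat P R)) \<mu> \<longleftrightarrow>
     g \<in> L2 \<and> (\<forall>x. x \<notin> {0..1} \<longrightarrow> y x = 0) \<and> bc (C $ 1) (D $ 1) y = 0 \<and> bc (C $ 2) (D $ 2) y = 0 \<and>
     dsys P R \<mu> (\<lambda>t. iB (g t)) y" (is "?l \<longleftrightarrow> ?r")
proof
  assume ?l
  then obtain f where fg: "g = f - cscale \<mu> y" and "(y, f) \<in> op_L C D (Q_mat P R)"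
    by (auto simp: op_shift_def)
  then obtain y' where f: "f \<in> L2" and BC: "C *v y 0 + D *v y 1 = 0" and W: "W12_derivative y y'"
    and ae: "AE x in I01. f x = (- \<i>) *s (B_mat *v y' x) + Q_mat P R x *v y x"
    by (auto simp: op_L_def)
  have y0: "\<And>x. x \<notin> {0..1} \<Longrightarrow> y x = 0" and y': "y' \<in> L2"
    and yint: "\<And>x. x \<in> {0..1} \<Longrightarrow> y x = y 0 + (LINT t|lebesgue_on {0..x}. y' t)"
    using W unfolding W12_derivative_def by blast+
  note y'a = L2_absint[OF y']
  have yint': "y x = y 0 + integral {0..x} y'" if "x \<in> {0..1}" for x
    using yint[OF that] LINT_initial_interval[OF y'a that] by simp
  have cy: "continuous_on {0..1} y"
  proof (rule continuous_on_eq)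
    show "continuous_on {0..1} (\<lambda>x. y 0 + integral {0..x} y')"
      using y'a by (intro continuous_intros indefinite_integral_continuous_1) (simp add: absolutely_integrable_on_def)
  qed (rule yint'[symmetric])
  have yL: "y \<in> L2" by (rule continuous_L2[OF cy y0])
  have gL: "g \<in> L2" unfolding fg by (intro diff_L2 cscale_L2 f yL)
  obtain N where N: "negligible N" "\<And>x. x \<in> {0..1} - N \<Longrightarrow> f x = (- \<i>) *s (B_mat *v y' x) + Q_mat P R x *v y x"
    using ae unfolding AE_I01_negligible by blast
  have yN: "y' x = dirac P R \<mu> x (y x) + iB (g x)" if "x \<in> {0..1} - N" for x
    using N(2)[OF that] unfolding differential_expression_iff[where \<mu> = \<mu>] fg by (simp add: cscale_def)
  have "y x = y 0 + integral {0..x} (\<lambda>t. dirac P R \<mu> t (y t) + iB (g t))" if x: "x \<in> {0..1}" for x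
  proof -
    have "integral {0..x} y' = integral {0..x} (\<lambda>t. dirac P R \<mu> t (y t) + iB (g t))"
      by (rule integral_spike[OF N(1)]) (use yN x in auto)
    then show ?thesis using yint'[OF x] by simp
  qed
  then have "dsys P R \<mu> (\<lambda>t. iB (g t)) y"
    unfolding dsys_def using cy L2_absint[OF iB_L2[OF gL]] by blast
  then show ?r using gL y0 BC unfolding boundary_condition_iff by blast
next
  assume r: ?r
  then have gL: "g \<in> L2" and y0: "\<And>x. x \<notin> {0..1} \<Longrightarrow> y x = 0" and S: "dsys P R \<mu> (\<lambda>t. iB (g t)) y"
    by blast+
  have yL: "y \<in> L2" by (rule continuous_L2[OF dsysD(1)[OF S] y0])
  define f where "f = g + cscale \<mu> y"
  have fL: "f \<in> L2" unfolding f_def by (intro add_L2 cscale_L2 gL yL)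
  define d where "d x = (if x \<in> {0..1} then dirac P R \<mu> x (y x) else 0)" for x
  have dL: "d \<in> L2"
  proof (rule continuous_L2)
    show "continuous_on {0..1} d"
      by (rule continuous_on_eq[OF continuous_on_dirac[OF dsysD(1)[OF S], of \<mu>]]) (simp add: d_def)
  qed (auto simp: d_def)
  define y' where "y' = d + (\<lambda>t. iB (g t))"
  have y'L: "y' \<in> L2" unfolding y'_def by (intro add_L2 dL iB_L2 gL)
  have y'x: "y' x = dirac P R \<mu> x (y x) + iB (g x)" if "x \<in> {0..1}" for x
    using that by (simp add: y'_def d_def)
  have "y x = y 0 + (LINT t|lebesgue_on {0..x}. y' t)" if x: "x \<in> {0..1}" for x
  proof -
    have "(LINT t|lebesgue_on {0..x}. y' t) = integral {0..x} (\<lambda>t. dirac P R \<mu> t (y t) + iB (g t))"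
      unfolding LINT_initial_interval[OF L2_absint[OF y'L] x]
      by (rule integral_cong) (use x y'x in auto)
    then show ?thesis using dsysD(3)[OF S x] by simp
  qed
  then have "W12_derivative y y'"
    unfolding W12_derivative_def using y0 y'L by blast
  moreover have "AE x in I01. f x = (- \<i>) *s (B_mat *v y' x) + Q_mat P R x *v y x"
  proof (rule AE_I2)
    fix x assume "x \<in> space I01"
    then have x: "x \<in> {0..1}" by simp
    show "f x = (- \<i>) *s (B_mat *v y' x) + Q_mat P R x *v y x"
      unfolding differential_expression_iff[where \<mu> = \<mu>] y'x[OF x] f_def by (simp add: cscale_def)
  qed
  ultimately have "(y, f) \<in> op_L C D (Q_mat P R)"
    using fL r unfolding op_L_def boundary_condition_iff by blast
  moreover have "g = f - cscale \<mu> y" by (simp add: f_def)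
  ultimately show ?l unfolding op_shift_def by blast
qed

end

lemma integral_zero_imp_AE_zero:
  fixes h :: "real \<Rightarrow> complex^2"
  assumes h: "h absolutely_integrable_on {0..1}" and 0: "\<And>x. x \<in> {0..1} \<Longrightarrow> integral {0..x} h = 0"
  shows "AE x in I01. h x = 0"
proof -
  define k where "k x = (if x \<in> {0..1} then h x else 0)" for x
  have hi: "h integrable_on {0..1}" using h by (simp add: absolutely_integrable_on_def)
  have "k integrable_on UNIV" using hi unfolding k_def[abs_def] by (simp only: integrable_restrict_UNIV)
  then have ki: "k integrable_on cbox a b" for a b by (rule integrable_on_subcbox) simp
  obtain N where N: "negligible N" "\<And>x e. x \<notin> N \<Longrightarrow> 0 < e \<Longrightarrow> \<exists>d>0. \<forall>s. 0 < s \<and> s < d \<longrightarrow>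
      norm (integral (cbox x (x + s *\<^sub>R One)) k /\<^sub>R s ^ DIM(real) - k x) < e"
    using integrable_ccontinuous_explicit[OF ki] by metis
  \<comment> \<open>The differentiation theorem is used with intervals to the right of the point, so
    the endpoint 1 is discarded together with the null set.\<close>
  have "h x = 0" if x: "x \<in> {0..1} - insert 1 N" for x
  proof (rule ccontr)
    assume "h x \<noteq> 0"
    then obtain d where d: "0 < d" "\<And>s. 0 < s \<Longrightarrow> s < d \<Longrightarrow> norm (integral (cbox x (x + s *\<^sub>R One)) k /\<^sub>R s ^ DIM(real) - k x) < norm (h x)"
      using N(2)[of x "norm (h x)"] x by auto
    define s where "s = min (d / 2) (1 - x)"
    have s: "0 < s" "s < d" "x + s \<le> 1" using d(1) x by (auto simp: s_def)
    have "integral {x..x + s} k = integral {x..x + s} h"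
      by (rule integral_cong) (use x s in \<open>auto simp: k_def\<close>)
    also have "\<dots> = 0"
      using integral_diff_Icc[OF hi, of x "x + s"] 0[of x] 0[of "x + s"] x s by auto
    finally show False using d(2)[OF s(1,2)] x by (simp add: k_def)
  qed
  moreover have "negligible (insert 1 N)" using N(1) by simp
  ultimately show ?thesis unfolding AE_I01_negligible by blast
qed

section \<open>The operator, its root subspaces and completeness\<close>

locale dirac_operator = bvp P R "C $ 1" "D $ 1" "C $ 2" "D $ 2"
  for P R :: "real \<Rightarrow> complex" and C D :: "complex^2^2"
begin

abbreviation "L \<equiv> op_L C D (Q_mat P R)"
abbreviation "T \<mu> \<equiv> op_shift L \<mu>"

lemma T_L2: "(y, g) \<in> T \<mu> \<Longrightarrow> y \<in> L2 \<and> g \<in> L2"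
  unfolding op_shift_iff by (metis continuous_L2 dsysD(1))

lemma T_lincomb:
  assumes "(y, g) \<in> T \<mu>" "(y', g') \<in> T \<mu>"
  shows "(y + cscale c y', g + cscale c g') \<in> T \<mu>"
proof -
  note A = assms[unfolded op_shift_iff]
  have S: "dsys P R \<mu> (\<lambda>t. iB (g t)) y" "dsys P R \<mu> (\<lambda>t. iB (g' t)) y'" using A by blast+
  have "dsys P R \<mu> (\<lambda>t. iB ((g + cscale c g') t)) (y + cscale c y')"
    by (rule dsys_cong[OF dsys_lincomb[OF S, of c]]) (auto intro!: complex2_eqI simp: cscale_def algebra_simps)
  moreover have "bc a b (y + cscale c y') = bc a b y + c * bc a b y'" for a b
    by (simp add: bc_def cscale_def algebra_simps)
  moreover have "\<forall>x. x \<notin> {0..1} \<longrightarrow> (y + cscale c y') x = 0" using A by (simp add: cscale_def)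
  moreover have "g + cscale c g' \<in> L2" using A by (blast intro: add_L2 cscale_L2)
  ultimately show ?thesis using A unfolding op_shift_iff by simp
qed

lemma T_zero: "(0, 0) \<in> T \<mu>"
  unfolding op_shift_iff using zero_L2 dsys_zero by (simp add: bc_def zero_fun_def)

lemma Tpow_zero: "(0, 0) \<in> T \<mu> ^^ k"
proof (induction k)
  case (Suc k)
  show ?case by (rule relpow_Suc_I[OF Suc T_zero])
qed simp

lemma Tpow_lincomb:
  "(y, g) \<in> T \<mu> ^^ k \<Longrightarrow> (y', g') \<in> T \<mu> ^^ k \<Longrightarrow> (y + cscale c y', g + cscale c g') \<in> T \<mu> ^^ k"
proof (induction k arbitrary: y g y' g')
  case (Suc k)
  obtain z where z: "(y, z) \<in> T \<mu>" "(z, g) \<in> T \<mu> ^^ k" using Suc.prems(1) by (blast dest: relpow_Suc_D2)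
  obtain z' where z': "(y', z') \<in> T \<mu>" "(z', g') \<in> T \<mu> ^^ k" using Suc.prems(2) by (blast dest: relpow_Suc_D2)
  show ?case by (rule relpow_Suc_I2[OF T_lincomb[OF z(1) z'(1)] Suc.IH[OF z(2) z'(2)]])
qed simp

lemma cscale_1: "cscale 1 y = y" and cscale_zero: "cscale c 0 = 0"
  by (simp_all add: cscale_def fun_eq_iff)

lemma ker_mono: "j \<le> k \<Longrightarrow> op_ker (T \<mu> ^^ j) \<subseteq> op_ker (T \<mu> ^^ k)"
proof (induction k)
  case (Suc k)
  have "op_ker (T \<mu> ^^ k) \<subseteq> op_ker (T \<mu> ^^ Suc k)"
    unfolding op_ker_def by (auto intro: relpow_Suc_I T_zero)
  then show ?case using Suc by (cases "j = Suc k") auto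
qed simp

text \<open>The kernels of the powers increase, so their union is already a subspace and taking the
  span adds nothing.\<close>

lemma root_subspace_eq: "root_subspace L \<mu> = (\<Union>k. op_ker (T \<mu> ^^ k))"
proof -
  have "cfun.subspace (\<Union>k. op_ker (T \<mu> ^^ k))"
    unfolding cfun.subspace_def
  proof (intro conjI ballI allI)
    show "0 \<in> (\<Union>k. op_ker (T \<mu> ^^ k))" using Tpow_zero[of 0 \<mu>] unfolding op_ker_def by blast
    show "x + y \<in> (\<Union>k. op_ker (T \<mu> ^^ k))" if xy: "x \<in> (\<Union>k. op_ker (T \<mu> ^^ k))" "y \<in> (\<Union>k. op_ker (T \<mu> ^^ k))" for x y
    proof -
      obtain j k where jk: "x \<in> op_ker (T \<mu> ^^ j)" "y \<in> op_ker (T \<mu> ^^ k)" using xy by blast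
      have "(x, 0) \<in> T \<mu> ^^ max j k" "(y, 0) \<in> T \<mu> ^^ max j k"
        using ker_mono[of j "max j k" \<mu>] ker_mono[of k "max j k" \<mu>] jk by (auto simp: op_ker_def)
      from Tpow_lincomb[OF this, of 1] show ?thesis by (auto simp: op_ker_def cscale_1 cscale_zero)
    qed
    show "cscale c x \<in> (\<Union>k. op_ker (T \<mu> ^^ k))" if x: "x \<in> (\<Union>k. op_ker (T \<mu> ^^ k))" for c x
    proof -
      obtain k where "(x, 0) \<in> T \<mu> ^^ k" using x by (auto simp: op_ker_def)
      from Tpow_lincomb[OF Tpow_zero this, of c] show ?thesis by (auto simp: op_ker_def cscale_zero)
    qed
  qed
  then show ?thesis unfolding root_subspace_def by (simp add: cfun.span_eq_iff)
qed

lemma root_chain_iff: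
  "root_chain \<mu> p n \<longleftrightarrow> (\<forall>k\<le>n. (p k, case k of 0 \<Rightarrow> 0 | Suc j \<Rightarrow> p j) \<in> T \<mu>)"
proof
  assume r: "root_chain \<mu> p n"
  note D = r[unfolded root_chain_def, rule_format]
  have pL: "p k \<in> L2" if "k \<le> n" for k
    using continuous_L2 dsysD(1) D[OF that] by blast
  show "\<forall>k\<le>n. (p k, case k of 0 \<Rightarrow> 0 | Suc j \<Rightarrow> p j) \<in> T \<mu>"
  proof (intro allI impI)
    fix k assume k: "k \<le> n"
    have "(case k of 0 \<Rightarrow> 0 | Suc j \<Rightarrow> p j) \<in> L2" using zero_L2 pL k by (cases k) auto
    moreover have "(\<lambda>t. iB ((case k of 0 \<Rightarrow> 0 | Suc j \<Rightarrow> p j) t)) = (case k of 0 \<Rightarrow> (\<lambda>_. 0) | Suc j \<Rightarrow> (\<lambda>t. iB (p j t)))"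
      by (cases k) auto
    ultimately show "(p k, case k of 0 \<Rightarrow> 0 | Suc j \<Rightarrow> p j) \<in> T \<mu>"
      unfolding op_shift_iff using D[OF k] by presburger
  qed
next
  assume a: "\<forall>k\<le>n. (p k, case k of 0 \<Rightarrow> 0 | Suc j \<Rightarrow> p j) \<in> T \<mu>"
  show "root_chain \<mu> p n"
    unfolding root_chain_def
  proof (intro allI impI)
    fix k assume "k \<le> n"
    with a have H: "(p k, case k of 0 \<Rightarrow> 0 | Suc j \<Rightarrow> p j) \<in> T \<mu>" by blast
    have e: "(\<lambda>t. iB ((case k of 0 \<Rightarrow> 0 | Suc j \<Rightarrow> p j) t)) = (case k of 0 \<Rightarrow> (\<lambda>_. 0) | Suc j \<Rightarrow> (\<lambda>t. iB (p j t)))"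
      by (cases k) auto
    show "dsys P R \<mu> (case k of 0 \<Rightarrow> (\<lambda>_. 0) | Suc j \<Rightarrow> (\<lambda>t. iB (p j t))) (p k) \<and>
      U1 (p k) = 0 \<and> U2 (p k) = 0 \<and> (\<forall>x. x \<notin> {0..1} \<longrightarrow> p k x = 0)"
      using H[unfolded op_shift_iff e] by blast
  qed
qed

lemma root_chain_relpow:
  assumes "root_chain \<mu> p n" shows "(p n, p 0) \<in> T \<mu> ^^ n" "p n \<in> op_ker (T \<mu> ^^ Suc n)"
proof -
  have "k \<le> n \<Longrightarrow> (p k, p 0) \<in> T \<mu> ^^ k" for k
  proof (induction k)
    case (Suc k)
    have "(p (Suc k), p k) \<in> T \<mu>" using assms Suc.prems unfolding root_chain_iff by (metis nat.case(2))
    then show ?case using Suc by (intro relpow_Suc_I2) auto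
  qed simp
  then show 1: "(p n, p 0) \<in> T \<mu> ^^ n" by blast
  have "(p 0, 0) \<in> T \<mu>" using assms unfolding root_chain_iff by (metis nat.case(1) le0)
  with 1 show "p n \<in> op_ker (T \<mu> ^^ Suc n)" unfolding op_ker_def by (auto intro: relpow_Suc_I)
qed

text \<open>The chain is read off from the relational power by peeling one application after
  another, with \<open>y\<close> at the top.\<close>

lemma ker_imp_root_chain:
  "y \<in> op_ker (T \<mu> ^^ Suc n) \<Longrightarrow> \<exists>p. root_chain \<mu> p n \<and> p n = y"
proof (induction n arbitrary: y)
  case 0
  then show ?case unfolding root_chain_iff op_ker_def by (intro exI[of _ "\<lambda>_. y"]) auto
next
  case (Suc n)
  then obtain z where z: "(y, z) \<in> T \<mu>" "z \<in> op_ker (T \<mu> ^^ Suc n)"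
    unfolding op_ker_def by (blast dest: relpow_Suc_D2)
  obtain p where p: "root_chain \<mu> p n" "p n = z" using Suc.IH[OF z(2)] by blast
  have "root_chain \<mu> (p(Suc n := y)) (Suc n)"
    unfolding root_chain_iff
  proof (intro allI impI)
    fix k assume k: "k \<le> Suc n"
    show "((p(Suc n := y)) k, case k of 0 \<Rightarrow> 0 | Suc j \<Rightarrow> (p(Suc n := y)) j) \<in> T \<mu>"
    proof (cases "k = Suc n")
      case True
      then show ?thesis using z(1) p(2) by simp
    next
      case False
      then have "k \<le> n" using k by simp
      then have "(p k, case k of 0 \<Rightarrow> 0 | Suc j \<Rightarrow> p j) \<in> T \<mu>" using p(1) unfolding root_chain_iff by blast
      then show ?thesis using False k by (cases k) auto
    qed
  qed
  then show ?case by (intro exI[of _ "p(Suc n := y)"] conjI fun_upd_same)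
qed

lemma root_subspace_L2: "root_subspace L \<mu> \<subseteq> L2"
proof
  fix y assume "y \<in> root_subspace L \<mu>"
  then obtain k where k: "y \<in> op_ker (T \<mu> ^^ k)" unfolding root_subspace_eq by blast
  show "y \<in> L2"
  proof (cases k)
    case 0
    then show ?thesis using k zero_L2 by (simp add: op_ker_def)
  next
    case (Suc n)
    then obtain z where "(y, z) \<in> T \<mu>" using k unfolding op_ker_def by (blast dest: relpow_Suc_D2)
    then show ?thesis using T_L2 by blast
  qed
qed

text \<open>Root chains are considered at every complex number; this disposes of those that do not
  belong to an eigenvalue.\<close>

lemma not_eigenvalue:
  assumes "\<mu> \<notin> eigenvalues L" shows "y \<in> op_ker (T \<mu> ^^ k) \<Longrightarrow> y = 0"
proof (induction k)
  case 0
  then show ?case by (simp add: op_ker_def)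
next
  case (Suc k)
  then obtain z where "(y, z) \<in> T \<mu> ^^ k" "(z, 0) \<in> T \<mu>" unfolding op_ker_def by (blast elim: relpow_Suc_E)
  moreover from this have "z = 0" using assms unfolding eigenvalues_def op_ker_def by blast
  ultimately have "y \<in> op_ker (T \<mu> ^^ k)" unfolding op_ker_def by blast
  then show ?case by (rule Suc.IH)
qed

lemma root_function_system_L2:
  assumes "root_function_system L S" shows "S \<subseteq> L2"
proof -
  obtain b where b: "\<And>\<mu>. \<mu> \<in> eigenvalues L \<Longrightarrow> cfun.span (b \<mu>) = root_subspace L \<mu>"
    and S: "S = (\<Union>\<mu>\<in>eigenvalues L. b \<mu>)"
    using assms unfolding root_function_system_def by blast
  have "b \<mu> \<subseteq> L2" if "\<mu> \<in> eigenvalues L" for \<mu>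
    using cfun.span_superset[of "b \<mu>"] root_subspace_L2[of \<mu>] unfolding b[OF that] by (rule order_trans)
  then show ?thesis unfolding S by blast
qed

theorem root_functions_complete:
  assumes S: "root_function_system L S"
  shows "complete_system S"
proof -
  obtain b where b: "\<And>\<mu>. \<mu> \<in> eigenvalues L \<Longrightarrow> cfun.span (b \<mu>) = root_subspace L \<mu>"
    and Sb: "S = (\<Union>\<mu>\<in>eigenvalues L. b \<mu>)"
    using S unfolding root_function_system_def by blast
  note SL = root_function_system_L2[OF S]
  have chainS: "p n \<in> cfun.span S" if "root_chain \<mu> p n" for \<mu> p n
  proof (cases "\<mu> \<in> eigenvalues L")
    case True
    have "p n \<in> root_subspace L \<mu>" using root_chain_relpow(2)[OF that] unfolding root_subspace_eq by blast
    then have "p n \<in> cfun.span (b \<mu>)" using b[OF True] by simp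
    moreover have "cfun.span (b \<mu>) \<subseteq> cfun.span S" by (rule cfun.span_mono) (use Sb True in blast)
    ultimately show ?thesis by blast
  next
    case False
    then have "p n = 0" using not_eigenvalue root_chain_relpow(2)[OF that] by blast
    then show ?thesis by (simp add: cfun.span_zero)
  qed
  have "L2_closure (cfun.span S) = L2"
  proof (rule L2_closure_eqI)
    show "cfun.subspace (cfun.span S)" by (rule cfun.subspace_span)
    show WL: "cfun.span S \<subseteq> L2" by (rule cfun.span_minimal[OF SL subspace_L2])
    fix h assume h: "h \<in> L2" and orth: "\<And>s. s \<in> cfun.span S \<Longrightarrow> ip h s = 0"
    \<comment> \<open>Conjugating \<open>h\<close> turns Hermitian orthogonality into the vanishing
      of the bilinear pairing.\<close>
    define cv where "cv z = (vector [cnj (z $ 1), cnj (z $ 2)] :: complex^2)" for z :: "complex^2"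
    have cv: "cv z $ 1 = cnj (z $ 1)" "cv z $ 2 = cnj (z $ 2)" for z by (simp_all add: cv_def)
    have cvlin: "bounded_linear cv"
      by (rule bounded_linear_intro[where K = 1])
        (auto intro!: complex2_eqI simp: cv norm_vec_def L2_set_def sum_2)
    have ha: "(\<lambda>t. cv (h t)) absolutely_integrable_on {0..1}"
      using absolutely_integrable_linear[OF L2_absint[OF h] cvlin] by (simp add: comp_def)
    have pair: "pairing (\<lambda>t. cv (h t)) s = 0" if s: "s \<in> cfun.span S" "continuous_on {0..1} s" for s
    proof -
      let ?f = "\<lambda>t. cv (h t) $ 1 * s t $ 1 + cv (h t) $ 2 * s t $ 2"
      have sL: "s \<in> L2" using s WL by blast
      \<comment> \<open>The imaginary part of the pairing with \<open>s\<close> is the real product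
        of \<open>h\<close> with -i s, which stays in the span.\<close>
      have iS: "cscale (- \<i>) s \<in> cfun.span S" by (rule cfun.span_scale[OF s(1)])
      have fi: "?f integrable_on {0..1}"
        using pairing_absint[OF ha s(2)] by (simp add: absolutely_integrable_on_def)
      have ipi: "ip h u = integral {0..1} (\<lambda>t. h t \<bullet> u t)" if "u \<in> L2" for u
        unfolding ip_def by (rule lebesgue_integral_eq_integral[OF inner_integrable[OF h that]]) simp
      have "Re (pairing (\<lambda>t. cv (h t)) s) = integral {0..1} (Re \<circ> ?f)"
        unfolding pairing_def using integral_linear[OF fi bounded_linear_Re] by simp
      also have "Re \<circ> ?f = (\<lambda>t. h t \<bullet> s t)"
        by (simp add: fun_eq_iff cv inner_vec_def sum_2 inner_complex_def)
      finally have re: "Re (pairing (\<lambda>t. cv (h t)) s) = 0"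
        using ipi[OF sL] orth[OF s(1)] by simp
      have "Im (pairing (\<lambda>t. cv (h t)) s) = integral {0..1} (Im \<circ> ?f)"
        unfolding pairing_def using integral_linear[OF fi bounded_linear_Im] by simp
      also have "Im \<circ> ?f = (\<lambda>t. h t \<bullet> cscale (- \<i>) s t)"
        by (simp add: fun_eq_iff cv inner_vec_def sum_2 inner_complex_def cscale_def)
      also have "integral {0..1} \<dots> = ip h (cscale (- \<i>) s)" by (rule ipi[OF cscale_L2[OF sL], symmetric])
      finally have im: "Im (pairing (\<lambda>t. cv (h t)) s) = 0" unfolding orth[OF iS] .
      show ?thesis using re im by (simp add: complex_eq_iff)
    qed
    have "annihilates (pairing (\<lambda>t. cv (h t)))"
      unfolding annihilates_def
    proof (intro allI impI)
      fix z p n assume c: "root_chain z p n"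
      have "continuous_on {0..1} (p n)"
        by (rule dsysD(1)[OF conjunct1[OF c[unfolded root_chain_def, rule_format, OF order_refl]]])
      then show "pairing (\<lambda>t. cv (h t)) (p n) = 0" by (rule pair[OF chainS[OF c]])
    qed
    from orthogonal_to_root_chains[OF ha this]
    have "AE x in I01. cv (h x) = 0" by (rule integral_zero_imp_AE_zero[OF ha])
    then show "AE x in I01. h x = 0"
    proof eventually_elim
      case (elim x)
      then have "cnj (h x $ 1) = 0" "cnj (h x $ 2) = 0" using cv[of "h x"] by simp_all
      then show ?case by (intro complex2_eqI) simp_all
    qed
  qed
  then show ?thesis using SL by (simp add: complete_system_def)
qed

section \<open>Taylor coefficients as dual functionals, and minimality\<close>

lemma \<eta>_derivative_lincomb:
  assumes "u \<in> L2" "v \<in> L2"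
  shows "(deriv ^^ k) (\<eta> i (u + cscale c v)) \<mu> = (deriv ^^ k) (\<eta> i u) \<mu> + c * (deriv ^^ k) (\<eta> i v) \<mu>"
proof -
  note h = \<eta>_entire[OF L2_absint[OF assms(1)], of i] \<eta>_entire[OF L2_absint[OF assms(2)], of i]
  have "\<eta> i (u + cscale c v) = (\<lambda>l. \<eta> i u l + c * \<eta> i v l)"
    using \<eta>_lincomb[OF L2_absint[OF assms(1)] L2_absint[OF assms(2)]]
    by (simp add: fun_eq_iff cscale_def plus_fun_def)
  then have "(deriv ^^ k) (\<eta> i (u + cscale c v)) \<mu> = (deriv ^^ k) (\<eta> i u) \<mu> + (deriv ^^ k) (\<lambda>l. c * \<eta> i v l) \<mu>"
    using higher_deriv_add[OF h(1) holomorphic_on_mult[OF holomorphic_on_const h(2)] open_UNIV UNIV_I] by simp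
  then show ?thesis unfolding higher_deriv_cmult[OF h(2) UNIV_I open_UNIV] .
qed

text \<open>Cauchy's inequality on the unit circle around \<mu> transfers the locally uniform bound
  to the derivatives.\<close>

lemma \<eta>_derivative_bound:
  "\<exists>K\<ge>0. \<forall>u\<in>L2. norm ((deriv ^^ k) (\<eta> i u) \<mu>) \<le> K * L2_norm u"
proof -
  obtain K where K: "\<And>g l. g absolutely_integrable_on {0..1} \<Longrightarrow> norm (l - \<mu>) \<le> 1 \<Longrightarrow>
     norm (\<eta> i g l) \<le> K * integral {0..1} (\<lambda>t. norm (g t))"
    using \<eta>_bound by blast
  have "norm ((deriv ^^ k) (\<eta> i u) \<mu>) \<le> (fact k * max 0 K) * L2_norm u" if u: "u \<in> L2" for u
  proof -
    note a = L2_absint[OF u]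
    have "norm ((deriv ^^ k) (\<eta> i u) \<mu>) \<le> fact k * (max 0 K * L2_norm u) / 1 ^ k"
    proof (rule Cauchy_inequality)
      show "\<eta> i u holomorphic_on ball \<mu> 1" by (rule holomorphic_on_subset[OF \<eta>_entire[OF a]]) simp
      show "continuous_on (cball \<mu> 1) (\<eta> i u)"
        by (rule holomorphic_on_imp_continuous_on[OF holomorphic_on_subset[OF \<eta>_entire[OF a]]]) simp
      fix l assume "norm (\<mu> - l) = 1"
      then have "norm (\<eta> i u l) \<le> K * integral {0..1} (\<lambda>t. norm (u t))"
        by (intro K a) (simp add: norm_minus_commute)
      also have "\<dots> \<le> max 0 K * L2_norm u"
        using L1_le_L2_norm[OF u] a
        by (intro mult_mono) (auto intro: integral_nonneg simp: absolutely_integrable_on_def)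
      finally show "norm (\<eta> i u l) \<le> max 0 K * L2_norm u" .
    qed simp
    then show ?thesis by (simp add: mult.assoc)
  qed
  then show ?thesis by (intro exI[of _ "fact k * max 0 K"]) auto
qed

text \<open>Near \<mu> the power of \<mu>' - l is invertible, so \<eta> is a holomorphic multiple of
  \<Delta> there and inherits its order of vanishing.\<close>

lemma \<eta>_derivative_other_root:
  assumes y: "y \<in> op_ker (T \<mu>' ^^ k)" and ne: "\<mu>' \<noteq> \<mu>"
    and g: "g holomorphic_on UNIV" "\<And>w. \<Delta> w = (w - \<mu>) ^ m * g w" and j: "j < m"
  shows "(deriv ^^ j) (\<eta> i y) \<mu> = 0"
proof -
  \<comment> \<open>Passing to \<open>Suc k\<close> also covers \<open>k = 0\<close>: root chains
    have at least one member.\<close>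
  have "y \<in> op_ker (T \<mu>' ^^ Suc k)" using y ker_mono[of k "Suc k" \<mu>'] by auto
  then obtain p where p: "root_chain \<mu>' p k" "p k = y" using ker_imp_root_chain by blast
  have ya: "y absolutely_integrable_on {0..1}"
    using y root_subspace_L2 L2_absint unfolding root_subspace_eq by blast
  obtain s where s: "\<And>i. s i holomorphic_on UNIV" "\<And>i l. (\<mu>' - l) ^ Suc k * \<eta> i y l = s i l * \<Delta> l"
    using \<eta>_root_chain[OF p(1)] p(2) by blast
  define f where "f w = s i w * g w / (\<mu>' - w) ^ Suc k" for w
  have "isCont (s i) \<mu>" "isCont g \<mu>"
    using s(1) g(1) holomorphic_on_imp_continuous_on continuous_on_eq_continuous_at by blast+
  then have "(f \<longlongrightarrow> s i \<mu> * g \<mu> / (\<mu>' - \<mu>) ^ Suc k) (at \<mu>)"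
    unfolding f_def by (intro tendsto_intros) (use ne in \<open>auto simp: isCont_def\<close>)
  from order_tendstoD(2)[OF tendsto_norm[OF this] less_add_one]
  have "\<forall>\<^sub>F w in at \<mu>. norm (\<eta> i y w) \<le> (norm (s i \<mu> * g \<mu> / (\<mu>' - \<mu>) ^ Suc k) + 1) * norm (w - \<mu>) ^ m"
    using eventually_neq_at_within[of \<mu>' \<mu> UNIV]
  proof eventually_elim
    case (elim w)
    have "\<eta> i y w = f w * (w - \<mu>) ^ m"
      using s(2)[of w i] elim(2) by (simp add: f_def g(2) field_simps)
    then show ?case using elim(1) by (simp add: norm_mult norm_power mult_right_mono)
  qed
  then have "\<exists>K. \<forall>\<^sub>F w in at \<mu>. norm (\<eta> i y w) \<le> K * norm (w - \<mu>) ^ m" by blast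
  then show ?thesis using vanishing_derivatives_iff[OF \<eta>_entire[OF ya, of i], of m \<mu>] j by blast
qed

text \<open>Vanishing to order \<open>m\<close> forces the leading coefficient of the resolvent
  identity at \<mu> to be 0. Then the eigenvector ending the chain has initial value 0 and vanishes
  by uniqueness, the chain is one step shorter, and induction applies.\<close>

lemma \<eta>_derivative_injective:
  assumes g: "g holomorphic_on UNIV" "\<And>w. \<Delta> w = (w - \<mu>) ^ m * g w" "g \<mu> \<noteq> 0"
  shows "y \<in> op_ker (T \<mu> ^^ k) \<Longrightarrow> (\<And>i j. j < m \<Longrightarrow> (deriv ^^ j) (\<eta> i y) \<mu> = 0) \<Longrightarrow> y = 0"
proof (induction k)
  case 0
  then show ?case by (simp add: op_ker_def)
next
  case (Suc n)
  obtain p where p: "root_chain \<mu> p n" "p n = y" using ker_imp_root_chain[OF Suc.prems(1)] by blast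
  have ya: "y absolutely_integrable_on {0..1}"
    using Suc.prems(1) root_subspace_L2 L2_absint unfolding root_subspace_eq by blast
  obtain s where s: "\<And>i. s i holomorphic_on UNIV" "\<And>i l. (\<mu> - l) ^ Suc n * \<eta> i y l = s i l * \<Delta> l"
    "norm (s True \<mu>) = norm (p 0 0 $ 1)" "norm (s False \<mu>) = norm (p 0 0 $ 2)"
    using \<eta>_root_chain[OF p(1)] p(2) by blast
  have s0: "s i \<mu> = 0" for i
  proof -
    obtain K where K: "\<forall>\<^sub>F w in at \<mu>. norm (\<eta> i y w) \<le> K * norm (w - \<mu>) ^ m"
      using vanishing_derivatives_iff[OF \<eta>_entire[OF ya, of i], of m \<mu>] Suc.prems(2) by blast
    have "isCont (s i) \<mu>" "isCont g \<mu>"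
      using s(1) g(1) holomorphic_on_imp_continuous_on continuous_on_eq_continuous_at by blast+
    then have lim: "((\<lambda>w. norm (s i w * g w)) \<longlongrightarrow> norm (s i \<mu> * g \<mu>)) (at \<mu>)"
      by (intro tendsto_intros) (auto simp: isCont_def)
    have lim0: "((\<lambda>w. K * norm (w - \<mu>) ^ Suc n) \<longlongrightarrow> K * norm (\<mu> - \<mu>) ^ Suc n) (at \<mu>)"
      by (intro tendsto_intros)
    have "\<forall>\<^sub>F w in at \<mu>. norm (s i w * g w) \<le> K * norm (w - \<mu>) ^ Suc n"
      using K eventually_neq_at_within[of \<mu> \<mu> UNIV]
    proof eventually_elim
      case (elim w)
      have "norm (w - \<mu>) ^ m * norm (s i w * g w) = norm (s i w * \<Delta> w)"
        by (simp add: g(2) norm_mult norm_power mult_ac)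
      also have "\<dots> = norm (w - \<mu>) ^ Suc n * norm (\<eta> i y w)"
        unfolding s(2)[symmetric] by (simp add: norm_mult norm_power norm_minus_commute)
      also have "\<dots> \<le> norm (w - \<mu>) ^ Suc n * (K * norm (w - \<mu>) ^ m)"
        using elim(1) by (intro mult_left_mono) auto
      finally have "norm (w - \<mu>) ^ m * norm (s i w * g w) \<le> norm (w - \<mu>) ^ m * (K * norm (w - \<mu>) ^ Suc n)"
        by (simp add: mult_ac)
      then show ?case using elim(2) by (simp add: mult_le_cancel_left)
    qed
    from tendsto_le[OF _ lim0 lim this] have "norm (s i \<mu> * g \<mu>) \<le> K * norm (\<mu> - \<mu>) ^ Suc n" by simp
    then show ?thesis using g(3) by simp
  qed
  have p00: "p 0 0 = 0" by (rule complex2_eqI) (use s(3,4) s0 in simp_all)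
  have p0: "dsys P R \<mu> (\<lambda>_. 0) (p 0)" "\<And>x. x \<notin> {0..1} \<Longrightarrow> p 0 x = 0"
    using p(1)[unfolded root_chain_def, rule_format, of 0] by simp_all
  have "p 0 = 0"
  proof
    fix x
    show "p 0 x = 0 x"
    proof (cases "x \<in> {0..1}")
      case True
      show ?thesis using dsys_unique[OF p0(1) dsys_zero _ True] p00 by simp
    next
      case False
      then show ?thesis using p0(2) by simp
    qed
  qed
  then have "y \<in> op_ker (T \<mu> ^^ n)"
    using root_chain_relpow(1)[OF p(1)] p(2) by (simp add: op_ker_def)
  then show ?case by (rule Suc.IH) (rule Suc.prems(2))
qed

text \<open>Finitely many coefficients are injective on the root subspace, so independence of the
  basis becomes separation by a finite combination that is continuous on L2 and zero on all other
  elements of the system.\<close>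

theorem root_functions_minimal:
  assumes S: "root_function_system L S"
  shows "minimal_system S"
proof -
  obtain b where b: "\<And>\<mu>. \<mu> \<in> eigenvalues L \<Longrightarrow> cfun.span (b \<mu>) = root_subspace L \<mu>"
    and ind: "\<And>\<mu>. \<mu> \<in> eigenvalues L \<Longrightarrow> cfun.independent (b \<mu>)"
    and Sb: "S = (\<Union>\<mu>\<in>eigenvalues L. b \<mu>)"
    using S unfolding root_function_system_def by blast
  note SL = root_function_system_L2[OF S]
  have "f \<notin> L2_closure (cfun.span (S - {f}))" if f: "f \<in> S" for f
  proof
    assume cl: "f \<in> L2_closure (cfun.span (S - {f}))"
    obtain \<mu> where \<mu>: "\<mu> \<in> eigenvalues L" "f \<in> b \<mu>" using f Sb by blast
    have fL: "f \<in> L2" using f SL by blast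
    have br: "b \<mu>' \<subseteq> root_subspace L \<mu>'" if "\<mu>' \<in> eigenvalues L" for \<mu>'
      using b[OF that] cfun.span_superset by blast
    obtain l0 where "\<Delta> l0 \<noteq> 0" using \<Delta>_nonzero by blast
    then obtain g m where g: "g holomorphic_on UNIV" "\<And>w. \<Delta> w = (w - \<mu>) ^ m * g w" "g \<mu> \<noteq> 0"
      using holomorphic_zero_factor_global[OF \<Delta>_entire(1)] by metis
    define I where "I = (UNIV :: bool set) \<times> {..<m}"
    define N where "N q u = (deriv ^^ snd q) (\<eta> (fst q) u) \<mu>" for q u
    define U where "U = cfun.span (b \<mu> - {f})"
    have Uroot: "U \<subseteq> root_subspace L \<mu>"
      unfolding U_def b[OF \<mu>(1), symmetric] by (rule cfun.span_mono) blast
    \<comment> \<open>Equal coefficients would make f - u vanish by injectivity, and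
      \<open>f\<close> would lie in the span of the other basis elements.\<close>
    have sep: "\<not> (\<exists>u\<in>U. \<forall>q\<in>I. N q u = N q f)"
    proof
      assume "\<exists>u\<in>U. \<forall>q\<in>I. N q u = N q f"
      then obtain u where u: "u \<in> U" "\<And>q. q \<in> I \<Longrightarrow> N q u = N q f" by blast
      have ur: "u \<in> root_subspace L \<mu>" using u Uroot by blast
      then have uL: "u \<in> L2" using root_subspace_L2 by blast
      have "f + cscale (- 1) u \<in> root_subspace L \<mu>"
        unfolding b[OF \<mu>(1), symmetric]
        by (intro cfun.span_add cfun.span_scale) (use ur b[OF \<mu>(1)] \<mu>(2) cfun.span_base in auto)
      then obtain k where k: "f + cscale (- 1) u \<in> op_ker (T \<mu> ^^ k)" unfolding root_subspace_eq by blast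
      have "f + cscale (- 1) u = 0"
      proof (rule \<eta>_derivative_injective[OF g k])
        fix i j assume "j < m"
        then have "(i, j) \<in> I" by (simp add: I_def)
        from u(2)[OF this] show "(deriv ^^ j) (\<eta> i (f + cscale (- 1) u)) \<mu> = 0"
          unfolding \<eta>_derivative_lincomb[OF fL uL] by (simp add: N_def)
      qed
      then have "f = u" by (simp add: cscale_minus1)
      then have "f \<in> cfun.span (b \<mu> - {f})" using u(1) by (simp add: U_def)
      then show False using ind[OF \<mu>(1)] \<mu>(2) unfolding cfun.dependent_def by blast
    qed
    have lin: "N q (u + cscale c v) = N q u + c * N q v" if "u \<in> L2" "v \<in> L2" for q u v c
      unfolding N_def by (rule \<eta>_derivative_lincomb[OF that])
    have "\<exists>c. (\<forall>u\<in>U. (\<Sum>q\<in>I. c q * N q u) = 0) \<and> (\<Sum>q\<in>I. c q * N q f) = 1"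
    proof (rule separating_combination[OF _ lin _ _ fL sep])
      show "finite I" by (simp add: I_def)
      show "cfun.subspace U" unfolding U_def by (rule cfun.subspace_span)
      show "U \<subseteq> L2" using Uroot root_subspace_L2 by blast
    qed
    then obtain c where c: "\<And>u. u \<in> U \<Longrightarrow> (\<Sum>q\<in>I. c q * N q u) = 0" "(\<Sum>q\<in>I. c q * N q f) = 1" by blast
    define \<Lambda> where "\<Lambda> u = (\<Sum>q\<in>I. c q * N q u)" for u
    have \<Lambda>lin: "\<Lambda> (u + cscale a v) = \<Lambda> u + a * \<Lambda> v" if "u \<in> L2" "v \<in> L2" for u v a
      unfolding \<Lambda>_def by (simp add: lin[OF that] sum.distrib sum_distrib_left algebra_simps)
    have \<Lambda>S: "\<Lambda> s = 0" if s: "s \<in> S - {f}" for s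
    proof -
      obtain \<mu>' where \<mu>': "\<mu>' \<in> eigenvalues L" "s \<in> b \<mu>'" using s Sb by blast
      show ?thesis
      proof (cases "\<mu>' = \<mu>")
        case True
        then have "s \<in> U" unfolding U_def using s \<mu>' by (intro cfun.span_base) auto
        then show ?thesis unfolding \<Lambda>_def by (rule c(1))
      next
        case False
        obtain k where k: "s \<in> op_ker (T \<mu>' ^^ k)" using br[OF \<mu>'(1)] \<mu>'(2) unfolding root_subspace_eq by blast
        show ?thesis unfolding \<Lambda>_def
        proof (rule sum.neutral, rule ballI)
          fix q assume "q \<in> I"
          then have "N q s = 0" unfolding N_def I_def
            by (intro \<eta>_derivative_other_root[OF k False g(1,2)]) auto
          then show "c q * N q s = 0" by simp
        qed
      qed
    qed
    have zero: "\<Lambda> 0 = 0"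
      using \<Lambda>lin[OF zero_L2 zero_L2, of 1] by (simp add: cscale_zero)
    have \<Lambda>span: "\<Lambda> u = 0" if "u \<in> cfun.span (S - {f})" for u
    proof -
      have "cfun.subspace {u \<in> L2. \<Lambda> u = 0}"
        unfolding cfun.subspace_def
      proof (intro conjI ballI allI)
        show "0 \<in> {u \<in> L2. \<Lambda> u = 0}" using zero zero_L2 by simp
        show "x + y \<in> {u \<in> L2. \<Lambda> u = 0}" if "x \<in> {u \<in> L2. \<Lambda> u = 0}" "y \<in> {u \<in> L2. \<Lambda> u = 0}" for x y
          using that \<Lambda>lin[of x y 1] add_L2[of x y] by (simp add: cscale_1)
        show "cscale a x \<in> {u \<in> L2. \<Lambda> u = 0}" if "x \<in> {u \<in> L2. \<Lambda> u = 0}" for a x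
          using that \<Lambda>lin[OF zero_L2, of x a] cscale_L2[of x a] zero by simp
      qed
      moreover have "S - {f} \<subseteq> {u \<in> L2. \<Lambda> u = 0}" using SL \<Lambda>S by blast
      ultimately have "cfun.span (S - {f}) \<subseteq> {u \<in> L2. \<Lambda> u = 0}" by (rule cfun.span_minimal[rotated])
      then show ?thesis using that by blast
    qed
    obtain K where K: "0 \<le> K" "\<And>u. u \<in> L2 \<Longrightarrow> norm (\<Lambda> u) \<le> K * L2_norm u"
    proof -
      have "\<exists>B. \<forall>q. B q \<ge> 0 \<and> (\<forall>u\<in>L2. norm (N q u) \<le> B q * L2_norm u)"
        unfolding N_def using \<eta>_derivative_bound by (intro choice allI) blast
      then obtain B where B: "\<And>q. 0 \<le> B q" "\<And>q u. u \<in> L2 \<Longrightarrow> norm (N q u) \<le> B q * L2_norm u" by blast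
      show ?thesis
      proof (rule that)
        show "0 \<le> (\<Sum>q\<in>I. norm (c q) * B q)" using B(1) by (intro sum_nonneg) simp
        show "norm (\<Lambda> u) \<le> (\<Sum>q\<in>I. norm (c q) * B q) * L2_norm u" if "u \<in> L2" for u
          unfolding \<Lambda>_def sum_distrib_right
          by (intro sum_norm_le) (simp add: norm_mult mult.assoc mult_left_mono B(2)[OF that])
      qed
    qed
    \<comment> \<open>Any radius whose product with \<open>K\<close> is below 1 works; adding 1
      covers \<open>K = 0\<close>.\<close>
    have "1 / (K + 1) > 0" using K(1) by simp
    then obtain w where w: "w \<in> cfun.span (S - {f})" "L2_norm (f - w) < 1 / (K + 1)"
      using cl unfolding L2_closure_def by blast
    have "S - {f} \<subseteq> L2" using SL by blast
    then have wL: "w \<in> L2" using w(1) cfun.span_minimal[OF _ subspace_L2] by blast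
    have "\<Lambda> (f - w) = 1"
      using \<Lambda>lin[OF fL wL, of "- 1"] \<Lambda>span[OF w(1)] c(2) by (simp add: cscale_minus1 \<Lambda>_def)
    then have "1 \<le> K * L2_norm (f - w)"
      using K(2)[OF diff_L2[OF fL wL]] by simp
    also have "\<dots> \<le> K * (1 / (K + 1))" using w(2) K(1) by (intro mult_left_mono) auto
    also have "\<dots> < 1" using K(1) by (simp add: field_simps)
    finally show False by simp
  qed
  then show ?thesis using SL by (simp add: minimal_system_def)
qed

end

theorem proposition1p4:
  fixes Q12 Q21 :: "real \<Rightarrow> complex" and C D :: "complex^2^2"
    and S :: "(real \<Rightarrow> complex^2) set"
  assumes "continuous_on {0..1} Q12" and "continuous_on {0..1} Q21"
    and "rank (block_row C D) = 2"
    and "J13 C D * Q12 0 - J42 C D * Q21 1 \<noteq> 0"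
    and "J13 C D * Q12 1 - J42 C D * Q21 0 \<noteq> 0"
    and "root_function_system (op_L C D (Q_mat Q12 Q21)) S"
  shows "complete_system S \<and> minimal_system S"
proof -
  interpret dirac_operator Q12 Q21 C D
    using assms(1,2,4,5) by unfold_locales (simp_all add: J13_def J42_def det_2)
  show ?thesis
    using root_functions_complete[OF assms(6)] root_functions_minimal[OF assms(6)] ..
qed

end
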